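(* Let $T$ be a standard Young tableau of shape $\lambda\vdash n$. The eigenvalue $\mathrm{eig}(T)$ of $P_n$ corresponding to $T$ (that is, the eigenvalue of $\frac1nQ_n$ on the eigenvector $v_T$ defined in the context) is $$\mathrm{eig}(T)=\frac1n\sum_{(i,j)}\frac{j-i+1}{T(i,j)},$$ where the sum is over all boxes $(i,j)$ of $T$.
   Context: $P_n$ is the probability distribution on $S_n$ with $P_n((i\,j))=\frac1{nj}$ for $1\le i<j\le n$, $P_n(\mathrm{id})=\frac1n\sum_{j=1}^n\frac1j$, and $P_n(\tau)=0$ otherwise. As an element of the group algebra $\mathfrak S_n=\mathbb C[S_n]$ it is $\sum_\tau P_n(\tau)\tau=\frac1nQ_n$, where $Q_n=\sum_{1\le i\le j\le n}\frac1j(i\,j)$ with $(i\,i)=\mathrm{id}$. A partition $\lambda\vdash n$ is identified with its Young diagram; box $(i,j)$ is in row $i$ (rows numbered downwards), column $j$, and $T(i,j)$ is the entry of $T$ in that box. A standard Young tableau (SYT) of shape $\lambda\vdash n$ has entries $1,\dots,n$, once each, increasing along rows and down columns; $d_\lambda$ is the number of SYT of shape $\lambda$. Eigenvector attached to $T$. Let $W^n$ be the set of words $w_1\cdot\ldots\cdot w_n$ of length $n$ with letters in $[n]=\{1,\dots,n\}$, and $M^n$ the complex vector space with basis $W^n$; $S_n$ acts by place permutations, $\sigma(w)=w_{\sigma^{-1}(1)}\cdot\ldots\cdot w_{\sigma^{-1}(n)}$, making $M^n$ an $\mathfrak S_n$-module. For $\lambda\vdash n$, $M^\lambda\subseteq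 M^n$ is the span of the words in which letter $i$ occurs $\lambda_i$ times for each $i$ ($\lambda$ padded with zeros). For a tableau $T$ of shape $\lambda$ with entries $1,\dots,n$ once each, $w(T)$ is the word whose letter in position $T(i,j)$ is $i$ for each box $(i,j)$. The Specht module $S^\lambda\subseteq M^\lambda$ is the span of the vectors $s(T)=\sum_{\sigma\in C_T}\mathrm{sign}(\sigma)\,w(\sigma(T))$, $T$ an SYT of shape $\lambda$, where $C_T$ is the group of permutations preserving each column's set of entries; $S^\lambda$ is simple of dimension $d_\lambda$ and occurs exactly once in $M^\lambda$. For $a\in[n+1]$ the adding operator $\Phi_a:M^n\to M^{n+1}$ appends the letter $a$: $\Phi_a(w)=w\cdot a$. If $\lambda\vdash n$ and $\mu=\lambda+e_a\vdash n+1$ (one box added in row $a$), the lifting operator is $\kappa_a^{\lambda,\mu}=\pi^\mu\circ\Phi_a:S^\lambda\to S^\mu$, where $\pi^\mu:M^\mu\to M^\mu$ is the projection onto the $S^\mu$-isotypic component. Given an SYT $T$ of size $n$, let $T_m$ be its subtableau with entries $1,\dots,m$, of shape $\lambda^{(m)}$. Put $v_{T_1}=1\in S^{(1)}$ (the one-letter word) and $v_{T_{m+1}}=\kappa_a^{\lambda^{(m)},\lambda^{(m+1)}}(v_{T_m})$, where $a$ is the row of $T$ containing $m+1$. Then $v_T=v_{T_n}\in S^{\lambda}$ is an eigenvector of $Q_n$, and $\mathrm{eig}(T)$ is the corresponding eigenvalue of $\frac1nQ_n$. *)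

theory Defs
  imports Complex_Main "HOL-Library.Function_Algebras" "HOL-Combinatorics.Permutations"
begin

text \<open>Rows, columns, positions and letters are all numbered from 1. A partition is a function
  giving the length of each row, padded with zeros; its value at the unused index 0 is 0, so that
  different functions are different partitions.\<close>

definition is_partition :: "(nat \<Rightarrow> nat) \<Rightarrow> nat \<Rightarrow> bool" where
  "is_partition lam n \<longleftrightarrow>
     lam 0 = 0 \<and> (\<forall>i\<ge>1. lam (Suc i) \<le> lam i) \<and> finite {i. lam i \<noteq> 0} \<and> (\<Sum>i | lam i \<noteq> 0. lam i) = n"

definition diagram :: "(nat \<Rightarrow> nat) \<Rightarrow> (nat \<times> nat) set" where
  "diagram lam = {(i, j). 1 \<le> i \<and> 1 \<le> j \<and> j \<le> lam i}"

type_synonym tableau = "nat \<times> nat \<Rightarrow> nat"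

text \<open>Only the values of a tableau on the boxes of the diagram are meaningful.\<close>

definition is_tableau :: "(nat \<Rightarrow> nat) \<Rightarrow> nat \<Rightarrow> tableau \<Rightarrow> bool" where
  "is_tableau lam n T \<longleftrightarrow> bij_betw T (diagram lam) {1..n}"

definition is_syt :: "(nat \<Rightarrow> nat) \<Rightarrow> nat \<Rightarrow> tableau \<Rightarrow> bool" where
  "is_syt lam n T \<longleftrightarrow> is_tableau lam n T \<and>
     (\<forall>i j j'. (i, j) \<in> diagram lam \<and> (i, j') \<in> diagram lam \<and> j < j' \<longrightarrow> T (i, j) < T (i, j')) \<and>
     (\<forall>i i' j. (i, j) \<in> diagram lam \<and> (i', j) \<in> diagram lam \<and> i < i' \<longrightarrow> T (i, j) < T (i', j))"

definition row_of :: "(nat \<Rightarrow> nat) \<Rightarrow> tableau \<Rightarrow> nat \<Rightarrow> nat" where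
  "row_of lam T k = fst (inv_into (diagram lam) T k)"

definition subshape :: "(nat \<Rightarrow> nat) \<Rightarrow> tableau \<Rightarrow> nat \<Rightarrow> nat \<Rightarrow> nat" where
  "subshape lam T m = (\<lambda>i. card {j. (i, j) \<in> diagram lam \<and> T (i, j) \<le> m})"

definition cscale :: "complex \<Rightarrow> ('a \<Rightarrow> complex) \<Rightarrow> 'a \<Rightarrow> complex" where
  "cscale c f = (\<lambda>x. c * f x)"

global_interpretation cfun: vector_space cscale
  defines cspan = cfun.span and csubspace = cfun.subspace
  by unfold_locales (auto simp: cscale_def plus_fun_def algebra_simps fun_eq_iff)

type_synonym word = "nat list"
type_synonym vect = "word \<Rightarrow> complex"

definition words :: "nat \<Rightarrow> word set" where
  "words n = {w. length w = n \<and> set w \<subseteq> {1..n}}"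

definition wvec :: "word \<Rightarrow> vect" where
  "wvec w = (\<lambda>u. if u = w then 1 else 0)"

definition word_space :: "nat \<Rightarrow> vect set" where
  "word_space n = cspan (wvec ` words n)"

definition weight_space :: "nat \<Rightarrow> (nat \<Rightarrow> nat) \<Rightarrow> vect set" where
  "weight_space n lam = cspan (wvec ` {w \<in> words n. \<forall>i\<in>{1..n}. count_list w i = lam i})"

text \<open>Linear extension to \<open>word_space n\<close> of a vector-valued map on \<open>words n\<close>.\<close>

definition lin_ext :: "nat \<Rightarrow> (word \<Rightarrow> vect) \<Rightarrow> vect \<Rightarrow> vect" where
  "lin_ext n g v = (\<Sum>w\<in>words n. cscale (v w) (g w))"

text \<open>Permutations in \<open>S_n\<close> are the functions with \<open>\<sigma> permutes {1..n}\<close>.\<close>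

definition place_perm :: "(nat \<Rightarrow> nat) \<Rightarrow> word \<Rightarrow> word" where
  "place_perm \<sigma> w = map (\<lambda>k. w ! (inv \<sigma> k - 1)) [1..<Suc (length w)]"

definition perm_act :: "nat \<Rightarrow> (nat \<Rightarrow> nat) \<Rightarrow> vect \<Rightarrow> vect" where
  "perm_act n \<sigma> = lin_ext n (\<lambda>w. wvec (place_perm \<sigma> w))"

type_synonym galg = "(nat \<Rightarrow> nat) \<Rightarrow> complex"

definition gvec :: "(nat \<Rightarrow> nat) \<Rightarrow> galg" where
  "gvec \<sigma> = (\<lambda>\<tau>. if \<tau> = \<sigma> then 1 else 0)"

definition galg_act :: "nat \<Rightarrow> galg \<Rightarrow> vect \<Rightarrow> vect" where
  "galg_act n a v = (\<Sum>\<sigma> | \<sigma> permutes {1..n}. cscale (a \<sigma>) (perm_act n \<sigma> v))"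

definition walk_sum :: "nat \<Rightarrow> galg" where
  "walk_sum n = (\<Sum>j\<in>{1..n}. \<Sum>i\<in>{1..j}. cscale (1 / of_nat j) (gvec (transpose i j)))"

text \<open>The sum in the second branch has at most one term.\<close>

definition walk_prob :: "nat \<Rightarrow> (nat \<Rightarrow> nat) \<Rightarrow> real" where
  "walk_prob n \<tau> = (if \<tau> = id then 1 / real n * (\<Sum>j\<in>{1..n}. 1 / real j)
     else \<Sum>(i, j) | 1 \<le> i \<and> i < j \<and> j \<le> n \<and> \<tau> = transpose i j. 1 / (real n * real j))"

lemma transpose_inj_ordered:
  assumes "i < j" "i' < j'" "transpose i j = transpose i' (j' :: nat)"
  shows "i = i' \<and> j = j'"
proof -
  have "transpose i' j' i = j" "transpose i' j' j = i"
    using assms(3) by (metis transpose_apply_first, metis transpose_apply_second)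
  then show ?thesis using assms(1,2) by (auto simp: transpose_def split: if_splits)
qed

lemma walk_prob_transpose:
  assumes "1 \<le> i" "i < j" "j \<le> n"
  shows "walk_prob n (transpose i j) = 1 / (real n * real j)"
proof -
  have "{(i', j'). 1 \<le> i' \<and> i' < j' \<and> j' \<le> n \<and> transpose i j = transpose i' j'} = {(i, j)}"
    using assms transpose_inj_ordered[OF assms(2)] by auto
  moreover have "transpose i j \<noteq> id"
    using assms by (metis id_apply less_irrefl transpose_apply_first)
  ultimately show ?thesis by (simp add: walk_prob_def)
qed

lemma walk_prob_eq_walk_sum:
  "(\<lambda>\<tau>. complex_of_real (walk_prob n \<tau>)) = cscale (1 / of_nat n) (walk_sum n)"
proof
  fix \<tau> :: "nat \<Rightarrow> nat"
  let ?c = "\<lambda>i j. if \<tau> = transpose i j then 1 / complex_of_nat j else 0"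
  have sum_app: "(\<Sum>x\<in>A. f x) y = (\<Sum>x\<in>A. f x y)" for A and f :: "nat \<Rightarrow> galg" and y
    by (induction A rule: infinite_finite_induct) auto
  have "walk_sum n \<tau> = (\<Sum>j\<in>{1..n}. \<Sum>i\<in>{1..j}. ?c i j)"
    unfolding walk_sum_def sum_app
    by (intro sum.cong refl) (simp add: cscale_def gvec_def)
  also have "\<dots> = (\<Sum>j\<in>{1..n}. (if \<tau> = id then 1 / of_nat j else 0) + (\<Sum>i\<in>{1..<j}. ?c i j))"
  proof (intro sum.cong refl)
    fix j assume "j \<in> {1..n}"
    then have "{1..j} = insert j {1..<j}" by auto
    then show "(\<Sum>i\<in>{1..j}. ?c i j)
        = (if \<tau> = id then 1 / of_nat j else 0) + (\<Sum>i\<in>{1..<j}. ?c i j)"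
      by simp
  qed
  finally have Q: "walk_sum n \<tau>
      = (\<Sum>j\<in>{1..n}. (if \<tau> = id then 1 / of_nat j else 0) + (\<Sum>i\<in>{1..<j}. ?c i j))" .
  show "complex_of_real (walk_prob n \<tau>) = cscale (1 / of_nat n) (walk_sum n) \<tau>"
  proof (cases "\<tau> = id")
    case True
    have "?c i j = 0" if "i < j" for i j
      using True that by (metis id_apply less_irrefl transpose_apply_first)
    then have "walk_sum n \<tau> = (\<Sum>j\<in>{1..n}. 1 / of_nat j)"
      unfolding Q using True by simp
    then show ?thesis using True by (simp add: walk_prob_def cscale_def)
  next
    case False
    let ?D = "SIGMA j:{1..n}. {1..<j}"
    let ?E = "{(i, j). 1 \<le> i \<and> i < j \<and> j \<le> n \<and> \<tau> = transpose i j}"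
    have "walk_sum n \<tau> = (\<Sum>(j, i)\<in>?D. ?c i j)"
      unfolding Q using False by (simp add: sum.Sigma)
    also have "\<dots> = (\<Sum>(j, i)\<in>{(j, i). (i, j) \<in> ?E}. 1 / of_nat j)"
      by (rule sum.mono_neutral_cong_right) (auto split: if_splits)
    also have "\<dots> = (\<Sum>(i, j)\<in>?E. 1 / of_nat j)"
      by (rule sum.reindex_bij_witness[of _ prod.swap prod.swap]) auto
    finally show ?thesis using False
      by (simp add: walk_prob_def cscale_def sum_divide_distrib mult.commute case_prod_unfold)
  qed
qed

definition tab_word :: "(nat \<Rightarrow> nat) \<Rightarrow> nat \<Rightarrow> tableau \<Rightarrow> word" where
  "tab_word lam n T = map (row_of lam T) [1..<Suc n]"

definition col_group :: "(nat \<Rightarrow> nat) \<Rightarrow> nat \<Rightarrow> tableau \<Rightarrow> (nat \<Rightarrow> nat) set" where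
  "col_group lam n T = {\<sigma>. \<sigma> permutes {1..n} \<and>
     (\<forall>j. \<sigma> ` {T (i, j) | i. (i, j) \<in> diagram lam} = {T (i, j) | i. (i, j) \<in> diagram lam})}"

definition specht_vec :: "(nat \<Rightarrow> nat) \<Rightarrow> nat \<Rightarrow> tableau \<Rightarrow> vect" where
  "specht_vec lam n T =
     (\<Sum>\<sigma>\<in>col_group lam n T. cscale (of_int (sign \<sigma>)) (wvec (tab_word lam n (\<sigma> \<circ> T))))"

definition specht :: "nat \<Rightarrow> (nat \<Rightarrow> nat) \<Rightarrow> vect set" where
  "specht n lam = cspan {specht_vec lam n T | T. is_syt lam n T}"

definition is_submodule :: "nat \<Rightarrow> vect set \<Rightarrow> bool" where
  "is_submodule n U \<longleftrightarrow> csubspace U \<and> U \<subseteq> word_space n \<and>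
     (\<forall>\<sigma> v. \<sigma> permutes {1..n} \<and> v \<in> U \<longrightarrow> perm_act n \<sigma> v \<in> U)"

definition is_simple :: "nat \<Rightarrow> vect set \<Rightarrow> bool" where
  "is_simple n U \<longleftrightarrow> is_submodule n U \<and> U \<noteq> {0} \<and>
     (\<forall>V. is_submodule n V \<and> V \<subseteq> U \<longrightarrow> V = {0} \<or> V = U)"

definition iso_modules :: "nat \<Rightarrow> vect set \<Rightarrow> vect set \<Rightarrow> bool" where
  "iso_modules n U V \<longleftrightarrow> (\<exists>\<phi>. bij_betw \<phi> U V \<and>
     (\<forall>u\<in>U. \<forall>u'\<in>U. \<phi> (u + u') = \<phi> u + \<phi> u') \<and>
     (\<forall>c. \<forall>u\<in>U. \<phi> (cscale c u) = cscale c (\<phi> u)) \<and>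
     (\<forall>\<sigma>. \<sigma> permutes {1..n} \<longrightarrow> (\<forall>u\<in>U. \<phi> (perm_act n \<sigma> u) = perm_act n \<sigma> (\<phi> u))))"

definition isotypic :: "nat \<Rightarrow> vect set \<Rightarrow> vect set \<Rightarrow> vect set" where
  "isotypic n M S = cspan (\<Union>{U. is_simple n U \<and> U \<subseteq> M \<and> iso_modules n U S})"

definition isotypic_rest :: "nat \<Rightarrow> vect set \<Rightarrow> vect set \<Rightarrow> vect set" where
  "isotypic_rest n M S = cspan (\<Union>{U. is_simple n U \<and> U \<subseteq> M \<and> \<not> iso_modules n U S})"

text \<open>For a semisimple module \<open>M\<close> and a simple module \<open>S\<close>, \<open>M\<close> is the direct sum of its
  \<open>S\<close>-isotypic component and of its other isotypic components; the projection is along the latter.\<close>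

definition isotypic_proj :: "nat \<Rightarrow> vect set \<Rightarrow> vect set \<Rightarrow> vect \<Rightarrow> vect" where
  "isotypic_proj n M S v = (THE u. u \<in> isotypic n M S \<and> v - u \<in> isotypic_rest n M S)"

definition add_letter :: "nat \<Rightarrow> nat \<Rightarrow> vect \<Rightarrow> vect" where
  "add_letter n a = lin_ext n (\<lambda>w. wvec (w @ [a]))"

text \<open>Here \<open>n\<close> is the size of the source, so that \<open>\<mu>\<close> is a partition of \<open>n + 1\<close>.\<close>

definition lifting :: "nat \<Rightarrow> nat \<Rightarrow> (nat \<Rightarrow> nat) \<Rightarrow> vect \<Rightarrow> vect" where
  "lifting n a \<mu> v =
     isotypic_proj (Suc n) (weight_space (Suc n) \<mu>) (specht (Suc n) \<mu>) (add_letter n a v)"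

text \<open>\<open>tab_vec lam T m\<close> is the vector of the subtableau of \<open>T\<close> with entries \<open>1, \<dots>, m\<close>;
  the value at \<open>m = 0\<close> is irrelevant.\<close>

fun tab_vec :: "(nat \<Rightarrow> nat) \<Rightarrow> tableau \<Rightarrow> nat \<Rightarrow> vect" where
  "tab_vec lam T 0 = 0"
| "tab_vec lam T (Suc 0) = wvec [1]"
| "tab_vec lam T (Suc (Suc m)) =
     lifting (Suc m) (row_of lam T (Suc (Suc m))) (subshape lam T (Suc (Suc m))) (tab_vec lam T (Suc m))"

definition is_eigenvector :: "nat \<Rightarrow> galg \<Rightarrow> complex \<Rightarrow> vect \<Rightarrow> bool" where
  "is_eigenvector n a c v \<longleftrightarrow> v \<noteq> 0 \<and> galg_act n a v = cscale c v"

definition eig :: "(nat \<Rightarrow> nat) \<Rightarrow> nat \<Rightarrow> tableau \<Rightarrow> complex" where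
  "eig lam n T = (THE c. is_eigenvector n (cscale (1 / of_nat n) (walk_sum n)) c (tab_vec lam T n))"

end

theory Submission
  imports Defs
begin

text \<open>
  Let \<open>X\<^sub>k = \<Sum>\<^bsub>i<k\<^esub> (i k)\<close> be the Jucys--Murphy elements. Since \<open>Q\<^sub>n = \<Sum>\<^sub>k (1 + X\<^sub>k) / k\<close>, the
  theorem follows once \<open>v\<^sub>T\<close> is known to be a nonzero joint eigenvector of all \<open>X\<^sub>k\<close>, the eigenvalue
  of \<open>X\<^sub>k\<close> being the content \<open>j - i\<close> of the box \<open>(i, j)\<close> that contains \<open>k\<close>. This is proved by
  adding the boxes of \<open>T\<close> one at a time (\<open>jucys_murphy_tab_vec\<close>). Appending a letter and projecting
  to an isotypic component both commute with \<open>X\<^sub>1, \<dots>, X\<^sub>m\<close>, so the eigenvalues found so far persist.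
  The new element \<open>X\<^bsub>m+1\<^esub>\<close> is the sum of all transpositions of \<open>S\<^bsub>m+1\<^esub>\<close> minus \<open>X\<^sub>1 + \<dots> + X\<^sub>m\<close>, and the
  sum of all transpositions acts on a Specht module as the sum of the contents of the boxes
  (\<open>transposition_sum_specht\<close>); the difference of the two is the content of the new box.

  Three facts about Specht modules support this argument.

  First, the span of the vectors \<open>s(T)\<close> with \<open>T\<close> standard is stable under all permutations. Instead of
  straightening by Garnir relations, \<open>specht_eq_hw_space\<close> identifies it with the space of highest
  weight vectors, that is, of the vectors of weight \<open>\<lambda>\<close> killed by every operator that replaces one
  occurrence of a letter by a smaller letter. That space is visibly stable, and sorting its vectors by
  their largest last letter reduces it to the same spaces for one box less.

  Second, the projection to the isotypic component of \<open>S\<^sup>\<lambda>\<close> in \<open>M\<^sup>\<lambda>\<close> is the orthogonal projection to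
  \<open>S\<^sup>\<lambda>\<close> for the inner product in which words are orthonormal. This rests on the submodule theorem of
  James (\<open>submodule_theorem\<close>): a submodule of \<open>M\<^sup>\<lambda>\<close> contains \<open>S\<^sup>\<lambda>\<close> or is orthogonal to it.

  Third, the projected vector is not zero. Appending the letter \<open>a\<close> is adjoint to removing a last
  letter \<open>a\<close>, and the latter operator maps \<open>S\<^sup>\<mu>\<close> onto a space that contains \<open>S\<^sup>\<lambda>\<close>, because a standard
  tableau of shape \<open>\<lambda>\<close> extends to one of shape \<open>\<mu>\<close> (\<open>specht_restriction\<close>). So a vector of \<open>S\<^sup>\<lambda>\<close> whose
  image were orthogonal to \<open>S\<^sup>\<mu>\<close> would be orthogonal to itself.
\<close>

section \<open>Coefficient functions of vectors\<close>

lemma sum_fun_apply: "(\<Sum>x\<in>A. f x) y = (\<Sum>x\<in>A. f x y)"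
  for f :: "'a \<Rightarrow> 'b \<Rightarrow> 'c::comm_monoid_add"
  by (induction A rule: infinite_finite_induct) auto

lemma cscale_apply [simp]: "cscale c f x = c * f x"
  by (simp add: cscale_def)

lemma finite_words [simp]: "finite (words n)"
  unfolding words_def using finite_lists_length_eq[of "{1..n}" n] by (simp add: conj_commute)

lemma length_words: "w \<in> words n \<Longrightarrow> length w = n"
  by (simp add: words_def)

lemma span_wvec:
  assumes "finite A"
  shows "cspan (wvec ` A) = {v. \<forall>x. x \<notin> A \<longrightarrow> v x = 0}"
proof
  have "csubspace {v :: vect. \<forall>x. x \<notin> A \<longrightarrow> v x = 0}"
    by (rule cfun.subspaceI) auto
  then show "cspan (wvec ` A) \<subseteq> {v. \<forall>x. x \<notin> A \<longrightarrow> v x = 0}"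
    by (rule cfun.span_minimal[rotated]) (auto simp: wvec_def)
  show "{v. \<forall>x. x \<notin> A \<longrightarrow> v x = 0} \<subseteq> cspan (wvec ` A)"
  proof
    fix v :: vect assume v: "v \<in> {v. \<forall>x. x \<notin> A \<longrightarrow> v x = 0}"
    have "v = (\<Sum>w\<in>A. cscale (v w) (wvec w))"
      using v assms by (auto simp: fun_eq_iff sum_fun_apply wvec_def if_distrib cong: if_cong)
    then show "v \<in> cspan (wvec ` A)"
      by (metis (no_types, lifting) cfun.span_base cfun.span_scale cfun.span_sum imageI)
  qed
qed

definition weight_words :: "nat \<Rightarrow> (nat \<Rightarrow> nat) \<Rightarrow> word set" where
  "weight_words n lam = {w \<in> words n. \<forall>i\<in>{1..n}. count_list w i = lam i}"

lemma weight_words_subset: "weight_words n lam \<subseteq> words n"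
  by (auto simp: weight_words_def)

lemma in_word_space: "v \<in> word_space n \<longleftrightarrow> (\<forall>x. x \<notin> words n \<longrightarrow> v x = 0)"
  by (simp add: word_space_def span_wvec)

lemma in_weight_space: "v \<in> weight_space n lam \<longleftrightarrow> (\<forall>x. x \<notin> weight_words n lam \<longrightarrow> v x = 0)"
  unfolding weight_space_def weight_words_def[symmetric]
  using span_wvec[of "weight_words n lam"] finite_subset[OF weight_words_subset, of n lam] by simp

lemma weight_space_subset: "weight_space n lam \<subseteq> word_space n"
  using weight_words_subset[of n lam] unfolding in_word_space in_weight_space subset_iff by blast

lemma subspace_word_space: "csubspace (word_space n)"
  by (simp add: word_space_def)

lemma subspace_weight_space: "csubspace (weight_space n lam)"
  by (simp add: weight_space_def)

lemma wvec_in_word_space: "w \<in> words n \<Longrightarrow> wvec w \<in> word_space n"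
  by (auto simp: in_word_space wvec_def)

lemma wvec_in_weight_space: "w \<in> weight_words n lam \<Longrightarrow> wvec w \<in> weight_space n lam"
  by (auto simp: in_weight_space wvec_def)

section \<open>Place permutations\<close>

lemma length_place_perm [simp]: "length (place_perm \<sigma> w) = length w"
  by (simp add: place_perm_def del: upt_Suc)

lemma nth_place_perm:
  "k < length w \<Longrightarrow> place_perm \<sigma> w ! k = w ! (inv \<sigma> (Suc k) - 1)"
  by (simp add: place_perm_def del: upt_Suc)

lemma place_perm_id [simp]: "place_perm id w = w"
proof (rule nth_equalityI)
  fix k assume "k < length (place_perm id w)"
  then show "place_perm id w ! k = w ! k" by (simp add: nth_place_perm inv_id)
qed simp

lemma permutes_range:
  assumes "\<sigma> permutes {1..n}" "k < n"
  shows "\<sigma> (Suc k) \<ge> 1" "\<sigma> (Suc k) \<le> n" "\<sigma> (Suc k) - 1 < n" "Suc (\<sigma> (Suc k) - 1) = \<sigma> (Suc k)"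
proof -
  have "\<sigma> (Suc k) \<in> {1..n}" using assms permutes_in_image[OF assms(1)] by simp
  then show "\<sigma> (Suc k) \<ge> 1" "\<sigma> (Suc k) \<le> n" "\<sigma> (Suc k) - 1 < n" "Suc (\<sigma> (Suc k) - 1) = \<sigma> (Suc k)"
    by auto
qed

lemma place_perm_comp:
  assumes "\<sigma> permutes {1..n}" "\<tau> permutes {1..n}" "length w = n"
  shows "place_perm \<sigma> (place_perm \<tau> w) = place_perm (\<sigma> \<circ> \<tau>) w"
proof (rule nth_equalityI)
  fix k assume "k < length (place_perm \<sigma> (place_perm \<tau> w))"
  then have k: "k < n" using assms by simp
  have "inv (\<sigma> \<circ> \<tau>) = inv \<tau> \<circ> inv \<sigma>"
    using assms by (simp add: o_inv_distrib permutes_bij)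
  then show "place_perm \<sigma> (place_perm \<tau> w) ! k = place_perm (\<sigma> \<circ> \<tau>) w ! k"
    using k assms permutes_range[OF permutes_inv[OF assms(1)] k] by (simp add: nth_place_perm)
qed simp

lemma place_perm_inv:
  assumes "\<sigma> permutes {1..n}" "length w = n"
  shows "place_perm \<sigma> (place_perm (inv \<sigma>) w) = w" "place_perm (inv \<sigma>) (place_perm \<sigma> w) = w"
  using place_perm_comp[OF assms(1) permutes_inv[OF assms(1)] assms(2)]
    place_perm_comp[OF permutes_inv[OF assms(1)] assms(1) assms(2)] permutes_inv_o[OF assms(1)]
  by simp_all

lemma mset_place_perm:
  assumes "\<sigma> permutes {1..n}" "length w = n"
  shows "mset (place_perm \<sigma> w) = mset w"
proof -
  have "mset (place_perm \<sigma> w) = image_mset (\<lambda>k. w ! (k - 1)) (image_mset (inv \<sigma>) (mset_set {1..n}))"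
    using assms(2) by (simp add: place_perm_def multiset.map_comp o_def del: upt_Suc)
      (simp add: atLeastLessThanSuc_atLeastAtMost)
  also have "image_mset (inv \<sigma>) (mset_set {1..n}) = mset_set {1..n}"
    by (rule permutes_image_mset[OF permutes_inv[OF assms(1)]])
  also have "image_mset (\<lambda>k. w ! (k - 1)) (mset_set {1..n}) = mset (place_perm id w)"
    using assms(2) by (simp add: place_perm_def inv_id del: upt_Suc place_perm_id)
      (simp add: atLeastLessThanSuc_atLeastAtMost)
  finally show ?thesis by simp
qed

lemma place_perm_in_words:
  assumes "\<sigma> permutes {1..n}" "w \<in> words n"
  shows "place_perm \<sigma> w \<in> words n"
  using assms mset_place_perm[of \<sigma> n w] mset_eq_setD[of "place_perm \<sigma> w" w] by (auto simp: words_def)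

lemma place_perm_in_weight_words:
  assumes "\<sigma> permutes {1..n}" "w \<in> weight_words n lam"
  shows "place_perm \<sigma> w \<in> weight_words n lam"
proof -
  have "length w = n" "w \<in> words n" using assms by (auto simp: words_def weight_words_def)
  then show ?thesis
    using assms mset_place_perm[of \<sigma> n w] place_perm_in_words[of \<sigma> n w]
    by (simp add: weight_words_def count_mset[symmetric])
qed

lemma bij_betw_place_perm:
  assumes "\<sigma> permutes {1..n}"
  shows "bij_betw (place_perm \<sigma>) (words n) (words n)"
  using place_perm_in_words[OF assms] place_perm_in_words[OF permutes_inv[OF assms]]
  by (intro bij_betw_byWitness[where f' = "place_perm (inv \<sigma>)"])
    (auto simp: place_perm_inv[OF assms] length_words)

text \<open>Permuting places is a bijection of the words, so on coefficient functions it is a substitution. All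
  later computations with the action go through this formula.\<close>

lemma perm_act_apply:
  assumes "\<sigma> permutes {1..n}"
  shows "perm_act n \<sigma> v x = (if x \<in> words n then v (place_perm (inv \<sigma>) x) else 0)"
proof -
  have eq: "x = place_perm \<sigma> w \<longleftrightarrow> x \<in> words n \<and> w = place_perm (inv \<sigma>) x" if "w \<in> words n" for w
    using that place_perm_inv[OF assms] place_perm_in_words[OF assms that]
    by (auto simp: length_words)
  have "perm_act n \<sigma> v x = (\<Sum>w\<in>words n. if x = place_perm \<sigma> w then v w else 0)"
    by (simp add: perm_act_def lin_ext_def sum_fun_apply wvec_def if_distrib cong: if_cong)
  also have "\<dots> = (\<Sum>w\<in>words n. if w = place_perm (inv \<sigma>) x then if x \<in> words n then v w else 0 else 0)"
    by (rule sum.cong) (auto simp: eq)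
  also have "\<dots> = (if x \<in> words n then v (place_perm (inv \<sigma>) x) else 0)"
    using place_perm_in_words[OF permutes_inv[OF assms]] by simp
  finally show ?thesis .
qed

lemma perm_act_comp:
  assumes "\<sigma> permutes {1..n}" "\<tau> permutes {1..n}"
  shows "perm_act n \<sigma> (perm_act n \<tau> v) = perm_act n (\<sigma> \<circ> \<tau>) v"
proof
  fix x
  have "inv (\<sigma> \<circ> \<tau>) = inv \<tau> \<circ> inv \<sigma>"
    using assms by (simp add: o_inv_distrib permutes_bij)
  then show "perm_act n \<sigma> (perm_act n \<tau> v) x = perm_act n (\<sigma> \<circ> \<tau>) v x"
    using place_perm_in_words[OF permutes_inv[OF assms(1)], of x]
    by (simp add: perm_act_apply assms permutes_compose permutes_inv length_words
        place_perm_comp[where n = n] del: One_nat_def)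
qed

lemma perm_act_id: "v \<in> word_space n \<Longrightarrow> perm_act n id v = v"
  using permutes_id[of "{1..n}"]
  by (intro ext) (simp add: perm_act_apply inv_id in_word_space)

lemma perm_act_wvec:
  assumes "\<sigma> permutes {1..n}" "w \<in> words n"
  shows "perm_act n \<sigma> (wvec w) = wvec (place_perm \<sigma> w)"
  using assms place_perm_inv[OF assms(1)] place_perm_in_words[OF assms]
  by (intro ext) (auto simp: perm_act_apply[OF assms(1)] wvec_def length_words)

lemma perm_act_add: "perm_act n \<sigma> (u + v) = perm_act n \<sigma> u + perm_act n \<sigma> v"
  by (auto simp: perm_act_def lin_ext_def fun_eq_iff sum_fun_apply algebra_simps sum.distrib)

lemma perm_act_scale: "perm_act n \<sigma> (cscale c v) = cscale c (perm_act n \<sigma> v)"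
  by (auto simp: perm_act_def lin_ext_def fun_eq_iff sum_fun_apply sum_distrib_left algebra_simps)

lemma perm_act_zero [simp]: "perm_act n \<sigma> 0 = 0"
  by (auto simp: perm_act_def lin_ext_def fun_eq_iff sum_fun_apply)

lemma perm_act_sum: "perm_act n \<sigma> (\<Sum>i\<in>A. f i) = (\<Sum>i\<in>A. perm_act n \<sigma> (f i))"
  by (induction A rule: infinite_finite_induct)
    (simp_all only: sum.infinite sum.empty sum.insert perm_act_zero perm_act_add not_False_eq_True)

lemma perm_act_in_weight_space:
  assumes "\<sigma> permutes {1..n}" "v \<in> weight_space n lam"
  shows "perm_act n \<sigma> v \<in> weight_space n lam"
proof -
  have "perm_act n \<sigma> v x = 0" if "x \<notin> weight_words n lam" for x
  proof (cases "x \<in> words n")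
    case True
    then have "place_perm (inv \<sigma>) x \<notin> weight_words n lam"
      using that assms(1) place_perm_in_weight_words[OF assms(1), of "place_perm (inv \<sigma>) x" lam]
      by (auto simp: place_perm_inv length_words)
    then show ?thesis using assms by (simp add: perm_act_apply in_weight_space)
  qed (use assms in \<open>simp add: perm_act_apply\<close>)
  then show ?thesis by (simp add: in_weight_space)
qed

lemma is_submodule_weight_space: "is_submodule n (weight_space n lam)"
  unfolding is_submodule_def
  using subspace_weight_space weight_space_subset perm_act_in_weight_space by blast

section \<open>The invariant inner product\<close>

definition iprod :: "nat \<Rightarrow> vect \<Rightarrow> vect \<Rightarrow> complex" where
  "iprod n u v = (\<Sum>x\<in>words n. u x * cnj (v x))"

lemma iprod_add_left: "iprod n (u + u') v = iprod n u v + iprod n u' v"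
  and iprod_diff_left: "iprod n (u - u') v = iprod n u v - iprod n u' v"
  and iprod_scale_left: "iprod n (cscale c u) v = c * iprod n u v"
  and iprod_zero_left [simp]: "iprod n 0 v = 0"
  and iprod_add_right: "iprod n u (v + v') = iprod n u v + iprod n u v'"
  and iprod_scale_right: "iprod n u (cscale c v) = cnj c * iprod n u v"
  and iprod_zero_right [simp]: "iprod n u 0 = 0"
  by (simp_all add: iprod_def algebra_simps sum.distrib sum_subtractf sum_distrib_left)

lemma iprod_commute: "iprod n u v = cnj (iprod n v u)"
  by (simp add: iprod_def mult.commute)

lemma iprod_sum_left: "iprod n (\<Sum>i\<in>A. f i) v = (\<Sum>i\<in>A. iprod n (f i) v)"
  by (induction A rule: infinite_finite_induct)
    (simp_all only: sum.infinite sum.empty sum.insert iprod_zero_left iprod_add_left not_False_eq_True)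

lemma iprod_sum_right: "iprod n v (\<Sum>i\<in>A. f i) = (\<Sum>i\<in>A. iprod n v (f i))"
  by (induction A rule: infinite_finite_induct)
    (simp_all only: sum.infinite sum.empty sum.insert iprod_zero_right iprod_add_right not_False_eq_True)

lemma iprod_wvec: "w \<in> words n \<Longrightarrow> iprod n u (wvec w) = u w"
  by (simp add: iprod_def wvec_def if_distrib cong: if_cong)

lemma iprod_self_eq_0:
  assumes "u \<in> word_space n" "iprod n u u = 0"
  shows "u = 0"
proof -
  have "iprod n u u = of_real (\<Sum>x\<in>words n. (cmod (u x))\<^sup>2)"
    by (simp only: iprod_def of_real_sum complex_norm_square)
  then have "(\<Sum>x\<in>words n. (cmod (u x))\<^sup>2) = 0"
    using assms(2) by (metis of_real_eq_0_iff)
  then have "\<forall>x\<in>words n. u x = 0" by (simp add: sum_nonneg_eq_0_iff)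
  then show ?thesis using assms(1) by (auto simp: in_word_space fun_eq_iff)
qed

lemma iprod_perm_act:
  assumes "\<sigma> permutes {1..n}"
  shows "iprod n (perm_act n \<sigma> u) v = iprod n u (perm_act n (inv \<sigma>) v)"
proof -
  have "iprod n (perm_act n \<sigma> u) v
      = (\<Sum>x\<in>words n. perm_act n \<sigma> u (place_perm \<sigma> x) * cnj (v (place_perm \<sigma> x)))"
    unfolding iprod_def by (rule sum.reindex_bij_betw[OF bij_betw_place_perm[OF assms], symmetric])
  also have "\<dots> = iprod n u (perm_act n (inv \<sigma>) v)"
    unfolding iprod_def using assms place_perm_in_words[OF assms]
    by (intro sum.cong refl)
      (auto simp: perm_act_apply permutes_inv permutes_inv_inv place_perm_inv length_words)
  finally show ?thesis .
qed

text \<open>One step of Gram--Schmidt: a new spanning vector \<open>b\<close> is replaced by its component \<open>d\<close> orthogonal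
  to the span of the earlier ones.\<close>

lemma orthogonal_projection_exists:
  assumes "finite B" "B \<subseteq> word_space n"
  shows "\<exists>p\<in>cspan B. \<forall>s\<in>cspan B. iprod n (v - p) s = 0"
  using assms
proof (induction B arbitrary: v)
  case empty
  have "\<exists>p\<in>cspan {}. \<forall>s\<in>cspan {}. iprod n (v - p) s = 0" for v
    by (simp only: cfun.span_empty bex_simps ball_simps iprod_zero_right simp_thms)
  then show ?case .
next
  case (insert b B)
  then have B: "B \<subseteq> word_space n" and b: "b \<in> word_space n" by auto
  obtain q where q: "q \<in> cspan B" "\<forall>s\<in>cspan B. iprod n (b - q) s = 0"
    by (rule bexE[OF insert.IH[OF B, of b]])
  obtain p where p: "p \<in> cspan B" "\<forall>s\<in>cspan B. iprod n (v - p) s = 0"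
    by (rule bexE[OF insert.IH[OF B, of v]])
  define d where "d = b - q"
  have qs: "q \<in> word_space n"
    using q(1) cfun.span_minimal[OF B subspace_word_space] by (rule rev_subsetD)
  then have ds: "d \<in> word_space n"
    unfolding d_def by (rule cfun.subspace_diff[OF subspace_word_space b])
  (* The division below is by 0 exactly when d = 0, and then the correction term vanishes. *)
  define c where "c = iprod n (v - p) d / iprod n d d"
  define p' where "p' = p + cscale c d"
  have span: "s \<in> cspan (insert b B) \<longleftrightarrow> (\<exists>k. s - cscale k b \<in> cspan B)" for s
    by (simp only: cfun.span_insert mem_Collect_eq)
  have mono: "x \<in> cspan (insert b B)" if "x \<in> cspan B" for x
    using that cfun.span_mono[OF subset_insertI] by (rule rev_subsetD)
  have d_in: "d \<in> cspan (insert b B)"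
    unfolding d_def by (rule cfun.span_diff[OF cfun.span_base[OF insertI1] mono[OF q(1)]])
  have "p' \<in> cspan (insert b B)"
    unfolding p'_def by (rule cfun.span_add[OF mono[OF p(1)] cfun.span_scale[OF d_in]])
  moreover have "iprod n (v - p') s = 0" if s_in: "s \<in> cspan (insert b B)" for s
  proof -
    obtain k where k: "s - cscale k b \<in> cspan B" by (rule exE[OF iffD1[OF span s_in]])
    define t where "t = s - cscale k b + cscale k q"
    have t: "t \<in> cspan B" unfolding t_def by (rule cfun.span_add[OF k cfun.span_scale[OF q(1)]])
    have s: "s = t + cscale k d"
      unfolding t_def d_def by (auto simp: fun_eq_iff algebra_simps)
    have v: "v - p' = (v - p) - cscale c d" unfolding p'_def by (simp add: algebra_simps)
    have dt: "iprod n d t = 0" using q(2) t by (simp add: d_def)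
    have "iprod n (v - p') d = 0"
    proof (cases "iprod n d d = 0")
      case True
      then have "d = 0" by (rule iprod_self_eq_0[OF ds])
      then show ?thesis by (simp only: iprod_zero_right)
    qed (simp add: v iprod_diff_left iprod_scale_left c_def)
    moreover have "iprod n (v - p') t = 0"
      using p(2) t dt by (simp add: v iprod_diff_left iprod_scale_left)
    ultimately show ?thesis by (simp add: s iprod_add_right iprod_scale_right)
  qed
  ultimately show ?case by (intro bexI ballI)
qed

lemma subspace_finite_basis:
  assumes "csubspace S" "S \<subseteq> word_space n"
  obtains B where "finite B" "B \<subseteq> S" "cspan B = S" "\<not> cfun.dependent B"
proof -
  obtain B where B: "B \<subseteq> S" "\<not> cfun.dependent B" "S \<subseteq> cspan B"
    using cfun.maximal_independent_subset[of S] by metis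
  have "finite B \<and> card B \<le> card (wvec ` words n)"
    using B(1,2) assms(2) by (intro cfun.independent_span_bound) (auto simp: word_space_def)
  moreover have "cspan B = S"
    using B(3) cfun.span_minimal[OF B(1) assms(1)] by (intro equalityI)
  ultimately show ?thesis using B(1,2) that[of B] by linarith
qed

lemma orthogonal_decomposition:
  assumes "csubspace S" "S \<subseteq> word_space n"
  shows "\<exists>p\<in>S. \<forall>s\<in>S. iprod n (v - p) s = 0"
proof -
  obtain B where B: "finite B" "B \<subseteq> S" "cspan B = S"
    using subspace_finite_basis[OF assms] .
  have "B \<subseteq> word_space n" using B(2) assms(2) by (rule order_trans)
  from orthogonal_projection_exists[OF B(1) this] show ?thesis unfolding B(3) .
qed

definition ocomp :: "nat \<Rightarrow> vect set \<Rightarrow> vect set \<Rightarrow> vect set" where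
  "ocomp n M S = {v \<in> M. \<forall>s\<in>S. iprod n v s = 0}"

lemma is_submodule_ocomp:
  assumes "is_submodule n M" "is_submodule n S"
  shows "is_submodule n (ocomp n M S)"
proof -
  have "csubspace (ocomp n M S)"
    using assms(1) unfolding is_submodule_def ocomp_def
    by (intro cfun.subspaceI)
      (simp_all add: cfun.subspace_0 cfun.subspace_add cfun.subspace_scale iprod_add_left
        iprod_scale_left)
  then show ?thesis
    using assms permutes_inv[of _ "{1..n}"] unfolding is_submodule_def ocomp_def
    by (auto simp: iprod_perm_act)
qed

lemma ocomp_disjoint:
  assumes "S \<subseteq> word_space n" "v \<in> S" "v \<in> ocomp n M S"
  shows "v = 0"
  using assms iprod_self_eq_0 by (auto simp: ocomp_def)

text \<open>A nonzero submodule of least dimension is simple.\<close>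

lemma contains_simple:
  assumes "is_submodule n V" "V \<noteq> {0}"
  obtains U where "is_simple n U" "U \<subseteq> V"
proof -
  define P where "P U \<longleftrightarrow> is_submodule n U \<and> U \<subseteq> V \<and> U \<noteq> {0}" for U
  have "P V" using assms by (simp add: P_def)
  then obtain U where U: "P U" and min: "\<And>W. P W \<Longrightarrow> cfun.dim U \<le> cfun.dim W"
    using arg_min_nat_lemma[of P V cfun.dim] by blast
  have "W = U" if W: "is_submodule n W" "W \<subseteq> U" "W \<noteq> {0}" for W
  proof (rule ccontr)
    assume "W \<noteq> U"
    then obtain x where x: "x \<in> U" "x \<notin> W" using W by blast
    have subU: "csubspace U" "U \<subseteq> word_space n" using U by (auto simp: P_def is_submodule_def)
    have subW: "csubspace W" "W \<subseteq> word_space n" using W by (auto simp: is_submodule_def)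
    obtain B where B: "finite B" "B \<subseteq> W" "cspan B = W" "\<not> cfun.dependent B"
      using subspace_finite_basis[OF subW] .
    have "\<not> cfun.dependent (insert x B)" using B x by (simp add: cfun.independent_insertI)
    moreover have "insert x B \<subseteq> U" using x B W by blast
    moreover obtain C where C: "finite C" "cspan C = U" "\<not> cfun.dependent C"
      using subspace_finite_basis[OF subU] .
    ultimately have "card (insert x B) \<le> card C"
      using cfun.independent_span_bound[of C "insert x B"] by auto
    moreover have "x \<notin> B" using x B by blast
    ultimately have "card B < card C" using B(1) by simp
    then have "cfun.dim W < cfun.dim U"
      using B C by (metis cfun.dim_span_eq_card_independent)
    moreover have "P W" using W U by (auto simp: P_def)
    ultimately show False using min by fastforce
  qed
  then have "is_simple n U" using U by (auto simp: P_def is_simple_def)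
  then show ?thesis using that U by (auto simp: P_def)
qed

section \<open>Highest weight vectors\<close>

text \<open>The matrix unit \<open>E\<^bsub>ab\<^esub>\<close> of the general linear Lie algebra acting on tensors: on words, it is the
  sum over all ways to replace one letter \<open>b\<close> by \<open>a\<close>. On coefficient functions the replacement runs
  backwards.\<close>

definition raise :: "nat \<Rightarrow> nat \<Rightarrow> vect \<Rightarrow> vect" where
  "raise a b u = (\<lambda>x. \<Sum>k | k < length x \<and> x ! k = a. u (x[k := b]))"

lemma raise_add: "raise a b (u + v) = raise a b u + raise a b v"
  and raise_scale: "raise a b (cscale c u) = cscale c (raise a b u)"
  and raise_zero [simp]: "raise a b 0 = 0"
  by (simp_all add: raise_def fun_eq_iff sum.distrib sum_distrib_left)

lemma raise_sum: "raise a b (\<Sum>i\<in>A. f i) = (\<Sum>i\<in>A. raise a b (f i))"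
  by (induction A rule: infinite_finite_induct)
    (simp_all only: sum.infinite sum.empty sum.insert raise_zero raise_add not_False_eq_True)

lemma raise_wvec:
  assumes "a \<noteq> b"
  shows "raise a b (wvec w) = (\<Sum>k | k < length w \<and> w ! k = b. wvec (w[k := a]))"
proof
  fix x
  have "raise a b (wvec w) x = (\<Sum>k | k < length x \<and> x ! k = a. if x[k := b] = w then 1 else 0)"
    by (simp add: raise_def wvec_def)
  also have "\<dots> = (\<Sum>k | k < length w \<and> w ! k = b. if x = w[k := a] then 1 else 0)"
  proof (rule sum.mono_neutral_cong)
    have inverse: "(x[k := b])[k := a] = x" if "x ! k = a"
      for x :: word and k a b
      using that by (metis list_update_id list_update_overwrite)
    show "(if x[k := b] = w then 1 else 0) = (0::complex)"
      if "k \<in> {k. k < length x \<and> x ! k = a} - {k. k < length w \<and> w ! k = b}" for k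
      using that by auto
    show "(if x = w[k := a] then 1 else 0) = (0::complex)"
      if "k \<in> {k. k < length w \<and> w ! k = b} - {k. k < length x \<and> x ! k = a}" for k
      using that by auto
    show "(if x[k := b] = w then 1 else 0) = (if x = w[k := a] then 1 else (0::complex))"
      if "k \<in> {k. k < length x \<and> x ! k = a} \<inter> {k. k < length w \<and> w ! k = b}" for k
      using that inverse[of x k a b] inverse[of w k b a] by (metis (mono_tags, lifting) IntD1 IntD2 mem_Collect_eq)
  qed auto
  finally show "raise a b (wvec w) x = (\<Sum>k | k < length w \<and> w ! k = b. wvec (w[k := a])) x"
    by (simp add: sum_fun_apply wvec_def)
qed

lemma place_perm_list_update:
  assumes "\<tau> permutes {1..n}" "length w = n" "k < n"
  shows "place_perm \<tau> (w[k := b]) = (place_perm \<tau> w)[\<tau> (Suc k) - 1 := b]"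
proof (rule nth_equalityI)
  fix l assume "l < length (place_perm \<tau> (w[k := b]))"
  then have l: "l < n" using assms by simp
  note r = permutes_range[OF assms(1,3)] permutes_range[OF permutes_inv[OF assms(1)] l]
  have "inv \<tau> (Suc l) - 1 = k \<longleftrightarrow> inv \<tau> (Suc l) = Suc k" using r by linarith
  also have "\<dots> \<longleftrightarrow> Suc l = \<tau> (Suc k)" using permutes_inv_eq[OF assms(1)] by metis
  also have "\<dots> \<longleftrightarrow> l = \<tau> (Suc k) - 1" using r by linarith
  finally show "place_perm \<tau> (w[k := b]) ! l = (place_perm \<tau> w)[\<tau> (Suc k) - 1 := b] ! l"
    using assms l r by (auto simp: nth_place_perm nth_list_update)
qed simp

lemma raise_perm_act:
  assumes "\<sigma> permutes {1..n}" "u \<in> word_space n" "1 \<le> a" "a < b"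
  shows "raise a b (perm_act n \<sigma> u) = perm_act n \<sigma> (raise a b u)"
proof
  fix x
  let ?\<tau> = "inv \<sigma>"
  have \<tau>: "?\<tau> permutes {1..n}" by (rule permutes_inv[OF assms(1)])
  show "raise a b (perm_act n \<sigma> u) x = perm_act n \<sigma> (raise a b u) x"
  proof (cases "x \<in> words n")
    case True
    then have len: "length x = n" by (rule length_words)
    have act: "perm_act n \<sigma> u y = u (place_perm ?\<tau> y)" if "length y = n" for y
    proof (cases "y \<in> words n")
      case False
      then have "place_perm ?\<tau> y \<notin> words n"
        using that place_perm_in_words[OF assms(1), of "place_perm ?\<tau> y"]
        by (auto simp: place_perm_inv[OF assms(1)])
      then show ?thesis using False assms(2) by (simp add: perm_act_apply[OF assms(1)] in_word_space)
    qed (simp add: perm_act_apply[OF assms(1)])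
    let ?f = "\<lambda>k. ?\<tau> (Suc k) - 1" and ?g = "\<lambda>k. \<sigma> (Suc k) - 1"
    have "raise a b (perm_act n \<sigma> u) x
        = (\<Sum>k | k < n \<and> x ! k = a. u ((place_perm ?\<tau> x)[?f k := b]))"
      unfolding raise_def len
      by (rule sum.cong) (auto simp: act len place_perm_list_update[OF \<tau>])
    also have "\<dots> = (\<Sum>k | k < n \<and> place_perm ?\<tau> x ! k = a. u ((place_perm ?\<tau> x)[k := b]))"
    proof (rule sum.reindex_bij_witness[of _ ?g ?f])
      fix k assume "k \<in> {k. k < n \<and> x ! k = a}"
      then have k: "k < n" "x ! k = a" by auto
      note r = permutes_range[OF \<tau> k(1)]
      show "?g (?f k) = k" using r(4) permutes_inverses(1)[OF assms(1)] by simp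
      show "?f k \<in> {k. k < n \<and> place_perm ?\<tau> x ! k = a}"
        using r(3,4) k permutes_inverses(1)[OF assms(1)]
        by (simp add: nth_place_perm len permutes_inv_inv[OF assms(1)])
    next
      fix k assume "k \<in> {k. k < n \<and> place_perm ?\<tau> x ! k = a}"
      then have k: "k < n" "place_perm ?\<tau> x ! k = a" by auto
      note r = permutes_range[OF assms(1) k(1)]
      show "?f (?g k) = k" using r(4) permutes_inverses(2)[OF assms(1)] by simp
      show "?g k \<in> {k. k < n \<and> x ! k = a}"
        using r(3) k by (simp add: nth_place_perm len permutes_inv_inv[OF assms(1)])
    qed simp
    also have "\<dots> = perm_act n \<sigma> (raise a b u) x"
      by (simp add: perm_act_apply[OF assms(1)] True raise_def len)
    finally show ?thesis .
  next
    case False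
    have "perm_act n \<sigma> u (x[k := b]) = 0" if "k < length x" "x ! k = a" for k
    proof -
      have "x[k := b] \<notin> words n"
      proof
        assume y: "x[k := b] \<in> words n"
        have "b \<in> set (x[k := b])" using that(1) by (simp add: set_update_memI)
        then have "a \<le> n" using y assms(4) by (auto simp: words_def)
        moreover have "x = (x[k := b])[k := a]" using that by (metis list_update_id list_update_overwrite)
        moreover have "set ((x[k := b])[k := a]) \<subseteq> insert a (set (x[k := b]))"
          by (rule set_update_subset_insert)
        ultimately have "set x \<subseteq> {1..n}" using y assms(3) by (auto simp: words_def)
        then show False using False y by (simp add: words_def)
      qed
      then show ?thesis by (simp add: perm_act_apply[OF assms(1)])
    qed
    then show ?thesis using False by (simp add: raise_def perm_act_apply[OF assms(1)])
  qed
qed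

definition hw_space :: "nat \<Rightarrow> (nat \<Rightarrow> nat) \<Rightarrow> vect set" where
  "hw_space n lam = {u \<in> weight_space n lam. \<forall>a b. 1 \<le> a \<and> a < b \<longrightarrow> raise a b u = 0}"

lemma is_submodule_hw_space: "is_submodule n (hw_space n lam)"
proof -
  have "csubspace (hw_space n lam)"
    using subspace_weight_space[of n lam] unfolding hw_space_def
    by (intro cfun.subspaceI)
      (simp_all add: cfun.subspace_0 cfun.subspace_add cfun.subspace_scale raise_add raise_scale)
  moreover have "hw_space n lam \<subseteq> word_space n"
    using weight_space_subset by (auto simp: hw_space_def)
  ultimately show ?thesis
    unfolding is_submodule_def
    by (auto simp: hw_space_def perm_act_in_weight_space raise_perm_act)
qed

lemma card_nth_eq_count_list: "card {k. k < length x \<and> x ! k = a} = count_list x a"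
proof -
  have "count_list x a = length (filter (\<lambda>y. a = y) x)"
    by (induction x) auto
  then show ?thesis by (simp add: length_filter_conv_card eq_commute)
qed

text \<open>The relation \<open>[E\<^bsub>ab\<^esub>, E\<^bsub>ba\<^esub>] = E\<^bsub>aa\<^esub> - E\<^bsub>bb\<^esub>\<close>: replacements at two different positions commute, and
  those at one position leave the two counts.\<close>

lemma raise_commutator:
  assumes "a \<noteq> b"
  shows "raise a b (raise b a u) y
    = raise b a (raise a b u) y + (of_nat (count_list y a) - of_nat (count_list y b)) * u y"
proof -
  have step: "raise a b (raise b a u) y = of_nat (count_list y a) * u y
      + (\<Sum>k | k < length y \<and> y ! k = a. \<Sum>l | l < length y \<and> y ! l = b. u (y[k := b, l := a]))"
    if "a \<noteq> b" for a b
  proof -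
    have "raise b a u (y[k := b]) = u y + (\<Sum>l | l < length y \<and> y ! l = b. u (y[k := b, l := a]))"
      if k: "k < length y" "y ! k = a" for k
    proof -
      have "{l. l < length (y[k := b]) \<and> y[k := b] ! l = b} = insert k {l. l < length y \<and> y ! l = b}"
        using k by (auto simp: nth_list_update)
      moreover have "y[k := a] = y" using k by auto
      ultimately show ?thesis using k \<open>a \<noteq> b\<close> by (simp add: raise_def)
    qed
    then have "raise a b (raise b a u) y
      = (\<Sum>k | k < length y \<and> y ! k = a. u y
          + (\<Sum>l | l < length y \<and> y ! l = b. u (y[k := b, l := a])))"
      unfolding raise_def[of a b] by (intro sum.cong) auto
    then show ?thesis by (simp add: sum.distrib card_nth_eq_count_list)
  qed
  have "(\<Sum>k | k < length y \<and> y ! k = a. \<Sum>l | l < length y \<and> y ! l = b. u (y[k := b, l := a]))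
      = (\<Sum>l | l < length y \<and> y ! l = b. \<Sum>k | k < length y \<and> y ! k = a. u (y[l := a, k := b]))"
  proof (subst sum.swap, intro sum.cong refl)
    fix l k assume "l \<in> {l. l < length y \<and> y ! l = b}" "k \<in> {k. k < length y \<and> y ! k = a}"
    then have "k \<noteq> l" using assms by auto
    then show "u (y[k := b, l := a]) = u (y[l := a, k := b])" by (simp only: list_update_swap)
  qed
  then show ?thesis
    using step[OF assms] step[OF assms[symmetric]] by (simp add: algebra_simps)
qed

lemma raise_adjoint:
  fixes n :: nat
  assumes "a \<le> N" "b \<le> N"
  defines "A \<equiv> {x. length x = n \<and> set x \<subseteq> {..N}}"
  shows "(\<Sum>x\<in>A. raise b a u x * cnj (v x)) = (\<Sum>y\<in>A. u y * cnj (raise a b v y))"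
proof -
  have fin: "finite A"
    unfolding A_def using finite_lists_length_eq[of "{..N}" n] by (simp add: conj_commute)
  have upd: "x[k := c] \<in> A" if "x \<in> A" "c \<le> N" for x k c
    using that set_update_subset_insert[of x k c] by (auto simp: A_def)
  have "(\<Sum>x\<in>A. raise b a u x * cnj (v x))
      = (\<Sum>(x, k)\<in>(SIGMA x:A. {k. k < length x \<and> x ! k = b}). u (x[k := a]) * cnj (v x))"
    using fin by (simp add: raise_def sum_distrib_right sum.Sigma)
  also have "\<dots> = (\<Sum>(y, k)\<in>(SIGMA x:A. {k. k < length x \<and> x ! k = a}). u y * cnj (v (y[k := b])))"
    by (rule sum.reindex_bij_witness[of _ "\<lambda>(y, k). (y[k := b], k)" "\<lambda>(x, k). (x[k := a], k)"])
      (use assms upd in auto)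
  also have "\<dots> = (\<Sum>y\<in>A. u y * cnj (raise a b v y))"
    using fin by (simp add: raise_def sum_distrib_left sum.Sigma)
  finally show ?thesis .
qed

text \<open>Raising a weight that is too low to be dominant is injective: if \<open>E\<^bsub>ab\<^esub> u = 0\<close>, then
  \<open>\<parallel>E\<^bsub>ba\<^esub> u\<parallel>\<^sup>2 = \<langle>u, E\<^bsub>ab\<^esub> E\<^bsub>ba\<^esub> u\<rangle> = (p - q) \<parallel>u\<parallel>\<^sup>2\<close>, which is negative unless \<open>u = 0\<close>. Letters up to an
  arbitrary bound are admitted because this is applied to words with their last letter cut off, whose
  letters may exceed their length.\<close>

lemma raise_injective:
  assumes supp: "\<And>x. u x \<noteq> 0 \<Longrightarrow>
      length x = n \<and> set x \<subseteq> {..N} \<and> count_list x a = p \<and> count_list x b = q"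
    and "a \<le> N" "b \<le> N" "a \<noteq> b" "p < q" and hw: "raise a b u = 0"
  shows "u = 0"
proof -
  define A where "A = {x. length x = n \<and> set x \<subseteq> {..N}}"
  define D where "D = raise b a u"
  have fin: "finite A"
    unfolding A_def using finite_lists_length_eq[of "{..N}" n] by (simp add: conj_commute)
  have "(\<Sum>x\<in>A. D x * cnj (D x)) = (\<Sum>y\<in>A. u y * cnj (raise a b D y))"
    using raise_adjoint[OF assms(2,3), where u = u and v = D and n = n] unfolding D_def A_def .
  also have "\<dots> = (\<Sum>y\<in>A. (of_nat p - of_nat q) * (u y * cnj (u y)))"
  proof (rule sum.cong[OF refl])
    fix y
    have "raise b a (raise a b u) y = 0" by (simp add: hw)
    then have "raise a b D y = (of_nat (count_list y a) - of_nat (count_list y b)) * u y"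
      using raise_commutator[OF assms(4), of u y] by (simp add: D_def)
    also have "\<dots> = (of_nat p - of_nat q) * u y" 
    proof (cases "u y = 0")
      case False
      then show ?thesis using supp[OF False] by simp
    qed simp
    finally show "u y * cnj (raise a b D y) = (of_nat p - of_nat q) * (u y * cnj (u y))"
      by simp
  qed
  finally have "of_real (\<Sum>x\<in>A. (cmod (D x))\<^sup>2)
      = (of_real ((real p - real q) * (\<Sum>y\<in>A. (cmod (u y))\<^sup>2)) :: complex)"
    by (simp only: of_real_sum of_real_mult complex_norm_square sum_distrib_left of_real_diff of_real_of_nat_eq)
  then have "(\<Sum>x\<in>A. (cmod (D x))\<^sup>2) = (real p - real q) * (\<Sum>y\<in>A. (cmod (u y))\<^sup>2)"
    by (simp only: of_real_eq_iff)
  moreover have "(\<Sum>x\<in>A. (cmod (D x))\<^sup>2) \<ge> 0" by (simp add: sum_nonneg)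
  moreover have "(\<Sum>y\<in>A. (cmod (u y))\<^sup>2) \<ge> 0" by (simp add: sum_nonneg)
  moreover have "real p - real q < 0" using assms(5) by simp
  ultimately have "(\<Sum>y\<in>A. (cmod (u y))\<^sup>2) = 0" by (smt (verit) mult_neg_pos)
  then have "\<forall>y\<in>A. u y = 0" using fin by (simp add: sum_nonneg_eq_0_iff)
  moreover have "y \<in> A" if "u y \<noteq> 0" for y using supp[OF that] by (simp add: A_def)
  ultimately have "u y = 0" for y by metis
  then show ?thesis by (simp add: fun_eq_iff)
qed

text \<open>The adjoint of appending the letter \<open>r\<close>.\<close>

definition last_part :: "nat \<Rightarrow> vect \<Rightarrow> vect" where
  "last_part r u = (\<lambda>y. u (y @ [r]))"

lemma raise_snoc:
  "raise a b u (y @ [c]) = raise a b (last_part c u) y + (if c = a then last_part b u y else 0)"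
proof -
  have "{k. k < length (y @ [c]) \<and> (y @ [c]) ! k = a}
      = {k. k < length y \<and> y ! k = a} \<union> (if c = a then {length y} else {})"
    by (auto simp: nth_append less_Suc_eq)
  then have "raise a b u (y @ [c])
      = (\<Sum>k | k < length y \<and> y ! k = a. u ((y @ [c])[k := b])) + (if c = a then last_part b u y else 0)"
    by (simp add: raise_def last_part_def sum.union_disjoint)
  also have "(\<Sum>k | k < length y \<and> y ! k = a. u ((y @ [c])[k := b])) = raise a b (last_part c u) y"
    unfolding raise_def last_part_def by (intro sum.cong) (auto simp: list_update_append)
  finally show ?thesis .
qed

lemma last_part_add: "last_part r (u + v) = last_part r u + last_part r v"
  and last_part_diff: "last_part r (u - v) = last_part r u - last_part r v"
  and last_part_scale: "last_part r (cscale c u) = cscale c (last_part r u)"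
  and last_part_zero [simp]: "last_part r 0 = 0"
  by (simp_all add: last_part_def fun_eq_iff)

section \<open>Partitions and tableaux\<close>

lemma partition_antimono:
  assumes "is_partition lam n" "1 \<le> i" "i \<le> j"
  shows "lam j \<le> lam i"
  using assms(3)
proof (induction rule: dec_induct)
  case (step k)
  then have "lam (Suc k) \<le> lam k" using assms(1,2) by (simp add: is_partition_def)
  then show ?case using step by linarith
qed simp

lemma diagram_upward:
  assumes "is_partition lam n" "(i, j) \<in> diagram lam" "1 \<le> i'" "i' \<le> i" "1 \<le> j'" "j' \<le> j"
  shows "(i', j') \<in> diagram lam"
  using assms partition_antimono[OF assms(1,3,4)] by (auto simp: diagram_def)

lemma diagram_eq_Sigma:
  assumes "is_partition lam n"
  shows "diagram lam = (SIGMA i:{i. lam i \<noteq> 0}. {1..lam i})"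
proof -
  have "lam i = 0 \<or> 1 \<le> i" for i using assms by (cases i) (auto simp: is_partition_def)
  then show ?thesis by (force simp: diagram_def)
qed

lemma finite_diagram: "is_partition lam n \<Longrightarrow> finite (diagram lam)"
  by (simp add: diagram_eq_Sigma is_partition_def)

lemma card_diagram: "is_partition lam n \<Longrightarrow> card (diagram lam) = n"
  by (simp add: diagram_eq_Sigma is_partition_def)

lemma partition_row_le:
  assumes "is_partition lam n" "(i, j) \<in> diagram lam"
  shows "i \<le> n"
proof -
  have "(\<lambda>k. (k, 1)) ` {1..i} \<subseteq> diagram lam"
    using diagram_upward[OF assms] assms(2) by (auto simp: diagram_def)
  then have "card ((\<lambda>k. (k, 1::nat)) ` {1..i}) \<le> n"
    using card_mono[OF finite_diagram[OF assms(1)]] card_diagram[OF assms(1)] by metis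
  then show ?thesis by (simp add: card_image inj_on_def)
qed

lemma partition_zero: "is_partition lam n \<Longrightarrow> n < i \<Longrightarrow> lam i = 0"
  using partition_row_le[of lam n i 1] by (force simp: diagram_def)

lemma weight_words_count:
  assumes "is_partition lam n" "w \<in> weight_words n lam" "1 \<le> i"
  shows "count_list w i = lam i"
proof (cases "i \<le> n")
  case True
  then show ?thesis using assms by (simp add: weight_words_def)
next
  case False
  then have "i \<notin> set w" using assms(2) by (auto simp: weight_words_def words_def)
  then show ?thesis using False partition_zero[OF assms(1), of i] by (simp add: count_list_0_iff)
qed

lemma weight_wordsI:
  assumes "is_partition lam n" "length w = n" "0 \<notin> set w" "\<And>i. 1 \<le> i \<Longrightarrow> count_list w i = lam i"
  shows "w \<in> weight_words n lam"
proof -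
  have "i \<le> n" if "i \<in> set w" for i
  proof (rule ccontr)
    assume "\<not> i \<le> n"
    then have "count_list w i = 0" using assms(4)[of i] partition_zero[OF assms(1), of i] by simp
    then show False using that by (simp add: count_list_0_iff)
  qed
  moreover have "1 \<le> i" if "i \<in> set w" for i using that assms(3) by (metis less_one not_le)
  ultimately have "w \<in> words n" using assms(2) by (auto simp: words_def)
  then show ?thesis using assms(4) by (simp add: weight_words_def)
qed

lemma mset_weight_words:
  assumes "w \<in> weight_words n lam" "w' \<in> weight_words n lam"
  shows "mset w = mset w'"
proof (rule multiset_eqI)
  fix i
  show "count (mset w) i = count (mset w') i"
  proof (cases "i \<in> {1..n}")
    case True
    then show ?thesis using assms by (simp add: weight_words_def count_mset)
  next
    case False
    then have "i \<notin> set w" "i \<notin> set w'" using assms by (auto simp: weight_words_def words_def)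
    then show ?thesis by (simp add: count_mset)
  qed
qed

lemma partition_remove_box:
  assumes "is_partition mu (Suc n)" "1 \<le> r" "mu (Suc r) < mu r"
  shows "is_partition (mu(r := mu r - 1)) n"
proof -
  let ?la = "mu(r := mu r - 1)"
  have fin: "finite {i. mu i \<noteq> 0}" and r: "r \<in> {i. mu i \<noteq> 0}"
    using assms by (auto simp: is_partition_def)
  have sub: "{i. ?la i \<noteq> 0} \<subseteq> {i. mu i \<noteq> 0}" by auto
  have "(\<Sum>i | ?la i \<noteq> 0. ?la i) = (\<Sum>i | mu i \<noteq> 0. ?la i)"
    by (rule sum.mono_neutral_left[OF fin sub]) auto
  also have "\<dots> = ?la r + (\<Sum>i\<in>{i. mu i \<noteq> 0} - {r}. ?la i)"
    by (rule sum.remove[OF fin r])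
  also have "\<dots> = (mu r - 1) + (\<Sum>i\<in>{i. mu i \<noteq> 0} - {r}. mu i)"
    by (intro arg_cong2[where f = "(+)"] sum.cong) auto
  also have "\<dots> = (\<Sum>i | mu i \<noteq> 0. mu i) - 1"
    using assms(3) sum.remove[OF fin r, of mu] by linarith
  also have "\<dots> = n" using assms(1) by (simp add: is_partition_def)
  finally have "(\<Sum>i | ?la i \<noteq> 0. ?la i) = n" .
  moreover have "?la (Suc i) \<le> ?la i" if "1 \<le> i" for i
  proof -
    have "mu (Suc i) \<le> mu i" using assms(1) that by (simp add: is_partition_def)
    then show ?thesis using assms(3) by auto
  qed
  moreover have "?la 0 = 0" using assms(1,2) by (simp add: is_partition_def)
  moreover have "finite {i. ?la i \<noteq> 0}" using finite_subset[OF sub fin] .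
  ultimately show ?thesis by (simp add: is_partition_def)
qed

definition col_of :: "(nat \<Rightarrow> nat) \<Rightarrow> tableau \<Rightarrow> nat \<Rightarrow> nat" where
  "col_of lam T k = snd (inv_into (diagram lam) T k)"

text \<open>Column antisymmetrization makes sense for every bijective filling of a diagram. The permutations in
  its column group are described by the row and the column of each entry.\<close>

locale numbering =
  fixes lam :: "nat \<Rightarrow> nat" and n :: nat and T :: tableau
  assumes part: "is_partition lam n" and tab: "is_tableau lam n T"
begin

abbreviation row where "row \<equiv> row_of lam T"
abbreviation col where "col \<equiv> col_of lam T"
abbreviation word where "word \<equiv> tab_word lam n T"
abbreviation C where "C \<equiv> col_group lam n T"

lemma bij: "bij_betw T (diagram lam) {1..n}"
  using tab by (simp add: is_tableau_def)

lemma box_in_diagram: "k \<in> {1..n} \<Longrightarrow> (row k, col k) \<in> diagram lam"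
  using bij inv_into_into[of k T "diagram lam"]
  by (simp add: row_of_def col_of_def bij_betw_def)

lemma T_box: "k \<in> {1..n} \<Longrightarrow> T (row k, col k) = k"
  using bij f_inv_into_f[of k T "diagram lam"]
  by (simp add: row_of_def col_of_def bij_betw_def)

lemma T_in: "(i, j) \<in> diagram lam \<Longrightarrow> T (i, j) \<in> {1..n}"
  using bij by (auto simp: bij_betw_def)

lemma row_T [simp]: "(i, j) \<in> diagram lam \<Longrightarrow> row (T (i, j)) = i"
  and col_T [simp]: "(i, j) \<in> diagram lam \<Longrightarrow> col (T (i, j)) = j"
  using bij by (simp_all add: row_of_def col_of_def bij_betw_def)

lemma row_col_eqD: "k \<in> {1..n} \<Longrightarrow> l \<in> {1..n} \<Longrightarrow> row k = row l \<Longrightarrow> col k = col l \<Longrightarrow> k = l"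
  by (metis T_box)

lemma row_bounds: "k \<in> {1..n} \<Longrightarrow> 1 \<le> row k \<and> row k \<le> n"
  using box_in_diagram[of k] partition_row_le[OF part] by (auto simp: diagram_def)

lemma col_bounds: "k \<in> {1..n} \<Longrightarrow> 1 \<le> col k \<and> col k \<le> lam (row k)"
  using box_in_diagram[of k] by (auto simp: diagram_def)

lemma length_word [simp]: "length word = n"
  by (simp add: tab_word_def del: upt_Suc)

lemma nth_word: "k < n \<Longrightarrow> word ! k = row (Suc k)"
  by (simp add: tab_word_def del: upt_Suc)

lemma nth_word_pred: "k \<in> {1..n} \<Longrightarrow> word ! (k - 1) = row k"
  using nth_word[of "k - 1"] by auto

lemma word_in_weight_words: "word \<in> weight_words n lam"
proof (rule weight_wordsI[OF part length_word])
  have "set word = row ` {1..n}"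
    by (simp add: tab_word_def atLeastLessThanSuc_atLeastAtMost del: upt_Suc)
  then show "0 \<notin> set word" using row_bounds by fastforce
  fix i :: nat assume i: "1 \<le> i"
  have "count_list word i = card {k. k < n \<and> word ! k = i}"
    using card_nth_eq_count_list[of word i] by simp
  also have "\<dots> = card {1..lam i}"
  proof (rule bij_betw_same_card[of "\<lambda>k. col (Suc k)"],
      rule bij_betw_byWitness[where f' = "\<lambda>j. T (i, j) - 1"])
    have D: "(i, j) \<in> diagram lam" if "j \<in> {1..lam i}" for j using that i by (simp add: diagram_def)
    show "\<forall>k\<in>{k. k < n \<and> word ! k = i}. T (i, col (Suc k)) - 1 = k"
    proof
      fix k assume "k \<in> {k. k < n \<and> word ! k = i}"
      then have "k < n" "row (Suc k) = i" by (auto simp: nth_word)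
      then show "T (i, col (Suc k)) - 1 = k" using T_box[of "Suc k"] by simp
    qed
    show "\<forall>j\<in>{1..lam i}. col (Suc (T (i, j) - 1)) = j"
      using D T_in by fastforce
    show "(\<lambda>k. col (Suc k)) ` {k. k < n \<and> word ! k = i} \<subseteq> {1..lam i}"
      using col_bounds[of "Suc _"] by (force simp: nth_word)
    show "(\<lambda>j. T (i, j) - 1) ` {1..lam i} \<subseteq> {k. k < n \<and> word ! k = i}"
    proof clarify
      fix j assume "j \<in> {1..lam i}"
      then have "T (i, j) \<in> {1..n}" "row (T (i, j)) = i" using D T_in by auto
      then show "T (i, j) - 1 < n \<and> word ! (T (i, j) - 1) = i" by (auto simp: nth_word)
    qed
  qed
  finally show "count_list word i = lam i" by simp
qed

lemma word_in_words: "word \<in> words n"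
  using word_in_weight_words weight_words_subset by blast

lemma col_group_eq: "C = {\<sigma>. \<sigma> permutes {1..n} \<and> (\<forall>k\<in>{1..n}. col (\<sigma> k) = col k)}"
proof -
  have set: "{T (i, j) | i. (i, j) \<in> diagram lam} = {k\<in>{1..n}. col k = j}" for j
    using T_in T_box box_in_diagram by force
  have "(\<forall>j. \<sigma> ` {k\<in>{1..n}. col k = j} = {k\<in>{1..n}. col k = j})
      \<longleftrightarrow> (\<forall>k\<in>{1..n}. col (\<sigma> k) = col k)" (is "?L \<longleftrightarrow> ?R") if \<sigma>: "\<sigma> permutes {1..n}" for \<sigma>
  proof
    assume ?L
    then show ?R by blast
  next
    assume R: ?R
    show ?L
    proof
      fix j
      have inj: "inj_on \<sigma> {k\<in>{1..n}. col k = j}" using permutes_inj_on[OF \<sigma>] .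
      have "\<sigma> ` {k\<in>{1..n}. col k = j} \<subseteq> {k\<in>{1..n}. col k = j}"
        using R permutes_in_image[OF \<sigma>] by auto
      then show "\<sigma> ` {k\<in>{1..n}. col k = j} = {k\<in>{1..n}. col k = j}"
        using inj by (intro endo_inj_surj) auto
    qed
  qed
  then show ?thesis unfolding col_group_def set by auto
qed

lemma C_permutes: "\<sigma> \<in> C \<Longrightarrow> \<sigma> permutes {1..n}"
  by (simp add: col_group_def)

lemma C_col: "\<sigma> \<in> C \<Longrightarrow> k \<in> {1..n} \<Longrightarrow> col (\<sigma> k) = col k"
  by (simp add: col_group_eq)

lemma finite_C: "finite C"
  using C_permutes by (intro finite_subset[OF _ finite_permutations[OF finite_atLeastAtMost]]) blast

lemma C_comp: "\<sigma> \<in> C \<Longrightarrow> \<tau> \<in> C \<Longrightarrow> \<sigma> \<circ> \<tau> \<in> C"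
  using permutes_in_image[of \<tau> "{1..n}"] by (auto simp: col_group_eq permutes_compose)

lemma C_inv: "\<sigma> \<in> C \<Longrightarrow> inv \<sigma> \<in> C"
proof -
  assume \<sigma>: "\<sigma> \<in> C"
  have p: "inv \<sigma> permutes {1..n}" using C_permutes[OF \<sigma>] by (rule permutes_inv)
  have "col (inv \<sigma> k) = col k" if "k \<in> {1..n}" for k
    using C_col[OF \<sigma>, of "inv \<sigma> k"] permutes_in_image[OF p, of k] that
      permutes_inverses(1)[OF C_permutes[OF \<sigma>]] by simp
  then show ?thesis using p by (simp add: col_group_eq)
qed

lemma C_transpose: "k \<in> {1..n} \<Longrightarrow> l \<in> {1..n} \<Longrightarrow> col k = col l \<Longrightarrow> transpose k l \<in> C"
  unfolding col_group_eq by (auto simp: permutes_swap_id transpose_def)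

lemma tab_word_comp:
  assumes "\<sigma> permutes {1..n}"
  shows "tab_word lam n (\<sigma> \<circ> T) = place_perm \<sigma> word"
proof (rule nth_equalityI)
  fix k assume "k < length (tab_word lam n (\<sigma> \<circ> T))"
  then have k: "k < n" by (simp add: tab_word_def del: upt_Suc)
  note r = permutes_range[OF permutes_inv[OF assms] k]
  let ?l = "inv \<sigma> (Suc k)"
  have l: "?l \<in> {1..n}" using r by simp
  have "(\<sigma> \<circ> T) (row ?l, col ?l) = Suc k"
    using T_box[OF l] permutes_inverses(1)[OF assms] by simp
  moreover have "inj_on (\<sigma> \<circ> T) (diagram lam)"
    using bij permutes_inj[OF assms] by (simp add: bij_betw_def comp_inj_on inj_on_subset)
  ultimately have "inv_into (diagram lam) (\<sigma> \<circ> T) (Suc k) = (row ?l, col ?l)"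
    using box_in_diagram[OF l] inv_into_f_f by metis
  then have "row_of lam (\<sigma> \<circ> T) (Suc k) = row ?l" by (simp add: row_of_def)
  then show "tab_word lam n (\<sigma> \<circ> T) ! k = place_perm \<sigma> word ! k"
    using k r by (simp add: tab_word_def nth_place_perm del: upt_Suc)
qed (simp add: tab_word_def del: upt_Suc)

section \<open>Column antisymmetrization\<close>

text \<open>Action of the element of the group algebra that is usually written \<open>\<kappa>\<^sub>T\<close>.\<close>

definition antisym :: "vect \<Rightarrow> vect" where
  "antisym u = (\<Sum>\<sigma>\<in>C. cscale (of_int (sign \<sigma>)) (perm_act n \<sigma> u))"

lemma antisym_add: "antisym (u + v) = antisym u + antisym v"
  by (simp add: antisym_def perm_act_add cfun.scale_right_distrib sum.distrib)

lemma antisym_scale: "antisym (cscale c u) = cscale c (antisym u)"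
  by (simp add: antisym_def perm_act_scale cfun.scale_sum_right mult.commute)

lemma antisym_zero [simp]: "antisym 0 = 0"
  by (simp add: antisym_def cfun.scale_zero_right)

lemma antisym_sum: "antisym (\<Sum>i\<in>A. f i) = (\<Sum>i\<in>A. antisym (f i))"
  by (induction A rule: infinite_finite_induct)
    (simp_all only: sum.infinite sum.empty sum.insert antisym_zero antisym_add not_False_eq_True)

lemma antisym_perm_act:
  assumes "\<tau> \<in> C"
  shows "antisym (perm_act n \<tau> u) = cscale (of_int (sign \<tau>)) (antisym u)"
proof -
  have p: "permutation \<sigma>" if "\<sigma> \<in> C" for \<sigma>
    using C_permutes[OF that] permutation_permutes by blast
  have sgn: "sign \<sigma> = sign \<tau> * sign (\<sigma> \<circ> \<tau>)" if "\<sigma> \<in> C" for \<sigma>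
    using p[OF that] p[OF assms] by (simp add: sign_compose)
  have "antisym (perm_act n \<tau> u)
      = (\<Sum>\<sigma>\<in>C. cscale (of_int (sign \<tau>)) (cscale (of_int (sign (\<sigma> \<circ> \<tau>))) (perm_act n (\<sigma> \<circ> \<tau>) u)))"
    unfolding antisym_def
  proof (rule sum.cong[OF refl])
    fix \<sigma> assume \<sigma>: "\<sigma> \<in> C"
    have "of_int (sign \<sigma>) = (of_int (sign \<tau>) * of_int (sign (\<sigma> \<circ> \<tau>)) :: complex)"
      using sgn[OF \<sigma>] by (metis of_int_mult)
    then show "cscale (of_int (sign \<sigma>)) (perm_act n \<sigma> (perm_act n \<tau> u)) =
        cscale (of_int (sign \<tau>)) (cscale (of_int (sign (\<sigma> \<circ> \<tau>))) (perm_act n (\<sigma> \<circ> \<tau>) u))"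
      by (simp add: perm_act_comp[OF C_permutes[OF \<sigma>] C_permutes[OF assms]])
  qed
  also have "\<dots> = cscale (of_int (sign \<tau>))
      (\<Sum>\<sigma>\<in>C. cscale (of_int (sign (\<sigma> \<circ> \<tau>))) (perm_act n (\<sigma> \<circ> \<tau>) u))"
    by (simp only: cfun.scale_sum_right)
  also have "(\<Sum>\<sigma>\<in>C. cscale (of_int (sign (\<sigma> \<circ> \<tau>))) (perm_act n (\<sigma> \<circ> \<tau>) u)) = antisym u"
    unfolding antisym_def
    by (rule sum.reindex_bij_witness[of _ "\<lambda>\<sigma>. \<sigma> \<circ> inv \<tau>" "\<lambda>\<sigma>. \<sigma> \<circ> \<tau>"])
      (use assms C_comp C_inv permutes_inv_o[OF C_permutes[OF assms]] in \<open>auto simp: comp_assoc\<close>)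
  finally show ?thesis .
qed

text \<open>The transposition of the two positions fixes the word and changes the sign of its
  antisymmetrization.\<close>

lemma antisym_repeated_letter:
  assumes "w \<in> words n" "k \<in> {1..n}" "l \<in> {1..n}" "k \<noteq> l" "col k = col l" "w ! (k - 1) = w ! (l - 1)"
  shows "antisym (wvec w) = 0"
proof -
  have t: "transpose k l \<in> C" using assms by (simp add: C_transpose)
  have "place_perm (transpose k l) w = w"
  proof (rule nth_equalityI)
    fix i assume "i < length (place_perm (transpose k l) w)"
    then have "place_perm (transpose k l) w ! i = w ! (transpose k l (Suc i) - 1)"
      by (simp add: nth_place_perm)
    also have "\<dots> = w ! i"
    proof (cases "Suc i = k \<or> Suc i = l")
      case True
      then show ?thesis
      proof
        assume "Suc i = k"
        then show ?thesis using assms(6) by (metis diff_Suc_1 transpose_apply_first)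
      next
        assume "Suc i = l"
        then show ?thesis using assms(6) by (metis diff_Suc_1 transpose_apply_second)
      qed
    next
      case False
      then have "transpose k l (Suc i) = Suc i" by (simp add: transpose_def)
      then show ?thesis by simp
    qed
    finally show "place_perm (transpose k l) w ! i = w ! i" .
  qed simp
  then have "antisym (wvec w) = antisym (perm_act n (transpose k l) (wvec w))"
    by (simp only: perm_act_wvec[OF C_permutes[OF t] assms(1)])
  also have "\<dots> = cscale (of_int (sign (transpose k l))) (antisym (wvec w))"
    by (rule antisym_perm_act[OF t])
  finally have eq: "antisym (wvec w) = cscale (of_int (sign (transpose k l))) (antisym (wvec w))" .
  have "antisym (wvec w) x = 0" for x
  proof -
    have "antisym (wvec w) x = - antisym (wvec w) x"
      using assms(4) by (subst eq) (simp add: sign_swap_id)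
    moreover have "z = - z \<Longrightarrow> z = 0" for z :: complex by (simp add: complex_eq_iff)
    ultimately show ?thesis by blast
  qed
  then show ?thesis by (simp add: fun_eq_iff)
qed

lemma specht_vec_eq_antisym: "specht_vec lam n T = antisym (wvec word)"
  unfolding specht_vec_def antisym_def
  by (intro sum.cong refl)
    (simp add: tab_word_comp[OF C_permutes] perm_act_wvec[OF C_permutes word_in_words])

lemma specht_vec_apply:
  "specht_vec lam n T x = (\<Sum>\<sigma>\<in>C. if x = place_perm \<sigma> word then of_int (sign \<sigma>) else 0)"
  unfolding specht_vec_def sum_fun_apply
  by (intro sum.cong refl) (simp add: tab_word_comp[OF C_permutes] wvec_def)

lemma specht_vec_in_weight_space: "specht_vec lam n T \<in> weight_space n lam"
  unfolding specht_vec_eq_antisym antisym_def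
  using subspace_weight_space wvec_in_weight_space[OF word_in_weight_words] perm_act_in_weight_space
    C_permutes
  by (intro cfun.subspace_sum cfun.subspace_scale) auto

lemma specht_vec_word: "specht_vec lam n T word = 1"
proof -
  have iff: "word = place_perm \<sigma> word \<longleftrightarrow> \<sigma> = id" if \<sigma>: "\<sigma> \<in> C" for \<sigma>
  proof
    assume eq: "word = place_perm \<sigma> word"
    have "inv \<sigma> k = k" if k: "k \<in> {1..n}" for k
    proof (rule row_col_eqD)
      show i: "inv \<sigma> k \<in> {1..n}"
        using that permutes_in_image[OF C_permutes[OF C_inv[OF \<sigma>]]] by simp
      obtain l where l: "k = Suc l" "l < n" using k by (cases k) auto
      have "row k = word ! l" using l by (simp add: nth_word)
      also have "\<dots> = place_perm \<sigma> word ! l" by (rule arg_cong[OF eq])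
      also have "\<dots> = row (inv \<sigma> k)" using l i by (auto simp: nth_place_perm nth_word)
      finally show "row (inv \<sigma> k) = row k" by simp
      show "col (inv \<sigma> k) = col k" using C_col[OF C_inv[OF \<sigma>] that] .
    qed (fact that)
    moreover have "inv \<sigma> k = k" if "k \<notin> {1..n}" for k
      using permutes_not_in[OF C_permutes[OF C_inv[OF \<sigma>]] that] .
    ultimately have "inv \<sigma> = id" by (auto simp only: fun_eq_iff id_apply)
    then have "inv (inv \<sigma>) = id" by (simp only: inv_id)
    then show "\<sigma> = id" by (simp only: permutes_inv_inv[OF C_permutes[OF \<sigma>]])
  qed (simp only: place_perm_id)
  have "specht_vec lam n T word = (\<Sum>\<sigma>\<in>C. if \<sigma> = id then 1 else 0)"
    unfolding specht_vec_apply
  proof (rule sum.cong[OF refl])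
    fix \<sigma> assume "\<sigma> \<in> C"
    show "(if word = place_perm \<sigma> word then of_int (sign \<sigma>) else 0) = (if \<sigma> = id then 1 else (0 :: complex))"
      unfolding iff[OF \<open>\<sigma> \<in> C\<close>] by simp
  qed
  moreover have "id \<in> C" by (simp add: col_group_eq permutes_id)
  ultimately show ?thesis by (simp only: sum.delta[OF finite_C] if_True)
qed

lemma card_letters_le:
  assumes "length v = n"
  shows "card {k\<in>{1..n}. v ! (k - 1) \<le> i} = size (filter_mset (\<lambda>x. x \<le> i) (mset v))"
proof -
  have "bij_betw (\<lambda>k. k - 1) {k\<in>{1..n}. v ! (k - 1) \<le> i} {k. k < length v \<and> v ! k \<le> i}"
    by (rule bij_betw_byWitness[where f' = Suc]) (auto simp: assms)
  then have "card {k\<in>{1..n}. v ! (k - 1) \<le> i} = card {k. k < length v \<and> v ! k \<le> i}"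
    by (rule bij_betw_same_card)
  also have "\<dots> = length (filter (\<lambda>x. x \<le> i) v)" by (simp add: length_filter_conv_card)
  finally show ?thesis by (simp only: mset_filter[symmetric] size_mset)
qed

text \<open>Among the fillings of a column by distinct positive numbers, the one by row numbers has the most
  entries that are at most \<open>i\<close>.\<close>

lemma card_col_le:
  assumes "\<And>k. k \<in> {1..n} \<Longrightarrow> 1 \<le> f k"
    and "\<And>k l. k \<in> {1..n} \<Longrightarrow> l \<in> {1..n} \<Longrightarrow> col k = col l \<Longrightarrow> f k = f l \<Longrightarrow> k = l"
  shows "card {k\<in>{1..n}. col k = j \<and> f k \<le> i} \<le> card {k\<in>{1..n}. col k = j \<and> row k \<le> i}"
proof (cases "\<exists>k\<in>{1..n}. col k = j \<and> i < row k")
  case True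
  then obtain k where k: "k \<in> {1..n}" "col k = j" "i < row k" by blast
  have D: "(i', j) \<in> diagram lam" if "i' \<in> {1..i}" for i'
    using diagram_upward[OF part box_in_diagram[OF k(1)], of i' j] that k col_bounds[OF k(1)] by auto
  have "card {k\<in>{1..n}. col k = j \<and> f k \<le> i} \<le> card {1..i}"
  proof (rule card_inj_on_le)
    show "inj_on f {k\<in>{1..n}. col k = j \<and> f k \<le> i}"
    proof (rule inj_onI)
      fix k l assume "k \<in> {k\<in>{1..n}. col k = j \<and> f k \<le> i}" "l \<in> {k\<in>{1..n}. col k = j \<and> f k \<le> i}"
        and eq: "f k = f l"
      then have "k \<in> {1..n}" "l \<in> {1..n}" "col k = col l" by simp_all
      then show "k = l" using eq by (rule assms(2))
    qed
    show "f ` {k\<in>{1..n}. col k = j \<and> f k \<le> i} \<subseteq> {1..i}"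
    proof
      fix m assume "m \<in> f ` {k\<in>{1..n}. col k = j \<and> f k \<le> i}"
      then obtain k where "m = f k" "k \<in> {1..n}" "f k \<le> i" by blast
      then show "m \<in> {1..i}" using assms(1)[of k] by simp
    qed
  qed simp
  also have "card {1..i} \<le> card {k\<in>{1..n}. col k = j \<and> row k \<le> i}"
  proof (rule card_inj_on_le)
    show "inj_on (\<lambda>i'. T (i', j)) {1..i}"     proof (rule inj_onI)
      fix a b assume ab: "a \<in> {1..i}" "b \<in> {1..i}" and eq: "T (a, j) = T (b, j)"
      have "a = row (T (a, j))" by (rule row_T[OF D[OF ab(1)], symmetric])
      also have "\<dots> = b" unfolding eq by (rule row_T[OF D[OF ab(2)]])
      finally show "a = b" .
    qed
    show "(\<lambda>i'. T (i', j)) ` {1..i} \<subseteq> {k\<in>{1..n}. col k = j \<and> row k \<le> i}"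
    proof clarify
      fix i' assume i': "i' \<in> {1..i}"
      show "T (i', j) \<in> {1..n} \<and> col (T (i', j)) = j \<and> row (T (i', j)) \<le> i"
        using T_in[OF D[OF i']] row_T[OF D[OF i']] col_T[OF D[OF i']] i' by simp
    qed
  qed simp
  finally show ?thesis .
next
  case False
  then have "{k\<in>{1..n}. col k = j \<and> row k \<le> i} = {k\<in>{1..n}. col k = j}" by force
  then have "card {k\<in>{1..n}. col k = j \<and> row k \<le> i} = card {k\<in>{1..n}. col k = j}"
    by (rule arg_cong)
  moreover have "card {k\<in>{1..n}. col k = j \<and> f k \<le> i} \<le> card {k\<in>{1..n}. col k = j}"
    by (rule card_mono) auto
  ultimately show ?thesis by linarith
qed

lemma card_split_cols:
  "card {k\<in>{1..n}. P k} = (\<Sum>j\<in>col ` {1..n}. card {k\<in>{1..n}. col k = j \<and> P k})"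
proof -
  have "{k\<in>{1..n}. P k} = (\<Union>j\<in>col ` {1..n}. {k\<in>{1..n}. col k = j \<and> P k})" by auto
  then have "card {k\<in>{1..n}. P k} = card (\<Union>j\<in>col ` {1..n}. {k\<in>{1..n}. col k = j \<and> P k})"
    by (rule arg_cong)
  also have "\<dots> = (\<Sum>j\<in>col ` {1..n}. card {k\<in>{1..n}. col k = j \<and> P k})"
    by (rule card_UN_disjoint) auto
  finally show ?thesis .
qed

text \<open>A word of weight \<open>\<lambda>\<close> without repetitions in a column has letters \<open>1, \<dots>, c\<close> in each column of height
  \<open>c\<close>. Indeed it has as many letters at most \<open>i\<close> as the word of the tableau, while by \<open>card_col_le\<close> no
  column can have more of them; so each column has equally many. Taking for \<open>i\<close> the height of a column
  shows that no letter exceeds it.\<close>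

lemma letter_in_column:
  assumes w: "w \<in> weight_words n lam" and k: "k \<in> {1..n}"
    and dist: "\<And>k l. k \<in> {1..n} \<Longrightarrow> l \<in> {1..n} \<Longrightarrow> col k = col l \<Longrightarrow> w ! (k - 1) = w ! (l - 1) \<Longrightarrow> k = l"
  shows "(w ! (k - 1), col k) \<in> diagram lam"
proof (rule ccontr)
  let ?l = "\<lambda>k. w ! (k - 1)"
  assume not: "(?l k, col k) \<notin> diagram lam"
  have len: "length w = n" and sub: "set w \<subseteq> {1..n}"
    using w by (auto simp: weight_words_def words_def)
  have letter: "1 \<le> ?l k" if "k \<in> {1..n}" for k
  proof -
    have "?l k \<in> set w" using that len by (intro nth_mem) auto
    then show ?thesis using sub by auto
  qed
  \<comment> \<open>A letter that exceeds the height of its column has a predecessor of at least that height.\<close>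
  define i where "i = ?l k - 1"
  have i: "?l k = Suc i" using letter[OF k] by (simp add: i_def)
  have "card {k\<in>{1..n}. ?l k \<le> i} = card {k\<in>{1..n}. word ! (k - 1) \<le> i}"
    unfolding card_letters_le[OF len] card_letters_le[OF length_word]
      mset_weight_words[OF w word_in_weight_words] ..
  also have "{k\<in>{1..n}. word ! (k - 1) \<le> i} = {k\<in>{1..n}. row k \<le> i}"
    by (intro Collect_cong conj_cong refl) (simp only: nth_word_pred)
  finally have total: "card {k\<in>{1..n}. ?l k \<le> i} = card {k\<in>{1..n}. row k \<le> i}" .
  have "row k' \<le> i" if "k' \<in> {1..n}" "col k' = col k" for k'
  proof (rule ccontr)
    assume "\<not> row k' \<le> i"
    then have "(?l k, col k) \<in> diagram lam"
      using i that col_bounds[OF k] letter[OF k]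
      by (intro diagram_upward[OF part box_in_diagram[OF that(1)]]) auto
    then show False using not by contradiction
  qed
  then have full: "{k'\<in>{1..n}. col k' = col k \<and> row k' \<le> i} = {k'\<in>{1..n}. col k' = col k}" by blast
  have "card {k'\<in>{1..n}. col k' = col k \<and> ?l k' \<le> i} = card {k'\<in>{1..n}. col k' = col k \<and> row k' \<le> i}"
  proof (rule sum_mono_inv[where i = "col k"
        and f = "\<lambda>j. card {k'\<in>{1..n}. col k' = j \<and> ?l k' \<le> i}"
        and g = "\<lambda>j. card {k'\<in>{1..n}. col k' = j \<and> row k' \<le> i}"])
    show "(\<Sum>j\<in>col ` {1..n}. card {k'\<in>{1..n}. col k' = j \<and> ?l k' \<le> i})
        = (\<Sum>j\<in>col ` {1..n}. card {k'\<in>{1..n}. col k' = j \<and> row k' \<le> i})"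
      using total by (simp only: card_split_cols[of "\<lambda>k. ?l k \<le> i"] card_split_cols[of "\<lambda>k. row k \<le> i"])
    show "card {k'\<in>{1..n}. col k' = j \<and> ?l k' \<le> i} \<le> card {k'\<in>{1..n}. col k' = j \<and> row k' \<le> i}" for j
      by (rule card_col_le[OF letter dist])
  qed (use k in auto)
  then have "{k'\<in>{1..n}. col k' = col k \<and> ?l k' \<le> i} = {k'\<in>{1..n}. col k' = col k}"
    unfolding full by (intro card_subset_eq) auto
  then have "?l k \<le> i" using k by blast
  then show False using i by simp
qed

text \<open>Either two equal letters share a column, or the word arises from the word of the tableau by a
  column permutation \<open>\<rho>\<close>, which sends a position to the entry of its column in the row named by its letter.\<close>

lemma antisym_wvec:
  assumes w: "w \<in> weight_words n lam"
  shows "\<exists>c. antisym (wvec w) = cscale c (specht_vec lam n T)"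
proof (cases "\<exists>k\<in>{1..n}. \<exists>l\<in>{1..n}. k \<noteq> l \<and> col k = col l \<and> w ! (k - 1) = w ! (l - 1)")
  case True
  then obtain k l where "k \<in> {1..n}" "l \<in> {1..n}" "k \<noteq> l" "col k = col l" "w ! (k - 1) = w ! (l - 1)"
    by blast
  moreover have "w \<in> words n" using w weight_words_subset by (rule rev_subsetD)
  ultimately have "antisym (wvec w) = 0" by (intro antisym_repeated_letter)
  then have "antisym (wvec w) = cscale 0 (specht_vec lam n T)" by (simp only: cfun.scale_zero_left)
  then show ?thesis ..
next
  case False
  let ?l = "\<lambda>k. w ! (k - 1)"
  have len: "length w = n" using w by (auto simp: weight_words_def words_def)
  have dist: "k = l" if "k \<in> {1..n}" "l \<in> {1..n}" "col k = col l" "?l k = ?l l" for k l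
    using that False by blast
  have D: "(?l k, col k) \<in> diagram lam" if "k \<in> {1..n}" for k
    by (rule letter_in_column[OF w that dist])
  define \<rho> where "\<rho> = (\<lambda>k. if k \<in> {1..n} then T (?l k, col k) else k)"
  have \<rho>: "\<rho> k \<in> {1..n}" "row (\<rho> k) = ?l k" "col (\<rho> k) = col k" if "k \<in> {1..n}" for k
    using row_T[OF D[OF that]] col_T[OF D[OF that]] T_in[OF D[OF that]] that by (simp_all add: \<rho>_def)
  have "inj_on \<rho> {1..n}" by (rule inj_onI) (metis \<rho> dist)
  moreover from this have "\<rho> ` {1..n} = {1..n}"
    using \<rho>(1) by (intro endo_inj_surj) auto
  ultimately have "bij_betw \<rho> {1..n} {1..n}" by (rule bij_betw_imageI)
  then have "\<rho> permutes {1..n}" by (rule bij_imp_permutes) (simp only: \<rho>_def if_False)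
  then have \<rho>C: "\<rho> \<in> C" using \<rho>(3) by (simp add: col_group_eq)
  have "w = place_perm (inv \<rho>) word"
  proof (rule nth_equalityI)
    fix k assume "k < length w"
    then have k: "k < n" "Suc k \<in> {1..n}" using len by simp_all
    then have "\<rho> (Suc k) - 1 < n" "Suc (\<rho> (Suc k) - 1) = \<rho> (Suc k)"
      using \<rho>(1)[OF k(2)] by auto
    then show "w ! k = place_perm (inv \<rho>) word ! k"
      using k \<rho>(2)[OF k(2)]
      by (simp add: nth_place_perm nth_word permutes_inv_inv[OF C_permutes[OF \<rho>C]])
  qed (simp add: len)
  then have "wvec w = perm_act n (inv \<rho>) (wvec word)"
    by (simp only: perm_act_wvec[OF C_permutes[OF C_inv[OF \<rho>C]] word_in_words])
  then have "antisym (wvec w) = cscale (of_int (sign (inv \<rho>))) (specht_vec lam n T)"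
    by (simp only: antisym_perm_act[OF C_inv[OF \<rho>C]] specht_vec_eq_antisym)
  then show ?thesis ..
qed

lemma weight_space_expansion:
  assumes "u \<in> weight_space n lam"
  shows "u = (\<Sum>w\<in>weight_words n lam. cscale (u w) (wvec w))"
proof
  fix x
  have fin: "finite (weight_words n lam)" using finite_subset[OF weight_words_subset] by simp
  show "u x = (\<Sum>w\<in>weight_words n lam. cscale (u w) (wvec w)) x"
    using assms fin by (simp add: sum_fun_apply wvec_def if_distrib in_weight_space cong: if_cong)
qed

lemma antisym_weight_space:
  assumes "u \<in> weight_space n lam"
  shows "\<exists>c. antisym u = cscale c (specht_vec lam n T)"
proof -
  have "\<forall>w\<in>weight_words n lam. \<exists>c. antisym (wvec w) = cscale c (specht_vec lam n T)"
    using antisym_wvec by (rule ballI)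
  then obtain c where c: "\<And>w. w \<in> weight_words n lam \<Longrightarrow>
      antisym (wvec w) = cscale (c w) (specht_vec lam n T)"
    unfolding bchoice_iff by (elim exE) (rule that, erule bspec)
  have "antisym u = antisym (\<Sum>w\<in>weight_words n lam. cscale (u w) (wvec w))"
    by (rule arg_cong[OF weight_space_expansion[OF assms]])
  also have "\<dots> = (\<Sum>w\<in>weight_words n lam. cscale (u w) (antisym (wvec w)))"
    by (simp only: antisym_sum antisym_scale)
  also have "\<dots> = (\<Sum>w\<in>weight_words n lam. cscale (u w * c w) (specht_vec lam n T))"
    by (rule sum.cong[OF refl]) (simp only: c cfun.scale_scale)
  also have "\<dots> = cscale (\<Sum>w\<in>weight_words n lam. u w * c w) (specht_vec lam n T)"
    by (simp only: cfun.scale_sum_left)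
  finally show ?thesis ..
qed

lemma raise_antisym:
  assumes "u \<in> word_space n" "1 \<le> a" "a < b"
  shows "raise a b (antisym u) = antisym (raise a b u)"
  unfolding antisym_def raise_sum
  by (intro sum.cong refl) (simp add: raise_scale raise_perm_act[OF C_permutes assms])

text \<open>Replacing a letter \<open>b\<close> of the word of \<open>T\<close> by \<open>a < b\<close> yields two letters \<open>a\<close> in one column, since
  above a box in row \<open>b\<close> there is one in row \<open>a\<close>.\<close>

lemma specht_vec_in_hw_space: "specht_vec lam n T \<in> hw_space n lam"
proof -
  have "raise a b (specht_vec lam n T) = 0" if ab: "1 \<le> a" "a < b" for a b
  proof -
    have zero: "antisym (wvec (word[k := a])) = 0" if k: "k < n" "word ! k = b" for k
    proof -
      have K: "Suc k \<in> {1..n}" and row: "row (Suc k) = b" using k by (auto simp: nth_word)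
      have D: "(a, col (Suc k)) \<in> diagram lam"
        using diagram_upward[OF part box_in_diagram[OF K], of a] ab row col_bounds[OF K] by simp
      let ?l = "T (a, col (Suc k))"
      have l: "?l \<in> {1..n}" "row ?l = a" "col ?l = col (Suc k)" using D T_in[OF D] by auto
      have "b \<le> n" using row row_bounds[OF K] by simp
      then have "word[k := a] \<in> words n"
        using word_in_words set_update_subset_insert[of word k a] ab by (auto simp: words_def)
      then show ?thesis
        by (rule antisym_repeated_letter[OF _ K l(1)])
          (use l k ab row in \<open>auto simp: nth_list_update nth_word\<close>)
    qed
    have "raise a b (specht_vec lam n T) = antisym (raise a b (wvec word))"
      unfolding specht_vec_eq_antisym
      by (rule raise_antisym[OF wvec_in_word_space[OF word_in_words] ab])
    also have "\<dots> = (\<Sum>k | k < n \<and> word ! k = b. antisym (wvec (word[k := a])))"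
      using ab by (simp add: raise_wvec antisym_sum)
    also have "\<dots> = 0" using zero by (intro sum.neutral) auto
    finally show ?thesis .
  qed
  then show ?thesis using specht_vec_in_weight_space by (simp add: hw_space_def)
qed

end

section \<open>Restriction to the first letters\<close>

text \<open>This lets one function serve as a tableau of several nested shapes.\<close>

lemma specht_vec_cong:
  assumes "\<And>b. b \<in> diagram lam \<Longrightarrow> T b = T' b"
  shows "specht_vec lam n T = specht_vec lam n T'"
proof -
  have "{T (i, j) | i. (i, j) \<in> diagram lam} = {T' (i, j) | i. (i, j) \<in> diagram lam}" for j
    using assms by force
  then have C: "col_group lam n T = col_group lam n T'" by (simp only: col_group_def)
  have "inv_into (diagram lam) (\<sigma> \<circ> T) = inv_into (diagram lam) (\<sigma> \<circ> T')" for \<sigma> :: "nat \<Rightarrow> nat"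
  proof
    fix k
    have "(\<lambda>y. y \<in> diagram lam \<and> (\<sigma> \<circ> T) y = k) = (\<lambda>y. y \<in> diagram lam \<and> (\<sigma> \<circ> T') y = k)"
      using assms by (auto simp: fun_eq_iff)
    then show "inv_into (diagram lam) (\<sigma> \<circ> T) k = inv_into (diagram lam) (\<sigma> \<circ> T') k"
      by (simp only: inv_into_def)
  qed
  then have "row_of lam (\<sigma> \<circ> T) = row_of lam (\<sigma> \<circ> T')" for \<sigma> :: "nat \<Rightarrow> nat"
    by (intro ext) (simp only: row_of_def)
  then have "tab_word lam n (\<sigma> \<circ> T) = tab_word lam n (\<sigma> \<circ> T')" for \<sigma>
    by (simp only: tab_word_def)
  then show ?thesis by (simp only: specht_vec_def C)
qed

lemma place_perm_snoc:
  assumes "\<sigma> permutes {1..n}" "length w = n"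
  shows "place_perm \<sigma> (w @ [a]) = place_perm \<sigma> w @ [a]"
proof (rule nth_equalityI)
  fix k assume "k < length (place_perm \<sigma> (w @ [a]))"
  then have k: "k < Suc n" using assms by simp
  show "place_perm \<sigma> (w @ [a]) ! k = (place_perm \<sigma> w @ [a]) ! k"
  proof (cases "k < n")
    case True
    then show ?thesis
      using assms permutes_range[OF permutes_inv[OF assms(1)] True] by (simp add: nth_place_perm nth_append)
  next
    case False
    then have "k = n" using k by simp
    moreover have "inv \<sigma> (Suc n) = Suc n" using permutes_not_in[OF permutes_inv[OF assms(1)]] by simp
    ultimately show ?thesis using assms by (simp add: nth_place_perm nth_append)
  qed
qed simp

lemma diagram_remove_box:
  assumes "mu (Suc r) < mu r"
  shows "diagram (mu(r := mu r - 1)) = diagram mu - {(r, mu r)}"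
  using assms by (auto simp: diagram_def split: if_splits)

lemma tableau_restrict:
  assumes "is_tableau mu (Suc n) T" "1 \<le> r" "mu (Suc r) < mu r" "T (r, mu r) = Suc n"
  shows "is_tableau (mu(r := mu r - 1)) n T"
proof -
  have "(r, mu r) \<in> diagram mu" using assms by (auto simp: diagram_def)
  moreover have "bij_betw T (diagram mu) {1..Suc n}" using assms(1) by (simp only: is_tableau_def)
  ultimately have "bij_betw T (diagram mu - {(r, mu r)}) ({1..Suc n} - {T (r, mu r)})"
    by (intro bij_betw_DiffI) (auto simp: bij_betw_def)
  moreover have "{1..Suc n} - {T (r, mu r)} = {1..n}" using assms(4) by auto
  ultimately show ?thesis by (simp only: is_tableau_def diagram_remove_box[where mu = mu and r = r, OF assms(3)])
qed

text \<open>The letter in the last position is the row of \<open>\<sigma>\<inverse>(n + 1)\<close>, a box in the column of the corner. It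
  cannot lie below the corner, and it lies in the row of the corner only if \<open>\<sigma>\<close> fixes \<open>n + 1\<close>. Such
  \<open>\<sigma>\<close> make up the column group of the smaller tableau.\<close>

lemma specht_vec_restrict:
  assumes mu: "is_partition mu (Suc n)" and r: "1 \<le> r" "mu (Suc r) < mu r"
    and T: "is_tableau mu (Suc n) T" "T (r, mu r) = Suc n"
  shows "last_part r (specht_vec mu (Suc n) T) = specht_vec (mu(r := mu r - 1)) n T"
    and "r < b \<Longrightarrow> last_part b (specht_vec mu (Suc n) T) = 0"
proof -
  let ?la = "mu(r := mu r - 1)"
  interpret big: numbering mu "Suc n" T by unfold_locales (fact mu, fact T(1))
  interpret small: numbering ?la n T
    by unfold_locales (fact partition_remove_box[OF mu r], fact tableau_restrict[OF T(1) r T(2)])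
  have corner: "(r, mu r) \<in> diagram mu" using r by (auto simp: diagram_def)
  have rc: "big.row (Suc n) = r" "big.col (Suc n) = mu r"
    using big.row_T[OF corner] big.col_T[OF corner] unfolding T(2) .
  have row: "small.row k = big.row k" and col: "small.col k = big.col k" if "k \<in> {1..n}" for k
  proof -
    have "(small.row k, small.col k) \<in> diagram mu"
      using small.box_in_diagram[OF that] unfolding diagram_remove_box[where mu = mu, OF r(2)] by blast
    from big.row_T[OF this] big.col_T[OF this]
    show "small.row k = big.row k" "small.col k = big.col k" unfolding small.T_box[OF that] by simp_all
  qed
  have word: "big.word = small.word @ [r]"
  proof (rule nth_equalityI)
    fix k assume "k < length big.word"
    then have "k < n \<or> k = n" by auto
    then show "big.word ! k = (small.word @ [r]) ! k"
    proof
      assume k: "k < n"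
      then have "big.row (Suc k) = small.row (Suc k)" using row[of "Suc k"] by simp
      moreover have "big.word ! k = big.row (Suc k)" using k by (intro big.nth_word) simp
      ultimately show ?thesis
        using k by (simp only: nth_append small.length_word small.nth_word if_True)
    next
      assume k: "k = n"
      have "(small.word @ [r]) ! n = (small.word @ [r]) ! length small.word"
        by (simp only: small.length_word)
      then have "(small.word @ [r]) ! n = r" by (simp only: nth_append_length)
      then show ?thesis by (simp add: k big.nth_word rc del: fun_upd_apply)
    qed
  qed (simp only: length_append_singleton big.length_word small.length_word)
  have C1: "\<sigma> \<in> big.C" if \<sigma>: "\<sigma> \<in> small.C" for \<sigma>
  proof -
    note p = small.C_permutes[OF \<sigma>]
    have "big.col (\<sigma> k) = big.col k" if "k \<in> {1..Suc n}" for k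
    proof (cases "k \<in> {1..n}")
      case True
      have "\<sigma> k \<in> {1..n}" using True permutes_in_image[OF p] by blast
      then show ?thesis using small.C_col[OF \<sigma> True] col[OF True] col[of "\<sigma> k"] by simp
    next
      case False
      then have "\<sigma> k = k" by (rule permutes_not_in[OF p])
      then show ?thesis by (simp only:)
    qed
    moreover have "\<sigma> permutes {1..Suc n}" by (rule permutes_subset[OF p]) auto
    ultimately show ?thesis unfolding big.col_group_eq by blast
  qed
  have C2: "\<sigma> \<in> small.C" if \<sigma>: "\<sigma> \<in> big.C" and fix_n: "inv \<sigma> (Suc n) = Suc n" for \<sigma>
  proof -
    note p = big.C_permutes[OF \<sigma>]
    have "\<sigma> (Suc n) = Suc n" using fix_n permutes_inverses(1)[OF p, of "Suc n"] by simp
    then have p': "\<sigma> permutes {1..n}"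
      by (intro permutes_superset[OF p]) (auto simp: le_Suc_eq)
    have "small.col (\<sigma> k) = small.col k" if "k \<in> {1..n}" for k
    proof -
      have "\<sigma> k \<in> {1..n}" using that permutes_in_image[OF p'] by blast
      then show ?thesis using big.C_col[OF \<sigma>, of k] col[OF that] col[of "\<sigma> k"] that by simp
    qed
    then show ?thesis using p' unfolding small.col_group_eq by blast
  qed
  have last: "big.row (inv \<sigma> (Suc n)) = b" "big.col (inv \<sigma> (Suc n)) = mu r"
    "inv \<sigma> (Suc n) \<in> {1..Suc n}"
    if \<sigma>: "\<sigma> \<in> big.C" and eq: "y @ [b] = place_perm \<sigma> big.word" for \<sigma> y b
  proof -
    have len: "length y = n" using arg_cong[OF eq, of length] by simp
    show i: "inv \<sigma> (Suc n) \<in> {1..Suc n}"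
      using permutes_in_image[OF big.C_permutes[OF big.C_inv[OF \<sigma>]], of "Suc n"] by simp
    have "b = (y @ [b]) ! n" using len by (simp add: nth_append)
    also have "\<dots> = place_perm \<sigma> big.word ! n" by (rule arg_cong[OF eq])
    also have "\<dots> = big.word ! (inv \<sigma> (Suc n) - 1)" by (simp add: nth_place_perm)
    also have "\<dots> = big.row (inv \<sigma> (Suc n))" by (rule big.nth_word_pred[OF i])
    finally show "big.row (inv \<sigma> (Suc n)) = b" by simp
    show "big.col (inv \<sigma> (Suc n)) = mu r"
      using big.C_col[OF big.C_inv[OF \<sigma>], of "Suc n"] rc by simp
  qed
  show "last_part r (specht_vec mu (Suc n) T) = specht_vec ?la n T"
  proof
    fix y
    have "last_part r (specht_vec mu (Suc n) T) y
        = (\<Sum>\<sigma>\<in>big.C. if y @ [r] = place_perm \<sigma> big.word then of_int (sign \<sigma>) else 0)"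
      by (simp only: last_part_def big.specht_vec_apply)
    also have "\<dots> = (\<Sum>\<sigma>\<in>small.C. if y = place_perm \<sigma> small.word then of_int (sign \<sigma>) else 0)"
    proof (rule sum.mono_neutral_cong_right[OF big.finite_C])
      show "small.C \<subseteq> big.C" using C1 by (rule subsetI)
      show "\<forall>\<sigma>\<in>big.C - small.C.
          (if y @ [r] = place_perm \<sigma> big.word then of_int (sign \<sigma>) else 0) = (0::complex)"
      proof
        fix \<sigma> assume \<sigma>: "\<sigma> \<in> big.C - small.C"
        have "y @ [r] \<noteq> place_perm \<sigma> big.word"
        proof
          assume eq: "y @ [r] = place_perm \<sigma> big.word"
          have "\<sigma> \<in> big.C" using \<sigma> by simp
          note l = last[OF this eq]
          have "inv \<sigma> (Suc n) = Suc n"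
            by (rule big.row_col_eqD[OF l(3)]) (simp_all only: l rc, simp)
          then show False using C2[of \<sigma>] \<sigma> by blast
        qed
        then show "(if y @ [r] = place_perm \<sigma> big.word then of_int (sign \<sigma>) else 0) = (0::complex)"
          by (simp only: if_False)
      qed
      fix \<sigma> assume "\<sigma> \<in> small.C"
      then have "place_perm \<sigma> big.word = place_perm \<sigma> small.word @ [r]"
        unfolding word by (rule place_perm_snoc[OF small.C_permutes small.length_word])
      then show "(if y @ [r] = place_perm \<sigma> big.word then of_int (sign \<sigma>) else 0)
          = (if y = place_perm \<sigma> small.word then of_int (sign \<sigma>) else (0::complex))"
        by (simp only: append1_eq_conv simp_thms)
    qed
    also have "\<dots> = specht_vec ?la n T y" by (simp only: small.specht_vec_apply)
    finally show "last_part r (specht_vec mu (Suc n) T) y = specht_vec ?la n T y" .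
  qed
  assume b: "r < b"
  have "specht_vec mu (Suc n) T (y @ [b]) = 0" for y
    unfolding big.specht_vec_apply
  proof (rule sum.neutral, rule ballI)
    fix \<sigma> assume \<sigma>: "\<sigma> \<in> big.C"
    have "y @ [b] \<noteq> place_perm \<sigma> big.word"
    proof
      assume eq: "y @ [b] = place_perm \<sigma> big.word"
      note l = last[OF \<sigma> eq]
      have "(b, mu r) \<in> diagram mu" using big.box_in_diagram[OF l(3)] unfolding l(1,2) .
      then have "mu r \<le> mu b" by (simp add: diagram_def)
      moreover have "mu b \<le> mu (Suc r)" using b by (intro partition_antimono[OF mu]) auto
      ultimately show False using r(2) by simp
    qed
    then show "(if y @ [b] = place_perm \<sigma> big.word then of_int (sign \<sigma>) else 0) = (0::complex)"
      by (simp only: if_False)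
  qed
  then show "last_part b (specht_vec mu (Suc n) T) = 0" by (simp add: last_part_def fun_eq_iff)
qed

lemma syt_extend:
  assumes mu: "is_partition mu (Suc n)" and r: "1 \<le> r" "mu (Suc r) < mu r"
    and T: "is_syt (mu(r := mu r - 1)) n T"
  shows "is_syt mu (Suc n) (T((r, mu r) := Suc n))"
proof -
  let ?la = "mu(r := mu r - 1)" and ?T = "T((r, mu r) := Suc n)"
  have D: "diagram mu = insert (r, mu r) (diagram ?la)" "(r, mu r) \<notin> diagram ?la"
    using r unfolding diagram_remove_box[where mu = mu, OF r(2)] by (auto simp: diagram_def)
  have bij: "bij_betw T (diagram ?la) {1..n}" using T by (simp add: is_syt_def is_tableau_def)
  then have le: "T x \<le> n" if "x \<in> diagram ?la" for x using that by (auto simp: bij_betw_def)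
  have "bij_betw ?T (diagram ?la) {1..n}"
    using bij D(2) by (subst bij_betw_cong[where g = T]) auto
  then have "bij_betw ?T (diagram ?la \<union> {(r, mu r)}) ({1..n} \<union> {?T (r, mu r)})"
    using D(2) by (intro notIn_Un_bij_betw) simp_all
  then have "bij_betw ?T (insert (r, mu r) (diagram ?la)) (insert (Suc n) {1..n})"
    by simp
  moreover have "insert (Suc n) {1..n} = {1..Suc n}" by auto
  ultimately have "is_tableau mu (Suc n) ?T" by (simp only: is_tableau_def D(1))
  moreover have "?T (i, j) < ?T (i, j')"
    if "(i, j) \<in> diagram mu" "(i, j') \<in> diagram mu" "j < j'" for i j j'
  proof -
    have "(i, j) \<noteq> (r, mu r)" using that by (auto simp: diagram_def)
    then have 1: "(i, j) \<in> diagram ?la" using that D by blast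
    show ?thesis
    proof (cases "(i, j') = (r, mu r)")
      case True
      then show ?thesis using le[OF 1] \<open>(i, j) \<noteq> (r, mu r)\<close> by simp
    next
      case False
      then have "(i, j') \<in> diagram ?la" using that D by blast
      then have "T (i, j) < T (i, j')" using T 1 that(3) unfolding is_syt_def by blast
      then show ?thesis by (simp only: fun_upd_other[OF False] fun_upd_other[OF \<open>(i, j) \<noteq> (r, mu r)\<close>])
    qed
  qed
  moreover have "?T (i, j) < ?T (i', j)"
    if "(i, j) \<in> diagram mu" "(i', j) \<in> diagram mu" "i < i'" for i i' j
  proof -
    have "(i, j) \<noteq> (r, mu r)"
    proof
      assume eq: "(i, j) = (r, mu r)"
      then have "mu r \<le> mu i'" using that by (simp add: diagram_def)
      moreover have "mu i' \<le> mu (Suc r)" using that(3) eq by (intro partition_antimono[OF mu]) auto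
      ultimately show False using r(2) by simp
    qed
    then have 1: "(i, j) \<in> diagram ?la" using that D by blast
    show ?thesis
    proof (cases "(i', j) = (r, mu r)")
      case True
      then show ?thesis using le[OF 1] \<open>(i, j) \<noteq> (r, mu r)\<close> by simp
    next
      case False
      then have "(i', j) \<in> diagram ?la" using that D by blast
      then have "T (i, j) < T (i', j)" using T 1 that(3) unfolding is_syt_def by blast
      then show ?thesis by (simp only: fun_upd_other[OF False] fun_upd_other[OF \<open>(i, j) \<noteq> (r, mu r)\<close>])
    qed
  qed
  ultimately show ?thesis unfolding is_syt_def by blast
qed

text \<open>It suffices to extend standard tableaux by a box with entry \<open>n + 1\<close>. The clause on larger letters
  drives the descent in \<open>hw_space_subset_specht\<close>.\<close>

lemma specht_restriction:
  assumes mu: "is_partition mu (Suc n)" and r: "1 \<le> r" "mu (Suc r) < mu r"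
    and v: "v \<in> specht n (mu(r := mu r - 1))"
  shows "\<exists>u\<in>specht (Suc n) mu. last_part r u = v \<and> (\<forall>b>r. last_part b u = 0)"
proof -
  let ?la = "mu(r := mu r - 1)"
  define V where "V = {v. \<exists>u\<in>specht (Suc n) mu. last_part r u = v \<and> (\<forall>b>r. last_part b u = 0)}"
  have sub: "csubspace (specht (Suc n) mu)" by (simp only: specht_def cfun.subspace_span)
  have "csubspace V"
  proof (rule cfun.subspaceI)
    show "0 \<in> V"
      unfolding V_def mem_Collect_eq
      by (rule bexI[OF _ cfun.subspace_0[OF sub]]) (simp only: last_part_zero simp_thms)
  next
    fix x y assume "x \<in> V" "y \<in> V"
    then obtain u w where u: "u \<in> specht (Suc n) mu" "last_part r u = x" "\<forall>b>r. last_part b u = 0"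
      and w: "w \<in> specht (Suc n) mu" "last_part r w = y" "\<forall>b>r. last_part b w = 0"
      unfolding V_def mem_Collect_eq by (elim bexE conjE)
    have "last_part r (u + w) = x + y" by (simp only: last_part_add u w)
    moreover have "last_part b (u + w) = 0" if "b > r" for b
      using u(3) w(3) that by (simp only: last_part_add) simp
    ultimately show "x + y \<in> V"
      unfolding V_def mem_Collect_eq using cfun.subspace_add[OF sub u(1) w(1)] by blast
  next
    fix c x assume "x \<in> V"
    then obtain u where u: "u \<in> specht (Suc n) mu" "last_part r u = x" "\<forall>b>r. last_part b u = 0"
      unfolding V_def mem_Collect_eq by (elim bexE conjE)
    have "last_part r (cscale c u) = cscale c x" by (simp only: last_part_scale u)
    moreover have "last_part b (cscale c u) = 0" if "b > r" for b
      using u(3) that by (simp only: last_part_scale) (simp add: fun_eq_iff)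
    ultimately show "cscale c x \<in> V"
      unfolding V_def mem_Collect_eq using cfun.subspace_scale[OF sub u(1)] by blast
  qed
  moreover have "specht_vec ?la n T \<in> V" if T: "is_syt ?la n T" for T
  proof -
    let ?T = "T((r, mu r) := Suc n)"
    have syt: "is_syt mu (Suc n) ?T" by (rule syt_extend[OF mu r T])
    then have tab: "is_tableau mu (Suc n) ?T" by (simp only: is_syt_def)
    have "specht_vec ?la n T = specht_vec ?la n ?T"
    proof (rule specht_vec_cong)
      fix b assume "b \<in> diagram ?la"
      then have "b \<noteq> (r, mu r)" unfolding diagram_remove_box[where mu = mu, OF r(2)] by blast
      then show "T b = ?T b" by simp
    qed
    moreover have "specht_vec mu (Suc n) ?T \<in> specht (Suc n) mu"
      unfolding specht_def by (rule cfun.span_base) (use syt in blast)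
    moreover have "?T (r, mu r) = Suc n" by simp
    ultimately show ?thesis
      unfolding V_def mem_Collect_eq using specht_vec_restrict[OF mu r tab] by metis
  qed
  ultimately have "specht n ?la \<subseteq> V"
    unfolding specht_def by (intro cfun.span_minimal) blast+
  then show ?thesis using v unfolding V_def by blast
qed

section \<open>The Specht module consists of the highest weight vectors\<close>

lemma specht_subset_hw_space:
  assumes "is_partition lam n"
  shows "specht n lam \<subseteq> hw_space n lam"
proof -
  have "specht_vec lam n T \<in> hw_space n lam" if "is_syt lam n T" for T
  proof -
    interpret numbering lam n T
      using assms that by unfold_locales (simp_all add: is_syt_def)
    show ?thesis by (rule specht_vec_in_hw_space)
  qed
  then show ?thesis
    unfolding specht_def using is_submodule_hw_space
    by (intro cfun.span_minimal) (auto simp only: is_submodule_def)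
qed

lemma hw_space_weight: "u \<in> hw_space n lam \<Longrightarrow> u x \<noteq> 0 \<Longrightarrow> x \<in> weight_words n lam"
  unfolding hw_space_def in_weight_space by blast

text \<open>If \<open>r\<close> is the largest last letter of \<open>u\<close>, then the operators \<open>E\<^bsub>ab\<^esub>\<close> with \<open>a < b\<close> produce no further
  words ending in \<open>r\<close>, so the part of \<open>u\<close> ending in \<open>r\<close> is itself a highest weight vector. By
  \<open>raise_injective\<close> its weight is dominant, which means that row \<open>r\<close> ends in a corner.\<close>

lemma last_part_hw_space:
  assumes mu: "is_partition mu (Suc n)" and u: "u \<in> hw_space (Suc n) mu" and r: "1 \<le> r"
    and zero: "\<And>b. b > r \<Longrightarrow> last_part b u = 0" and nz: "last_part r u \<noteq> 0"
  shows "mu (Suc r) < mu r" "last_part r u \<in> hw_space n (mu(r := mu r - 1))"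
proof -
  let ?v = "last_part r u"
  have word: "y @ [r] \<in> weight_words (Suc n) mu" if "?v y \<noteq> 0" for y
    using hw_space_weight[OF u] that by (simp only: last_part_def)
  have len: "length y = n" and sub: "set y \<subseteq> {1..Suc n}" and rle: "r \<le> Suc n" if "?v y \<noteq> 0" for y
    using word[OF that] by (auto simp: weight_words_def words_def)
  have count: "count_list y i = (mu(r := mu r - 1)) i" and pos: "1 \<le> mu r"
    if "?v y \<noteq> 0" "1 \<le> i" for y i
    using weight_words_count[OF mu word[OF that(1)] that(2)]
      weight_words_count[OF mu word[OF that(1)] r] by auto
  have raise: "raise a b ?v = 0" if "1 \<le> a" "a < b" for a b
  proof
    fix y
    have "raise a b u (y @ [r]) = 0" using u that unfolding hw_space_def by (simp add: fun_eq_iff)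
    then have "raise a b ?v y + (if r = a then last_part b u y else 0) = 0"
      by (simp only: raise_snoc)
    then show "raise a b ?v y = 0 y" using zero[of b] that by (auto split: if_splits)
  qed
  obtain y0 where y0: "?v y0 \<noteq> 0" using nz by (auto simp: fun_eq_iff)
  show corner: "mu (Suc r) < mu r"
  proof (rule ccontr)
    assume "\<not> mu (Suc r) < mu r"
    then have lt: "mu r - 1 < mu (Suc r)" using pos[OF y0 r] by linarith
    have "?v = 0"
    proof (rule raise_injective[where a = r and b = "Suc r" and N = "Suc (Suc n)" and n = n])
      show "length y = n \<and> set y \<subseteq> {..Suc (Suc n)} \<and> count_list y r = mu r - 1
          \<and> count_list y (Suc r) = mu (Suc r)" if "?v y \<noteq> 0" for y
        using len[OF that] sub[OF that] count[OF that r] count[OF that, of "Suc r"] by auto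
      show "r \<le> Suc (Suc n)" "Suc r \<le> Suc (Suc n)" using rle[OF y0] by simp_all
      show "raise r (Suc r) ?v = 0" by (rule raise) (use r in simp_all)
    qed (use lt in simp_all)
    then show False using nz by contradiction
  qed
  have la: "is_partition (mu(r := mu r - 1)) n" by (rule partition_remove_box[OF mu r corner])
  have "y \<in> weight_words n (mu(r := mu r - 1))" if "?v y \<noteq> 0" for y
  proof (rule weight_wordsI[OF la len[OF that] _ count[OF that]])
    show "0 \<notin> set y" using sub[OF that] by auto
  qed
  then have "?v \<in> weight_space n (mu(r := mu r - 1))" unfolding in_weight_space by blast
  then show "?v \<in> hw_space n (mu(r := mu r - 1))" using raise unfolding hw_space_def by blast
qed

lemma vanishes_if_last_parts_vanish:
  assumes u: "u \<in> word_space (Suc n)" and zero: "\<And>b. b \<ge> 1 \<Longrightarrow> last_part b u = 0"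
  shows "u = 0"
proof
  fix x
  show "u x = 0 x"
  proof (cases "x \<in> words (Suc n)")
    case True
    then obtain y b where x: "x = y @ [b]" by (cases x rule: rev_cases) (auto simp: words_def)
    then have "b \<ge> 1" using True by (simp add: words_def)
    from fun_cong[OF zero[OF this], of y] show ?thesis by (simp add: last_part_def x)
  next
    case False
    then show ?thesis using u by (simp add: in_word_space)
  qed
qed

lemma hw_space_subset_specht_0:
  assumes "is_partition mu 0"
  shows "hw_space 0 mu \<subseteq> specht 0 mu"
proof
  fix u assume "u \<in> hw_space 0 mu"
  then have u: "u \<in> weight_space 0 mu" by (simp add: hw_space_def)
  define T :: tableau where "T = (\<lambda>_. 0)"
  have "diagram mu = {}" using card_diagram[OF assms] finite_diagram[OF assms] by simp
  then have syt: "is_syt mu 0 T" by (simp add: is_syt_def is_tableau_def bij_betw_def)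
  interpret numbering mu 0 T using assms syt by unfold_locales (simp_all add: is_syt_def)
  have "words 0 = {[]}" by (auto simp: words_def)
  then have nil: "x \<notin> weight_words 0 mu" if "x \<noteq> []" for x
    using that weight_words_subset[of 0 mu] by auto
  have "word = []" using length_word by (simp only: length_0_conv)
  then have s: "specht_vec mu 0 T [] = 1" using specht_vec_word by simp
  have eq: "u = cscale (u []) (specht_vec mu 0 T)"
  proof
    fix x
    show "u x = cscale (u []) (specht_vec mu 0 T) x"
    proof (cases "x = []")
      case False
      then have "u x = 0" "specht_vec mu 0 T x = 0"
        using nil[OF False] u specht_vec_in_weight_space unfolding in_weight_space by blast+
      then show ?thesis by simp
    qed (simp add: s)
  qed
  have "specht_vec mu 0 T \<in> specht 0 mu"
    unfolding specht_def by (rule cfun.span_base) (use syt in blast)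
  then have "cscale (u []) (specht_vec mu 0 T) \<in> specht 0 mu"
    unfolding specht_def by (rule cfun.span_scale)
  then show "u \<in> specht 0 mu" by (rule back_subst[OF _ eq[symmetric], of "\<lambda>v. v \<in> specht 0 mu"])
qed

text \<open>Induction on the size, and for each size on a bound \<open>r\<close> for the last letters of \<open>u\<close>. The part of
  \<open>u\<close> that ends in \<open>r\<close> lies in a smaller Specht module by induction, hence is also the part of some
  vector \<open>w\<close> of the Specht module without larger last letters; then \<open>u - w\<close> has a smaller bound.\<close>

lemma hw_space_subset_specht:
  "is_partition mu n \<Longrightarrow> hw_space n mu \<subseteq> specht n mu"
proof (induction n arbitrary: mu)
  case 0
  then show ?case by (rule hw_space_subset_specht_0)
next
  case (Suc n)
  note mu = Suc.prems
  have sub: "csubspace (specht (Suc n) mu)" by (simp only: specht_def cfun.subspace_span)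
  have hw_sub: "csubspace (hw_space (Suc n) mu)" "hw_space (Suc n) mu \<subseteq> word_space (Suc n)"
    using is_submodule_hw_space[of "Suc n" mu] by (simp_all only: is_submodule_def)
  have main: "\<forall>u\<in>hw_space (Suc n) mu. (\<forall>b>r. last_part b u = 0) \<longrightarrow> u \<in> specht (Suc n) mu" for r
  proof (induction r)
    case 0
    show ?case
    proof (intro ballI impI)
      fix u assume "u \<in> hw_space (Suc n) mu" "\<forall>b>0. last_part b u = 0"
      then have "u = 0"
        using hw_sub(2) by (intro vanishes_if_last_parts_vanish[of u n]) auto
      then show "u \<in> specht (Suc n) mu" using cfun.subspace_0[OF sub] by metis
    qed
  next
    case (Suc r)
    show ?case
    proof (intro ballI impI)
      fix u assume u: "u \<in> hw_space (Suc n) mu" and zero: "\<forall>b>Suc r. last_part b u = 0"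
      show "u \<in> specht (Suc n) mu"
      proof (cases "last_part (Suc r) u = 0")
        case True
        have "last_part b u = 0" if "b > r" for b
          using True zero that by (cases "b = Suc r") auto
        then show ?thesis using Suc.IH u by blast
      next
        case False
        let ?R = "Suc r"
        have R: "1 \<le> ?R" by simp
        have z: "\<And>b. b > ?R \<Longrightarrow> last_part b u = 0" using zero by blast
        have lp: "mu (Suc ?R) < mu ?R" "last_part ?R u \<in> hw_space n (mu(?R := mu ?R - 1))"
          using z False by (intro last_part_hw_space[OF mu u R]; blast)+
        have "last_part ?R u \<in> specht n (mu(?R := mu ?R - 1))"
          by (rule subsetD[OF \<open>\<And>mu. is_partition mu n \<Longrightarrow> hw_space n mu \<subseteq> specht n mu\<close>
                [OF partition_remove_box[OF mu R lp(1)]] lp(2)])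
        from specht_restriction[OF mu R lp(1) this]
        obtain w where w: "w \<in> specht (Suc n) mu" "last_part ?R w = last_part ?R u"
          "\<forall>b>?R. last_part b w = 0" by (elim bexE conjE)
        have "last_part b (u - w) = 0" if "b > r" for b
        proof (cases "b = ?R")
          case True
          then show ?thesis by (simp only: last_part_diff w(2) diff_self)
        next
          case False
          then have "b > ?R" using that by simp
          then have "last_part b u = 0" "last_part b w = 0" using zero w(3) by blast+
          then show ?thesis by (simp only: last_part_diff diff_self)
        qed
        moreover have "u - w \<in> hw_space (Suc n) mu"
          by (rule cfun.subspace_diff[OF hw_sub(1) u subsetD[OF specht_subset_hw_space[OF mu] w(1)]])
        ultimately have "u - w \<in> specht (Suc n) mu" using Suc.IH by blast
        from cfun.subspace_add[OF sub this w(1)] show ?thesis by (simp only: diff_add_cancel)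
      qed
    qed
  qed
  show ?case
  proof
    fix u assume u: "u \<in> hw_space (Suc n) mu"
    have "last_part b u = 0" if "b > Suc n" for b
    proof
      fix y
      have "y @ [b] \<notin> words (Suc n)" using that by (simp add: words_def)
      then show "last_part b u y = 0 y" using u hw_sub(2) by (auto simp: last_part_def in_word_space)
    qed
    then show "u \<in> specht (Suc n) mu" using main[of "Suc n"] u by blast
  qed
qed

theorem specht_eq_hw_space: "is_partition lam n \<Longrightarrow> specht n lam = hw_space n lam"
  by (intro equalityI specht_subset_hw_space hw_space_subset_specht)

lemma is_submodule_specht: "is_partition lam n \<Longrightarrow> is_submodule n (specht n lam)"
  by (simp only: specht_eq_hw_space is_submodule_hw_space)

lemma specht_subset_weight_space: "is_partition lam n \<Longrightarrow> specht n lam \<subseteq> weight_space n lam"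
  by (auto simp: specht_eq_hw_space hw_space_def)

section \<open>The submodule theorem\<close>

lemma submodule_sum:
  assumes "is_submodule n U" "\<And>i. i \<in> A \<Longrightarrow> f i \<in> U"
  shows "(\<Sum>i\<in>A. f i) \<in> U"
  by (rule cfun.subspace_sum) (use assms in \<open>simp_all only: is_submodule_def\<close>)

lemma submodule_scale: "is_submodule n U \<Longrightarrow> u \<in> U \<Longrightarrow> cscale c u \<in> U"
  unfolding is_submodule_def by (intro cfun.subspace_scale) blast+

lemma submodule_perm_act: "is_submodule n U \<Longrightarrow> \<sigma> permutes {1..n} \<Longrightarrow> u \<in> U \<Longrightarrow> perm_act n \<sigma> u \<in> U"
  unfolding is_submodule_def by blast

lemma submodule_zero: "is_submodule n U \<Longrightarrow> 0 \<in> U"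
  unfolding is_submodule_def by (intro cfun.subspace_0) blast

lemma submodule_word_space: "is_submodule n U \<Longrightarrow> U \<subseteq> word_space n"
  unfolding is_submodule_def by blast

lemma submodule_diff: "is_submodule n U \<Longrightarrow> u \<in> U \<Longrightarrow> v \<in> U \<Longrightarrow> u - v \<in> U"
  unfolding is_submodule_def by (intro cfun.subspace_diff) blast+

context numbering
begin

lemma antisym_in_submodule:
  assumes "is_submodule n U" "u \<in> U"
  shows "antisym u \<in> U"
  unfolding antisym_def
  by (intro submodule_sum[OF assms(1)] submodule_scale[OF assms(1)] submodule_perm_act[OF assms(1)]
      C_permutes assms(2))

lemma antisym_adjoint: "iprod n (antisym u) v = iprod n u (antisym v)"
proof -
  have "iprod n (antisym u) v = (\<Sum>\<sigma>\<in>C. of_int (sign \<sigma>) * iprod n u (perm_act n (inv \<sigma>) v))"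
    unfolding antisym_def iprod_sum_left iprod_scale_left
    by (rule sum.cong[OF refl]) (simp only: iprod_perm_act[OF C_permutes])
  also have "\<dots> = (\<Sum>\<sigma>\<in>C. of_int (sign \<sigma>) * iprod n u (perm_act n \<sigma> v))"
  proof (rule sum.reindex_bij_witness[of _ inv inv])
    fix \<sigma> assume \<sigma>: "\<sigma> \<in> C"
    note p = C_permutes[OF \<sigma>]
    show "inv (inv \<sigma>) = \<sigma>" "inv (inv \<sigma>) = \<sigma>" by (rule permutes_inv_inv[OF p])+
    show "inv \<sigma> \<in> C" "inv \<sigma> \<in> C" by (rule C_inv[OF \<sigma>])+
    have "permutation \<sigma>" using p permutation_permutes by blast
    then show "of_int (sign (inv \<sigma>)) * iprod n u (perm_act n (inv \<sigma>) v)
        = of_int (sign \<sigma>) * iprod n u (perm_act n (inv \<sigma>) v)"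
      by (simp only: sign_inverse)
  qed
  also have "\<dots> = iprod n u (antisym v)"
    unfolding antisym_def iprod_sum_right iprod_scale_right by simp
  finally show ?thesis .
qed

lemma iprod_specht_vec: "iprod n u (specht_vec lam n T) = antisym u word"
  by (simp only: specht_vec_eq_antisym antisym_adjoint[symmetric] iprod_wvec[OF word_in_words])

text \<open>Relabelling by \<open>\<pi>\<close> conjugates the column group by \<open>\<pi>\<close>.\<close>

lemma specht_vec_relabel:
  assumes \<pi>: "\<pi> permutes {1..n}"
  shows "specht_vec lam n (\<pi> \<circ> T) = perm_act n \<pi> (specht_vec lam n T)"
proof -
  have tab': "is_tableau lam n (\<pi> \<circ> T)"
    using tab permutes_imp_bij[OF \<pi>] unfolding is_tableau_def by (rule bij_betw_trans)
  interpret relabelled: numbering lam n "\<pi> \<circ> T" by unfold_locales (fact part, fact tab')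
  have pi_inv: "\<pi> \<circ> inv \<pi> = id" "inv \<pi> \<circ> \<pi> = id" by (rule permutes_inv_o[OF \<pi>])+
  have col: "relabelled.col (\<pi> k) = col k" if "k \<in> {1..n}" for k
    using relabelled.col_T[OF box_in_diagram[OF that]] by (simp only: o_def T_box[OF that])
  have in_n: "\<pi> k \<in> {1..n} \<longleftrightarrow> k \<in> {1..n}" for k by (rule permutes_in_image[OF \<pi>])
  have C1: "\<pi> \<circ> \<tau> \<circ> inv \<pi> \<in> relabelled.C" if \<tau>: "\<tau> \<in> C" for \<tau>
  proof -
    note p = C_permutes[OF \<tau>]
    have "relabelled.col ((\<pi> \<circ> \<tau> \<circ> inv \<pi>) k) = relabelled.col k" if k: "k \<in> {1..n}" for k
    proof -
      obtain l where l: "k = \<pi> l" by (metis permutes_inverses(1)[OF \<pi>])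
      then have ln: "l \<in> {1..n}" using k in_n by blast
      then have "\<tau> l \<in> {1..n}" using permutes_in_image[OF p] by blast
      then have "relabelled.col (\<pi> (\<tau> l)) = relabelled.col (\<pi> l)"
        by (simp only: col ln C_col[OF \<tau> ln])
      then show ?thesis by (simp only: o_def l permutes_inverses(2)[OF \<pi>])
    qed
    moreover have "\<pi> \<circ> \<tau> \<circ> inv \<pi> permutes {1..n}"
      by (intro permutes_compose permutes_inv \<pi> p)
    ultimately show ?thesis unfolding relabelled.col_group_eq by blast
  qed
  have C2: "inv \<pi> \<circ> \<sigma> \<circ> \<pi> \<in> C" if \<sigma>: "\<sigma> \<in> relabelled.C" for \<sigma>
  proof -
    note p = relabelled.C_permutes[OF \<sigma>]
    have perm: "inv \<pi> \<circ> \<sigma> \<circ> \<pi> permutes {1..n}"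
      by (intro permutes_compose permutes_inv \<pi> p)
    have "col ((inv \<pi> \<circ> \<sigma> \<circ> \<pi>) k) = col k" if k: "k \<in> {1..n}" for k
    proof -
      let ?m = "(inv \<pi> \<circ> \<sigma> \<circ> \<pi>) k"
      have m: "?m \<in> {1..n}" using k permutes_in_image[OF perm] by blast
      have "col ?m = relabelled.col (\<pi> ?m)" by (rule col[OF m, symmetric])
      also have "\<pi> ?m = \<sigma> (\<pi> k)" by (simp only: o_def permutes_inverses(1)[OF \<pi>])
      also have "relabelled.col (\<sigma> (\<pi> k)) = relabelled.col (\<pi> k)"
        by (rule relabelled.C_col[OF \<sigma>]) (use k in_n in blast)
      also have "\<dots> = col k" by (rule col[OF k])
      finally show ?thesis .
    qed
    then show ?thesis using perm unfolding col_group_eq by blast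
  qed
  have word': "relabelled.word = place_perm \<pi> word" by (rule tab_word_comp[OF \<pi>])
  have "specht_vec lam n (\<pi> \<circ> T)
      = (\<Sum>\<sigma>\<in>relabelled.C. cscale (of_int (sign \<sigma>)) (perm_act n \<sigma> (wvec relabelled.word)))"
    by (simp only: relabelled.specht_vec_eq_antisym relabelled.antisym_def)
  also have "\<dots> = (\<Sum>\<tau>\<in>C. perm_act n \<pi> (cscale (of_int (sign \<tau>)) (perm_act n \<tau> (wvec word))))"
  proof (rule sum.reindex_bij_witness[of _ "\<lambda>\<tau>. \<pi> \<circ> \<tau> \<circ> inv \<pi>" "\<lambda>\<sigma>. inv \<pi> \<circ> \<sigma> \<circ> \<pi>"])
    fix \<sigma> assume \<sigma>: "\<sigma> \<in> relabelled.C"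
    note p = relabelled.C_permutes[OF \<sigma>] and q = C_permutes[OF C2[OF \<sigma>]]
    have "permutation \<pi>" "permutation \<sigma>" "permutation (inv \<pi>)"
      using \<pi> p permutes_inv[OF \<pi>] permutation_permutes by blast+
    then have sgn: "sign (inv \<pi> \<circ> \<sigma> \<circ> \<pi>) = sign \<sigma>"
      by (simp add: sign_compose sign_inverse permutation_compose)
    have "perm_act n \<pi> (perm_act n (inv \<pi> \<circ> \<sigma> \<circ> \<pi>) (wvec word))
        = perm_act n (\<pi> \<circ> (inv \<pi> \<circ> \<sigma> \<circ> \<pi>)) (wvec word)"
      by (rule perm_act_comp[OF \<pi> q])
    also have "\<pi> \<circ> (inv \<pi> \<circ> \<sigma> \<circ> \<pi>) = \<sigma> \<circ> \<pi>"
      by (simp only: comp_assoc[symmetric] pi_inv id_comp)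
    also have "perm_act n (\<sigma> \<circ> \<pi>) (wvec word) = perm_act n \<sigma> (wvec relabelled.word)"
      by (simp only: perm_act_comp[OF p \<pi>, symmetric] perm_act_wvec[OF \<pi> word_in_words] word')
    finally show "perm_act n \<pi> (cscale (of_int (sign (inv \<pi> \<circ> \<sigma> \<circ> \<pi>)))
          (perm_act n (inv \<pi> \<circ> \<sigma> \<circ> \<pi>) (wvec word)))
        = cscale (of_int (sign \<sigma>)) (perm_act n \<sigma> (wvec relabelled.word))"
      by (simp only: perm_act_scale sgn)
    show "\<pi> \<circ> (inv \<pi> \<circ> \<sigma> \<circ> \<pi>) \<circ> inv \<pi> = \<sigma>"
      by (simp only: comp_assoc pi_inv comp_id) (simp only: comp_assoc[symmetric] pi_inv id_comp)
    show "inv \<pi> \<circ> \<sigma> \<circ> \<pi> \<in> C" by (rule C2[OF \<sigma>])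
  next
    fix \<tau> assume \<tau>: "\<tau> \<in> C"
    show "inv \<pi> \<circ> (\<pi> \<circ> \<tau> \<circ> inv \<pi>) \<circ> \<pi> = \<tau>"
      by (simp only: comp_assoc pi_inv comp_id) (simp only: comp_assoc[symmetric] pi_inv id_comp)
    show "\<pi> \<circ> \<tau> \<circ> inv \<pi> \<in> relabelled.C" by (rule C1[OF \<tau>])
  qed
  also have "\<dots> = perm_act n \<pi> (specht_vec lam n T)"
    by (simp only: perm_act_sum specht_vec_eq_antisym antisym_def)
  finally show ?thesis .
qed

text \<open>Any two fillings of a diagram differ by a relabelling.\<close>

lemma submodule_contains_specht:
  assumes U: "is_submodule n U" and s: "specht_vec lam n T \<in> U"
  shows "specht n lam \<subseteq> U"
proof -
  have "specht_vec lam n T' \<in> U" if syt: "is_syt lam n T'" for T'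
  proof -
    interpret other: numbering lam n T'
      by unfold_locales (fact part, use syt in \<open>simp only: is_syt_def\<close>)
    define \<pi> where "\<pi> = (\<lambda>k. if k \<in> {1..n} then T' (row k, col k) else k)"
    have "bij_betw (\<lambda>k. (row k, col k)) {1..n} (diagram lam)"
    proof (rule bij_betw_byWitness[where f' = T])
      show "\<forall>k\<in>{1..n}. T (row k, col k) = k" using T_box by blast
      show "\<forall>b\<in>diagram lam. (row (T b), col (T b)) = b" by auto
      show "(\<lambda>k. (row k, col k)) ` {1..n} \<subseteq> diagram lam" using box_in_diagram by blast
      show "T ` diagram lam \<subseteq> {1..n}" using T_in by auto
    qed
    from bij_betw_trans[OF this other.bij]
    have "bij_betw (T' \<circ> (\<lambda>k. (row k, col k))) {1..n} {1..n}" .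
    then have "bij_betw \<pi> {1..n} {1..n}"
      by (rule bij_betw_cong[THEN iffD1, rotated]) (simp add: \<pi>_def)
    then have perm: "\<pi> permutes {1..n}" by (rule bij_imp_permutes) (simp only: \<pi>_def if_False)
    have "specht_vec lam n T' = specht_vec lam n (\<pi> \<circ> T)"
    proof (rule specht_vec_cong)
      fix b assume b: "b \<in> diagram lam"
      obtain i j where ij: "b = (i, j)" by (cases b)
      have "T (i, j) \<in> {1..n}" using b T_in ij by blast
      then show "T' b = (\<pi> \<circ> T) b" using b unfolding ij by (simp add: \<pi>_def)
    qed
    also have "\<dots> = perm_act n \<pi> (specht_vec lam n T)" by (rule specht_vec_relabel[OF perm])
    finally show ?thesis using submodule_perm_act[OF U perm s] by (simp only:)
  qed
  then show ?thesis
    unfolding specht_def using U by (intro cfun.span_minimal) (auto simp only: is_submodule_def)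
qed

end

text \<open>Since \<open>\<kappa>\<^sub>T\<close> is self-adjoint and maps \<open>M\<^sup>\<lambda>\<close> to the line of \<open>s(T)\<close>, a vector \<open>u\<close> of \<open>U\<close> that is not
  orthogonal to \<open>s(T)\<close> has a nonzero multiple of \<open>s(T)\<close> as its image \<open>\<kappa>\<^sub>T u\<close>, which lies in \<open>U\<close>.\<close>

lemma submodule_theorem:
  assumes part: "is_partition lam n" and U: "is_submodule n U" "U \<subseteq> weight_space n lam"
  shows "specht n lam \<subseteq> U \<or> U \<subseteq> ocomp n (weight_space n lam) (specht n lam)"
proof (cases "\<exists>T. is_syt lam n T \<and> (\<exists>u\<in>U. iprod n u (specht_vec lam n T) \<noteq> 0)")
  case True
  then obtain T u where T: "is_syt lam n T" and u: "u \<in> U" "iprod n u (specht_vec lam n T) \<noteq> 0"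
    by blast
  interpret numbering lam n T
    by unfold_locales (fact part, use T in \<open>simp only: is_syt_def\<close>)
  obtain c where c: "antisym u = cscale c (specht_vec lam n T)"
    using antisym_weight_space[OF subsetD[OF U(2) u(1)]] ..
  have "iprod n u (specht_vec lam n T) = c * specht_vec lam n T word"
    by (simp only: iprod_specht_vec c cscale_apply)
  then have "c \<noteq> 0" using u(2) by auto
  then have "cscale (inverse c) (antisym u) = specht_vec lam n T"
    unfolding c by (simp only: cfun.scale_scale left_inverse[OF \<open>c \<noteq> 0\<close>] cfun.scale_one)
  moreover have "cscale (inverse c) (antisym u) \<in> U"
    by (intro submodule_scale[OF U(1)] antisym_in_submodule[OF U(1)] u(1))
  ultimately have "specht_vec lam n T \<in> U" by (simp only:)
  from submodule_contains_specht[OF U(1) this] show ?thesis ..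
next
  case False
  have "iprod n u s = 0" if u: "u \<in> U" and s: "s \<in> specht n lam" for u s
  proof -
    have "csubspace {s. iprod n u s = 0}"
      by (rule cfun.subspaceI) (simp_all add: iprod_add_right iprod_scale_right)
    then have "specht n lam \<subseteq> {s. iprod n u s = 0}"
      unfolding specht_def using False u by (intro cfun.span_minimal) blast+
    then show ?thesis using s by blast
  qed
  then show ?thesis unfolding ocomp_def using U(2) by blast
qed

section \<open>The projection onto the Specht module\<close>

locale standard = numbering +
  assumes syt: "is_syt lam n T"
begin

abbreviation S where "S \<equiv> specht n lam"
abbreviation M where "M \<equiv> weight_space n lam"

lemma specht_vec_in_specht: "specht_vec lam n T \<in> S"
  unfolding specht_def by (rule cfun.span_base) (use syt in blast)

lemma S_submodule: "is_submodule n S" and M_submodule: "is_submodule n M" and S_M: "S \<subseteq> M"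
  by (rule is_submodule_specht[OF part], rule is_submodule_weight_space,
      rule specht_subset_weight_space[OF part])

lemma S_words: "S \<subseteq> word_space n"
  by (rule submodule_word_space[OF S_submodule])

lemma specht_vec_nonzero: "specht_vec lam n T \<noteq> 0"
proof
  assume "specht_vec lam n T = 0"
  from fun_cong[OF this, of word] show False by (simp add: specht_vec_word)
qed

lemma S_nonzero: "S \<noteq> {0}"
  using specht_vec_in_specht specht_vec_nonzero by blast

lemma S_simple: "is_simple n S"
proof -
  have "V = {0} \<or> V = S" if V: "is_submodule n V" "V \<subseteq> S" for V
  proof -
    have "S \<subseteq> V \<or> V \<subseteq> ocomp n M S"
      by (rule submodule_theorem[OF part V(1) subset_trans[OF V(2) S_M]])
    then show ?thesis
    proof
      assume "V \<subseteq> ocomp n M S"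
      then have "v = 0" if "v \<in> V" for v
        using ocomp_disjoint[OF S_words] V(2) that by blast
      then show ?thesis using submodule_zero[OF V(1)] by blast
    qed (use V in blast)
  qed
  then show ?thesis using S_submodule S_nonzero unfolding is_simple_def by blast
qed

text \<open>Multiplicity one. If \<open>U\<close> were orthogonal to \<open>S\<close>, then \<open>\<kappa>\<^sub>T\<close> would map \<open>U\<close> to \<open>U \<inter> S = 0\<close>. But
  \<open>\<kappa>\<^sub>T\<close> commutes with an isomorphism, and it does not kill \<open>S\<close>, as
  \<open>\<langle>\<kappa>\<^sub>T s(T), w(T)\<rangle> = \<langle>s(T), s(T)\<rangle>\<close>.\<close>

lemma iso_S_unique:
  assumes U: "is_simple n U" "U \<subseteq> M" and iso: "iso_modules n U S"
  shows "U = S"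
proof -
  have subU: "is_submodule n U" using U(1) by (simp only: is_simple_def)
  have "\<not> U \<subseteq> ocomp n M S"
  proof
    assume perp: "U \<subseteq> ocomp n M S"
    obtain \<phi> where bij: "bij_betw \<phi> U S"
      and add: "\<forall>u\<in>U. \<forall>u'\<in>U. \<phi> (u + u') = \<phi> u + \<phi> u'"
      and scale: "\<forall>c. \<forall>u\<in>U. \<phi> (cscale c u) = cscale c (\<phi> u)"
      and act: "\<forall>\<sigma>. \<sigma> permutes {1..n} \<longrightarrow> (\<forall>u\<in>U. \<phi> (perm_act n \<sigma> u) = perm_act n \<sigma> (\<phi> u))"
      using iso unfolding iso_modules_def by (elim exE conjE)
    have zero: "\<phi> 0 = 0"
    proof -
      have "\<phi> (cscale 0 0) = cscale 0 (\<phi> 0)" 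
        by (rule scale[rule_format, OF submodule_zero[OF subU]])
      then show ?thesis by (simp only: cfun.scale_zero_left)
    qed
    have sum: "\<phi> (\<Sum>i\<in>A. f i) = (\<Sum>i\<in>A. \<phi> (f i))" if "finite A" "\<And>i. i \<in> A \<Longrightarrow> f i \<in> U"
      for A :: "(nat \<Rightarrow> nat) set" and f
      using that
    proof (induction A rule: finite_induct)
      case empty
      show ?case by (simp only: sum.empty zero)
    next
      case (insert x F)
      have in_U: "f i \<in> U" if "i \<in> F" for i by (rule insert.prems[OF insertI2[OF that]])
      have "\<phi> (f x + sum f F) = \<phi> (f x) + \<phi> (sum f F)"
        by (rule add[rule_format, OF insert.prems[OF insertI1] submodule_sum[OF subU in_U]])
      moreover have "\<phi> (sum f F) = (\<Sum>i\<in>F. \<phi> (f i))" by (rule insert.IH[OF in_U])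
      ultimately show ?case by (simp only: sum.insert[OF insert.hyps])
    qed
    have phi_antisym: "\<phi> (antisym u) = antisym (\<phi> u)" if u: "u \<in> U" for u
    proof -
      have a: "perm_act n \<sigma> u \<in> U" if "\<sigma> \<in> C" for \<sigma>
        by (rule submodule_perm_act[OF subU C_permutes[OF that] u])
      have "\<phi> (antisym u) = (\<Sum>\<sigma>\<in>C. \<phi> (cscale (of_int (sign \<sigma>)) (perm_act n \<sigma> u)))"
        unfolding antisym_def by (rule sum[OF finite_C submodule_scale[OF subU a]])
      also have "\<dots> = antisym (\<phi> u)"
        unfolding antisym_def
      proof (rule sum.cong[OF refl])
        fix \<sigma> assume \<sigma>: "\<sigma> \<in> C"
        have "\<phi> (cscale (of_int (sign \<sigma>)) (perm_act n \<sigma> u))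
            = cscale (of_int (sign \<sigma>)) (\<phi> (perm_act n \<sigma> u))"
          by (rule scale[rule_format, OF a[OF \<sigma>]])
        also have "\<phi> (perm_act n \<sigma> u) = perm_act n \<sigma> (\<phi> u)"
          by (rule act[rule_format, OF C_permutes[OF \<sigma>] u])
        finally show "\<phi> (cscale (of_int (sign \<sigma>)) (perm_act n \<sigma> u))
            = cscale (of_int (sign \<sigma>)) (perm_act n \<sigma> (\<phi> u))" .
      qed
      finally show ?thesis .
    qed
    obtain u where u: "u \<in> U" "\<phi> u = specht_vec lam n T"
      using specht_vec_in_specht unfolding bij_betw_imp_surj_on[OF bij, symmetric] by (metis imageE)
    obtain c where c: "antisym u = cscale c (specht_vec lam n T)"
      using antisym_weight_space[OF subsetD[OF U(2) u(1)]] ..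
    have "antisym u \<in> U" by (rule antisym_in_submodule[OF subU u(1)])
    then have "antisym u \<in> ocomp n M S" using perp by blast
    moreover have "antisym u \<in> S"
      unfolding c by (rule submodule_scale[OF S_submodule specht_vec_in_specht])
    ultimately have "antisym u = 0" by (intro ocomp_disjoint[OF S_words])
    then have "\<phi> (antisym u) = 0" by (simp only: zero)
    moreover have "\<phi> (antisym u) = antisym (\<phi> u)" by (rule phi_antisym[OF u(1)])
    ultimately have "antisym (specht_vec lam n T) = 0" by (simp only: u(2))
    from fun_cong[OF this, of word] have "antisym (specht_vec lam n T) word = 0"
      by (simp only: zero_fun_apply)
    then have zero: "iprod n (specht_vec lam n T) (specht_vec lam n T) = 0"
      by (simp only: iprod_specht_vec)
    have "specht_vec lam n T = 0"
      by (rule iprod_self_eq_0[OF subsetD[OF S_words specht_vec_in_specht] zero])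
    then show False using specht_vec_nonzero by contradiction
  qed
  then have "S \<subseteq> U" using submodule_theorem[OF part subU U(2)] by blast
  then show ?thesis using U(1) S_submodule S_nonzero unfolding is_simple_def by blast
qed

lemma iso_refl: "iso_modules n S S"
  unfolding iso_modules_def by (rule exI[of _ id]) simp

lemma isotypic_eq: "isotypic n M S = S"
proof -
  have "{U. is_simple n U \<and> U \<subseteq> M \<and> iso_modules n U S} = {S}"
  proof (intro equalityI subsetI)
    fix U assume "U \<in> {U. is_simple n U \<and> U \<subseteq> M \<and> iso_modules n U S}"
    then have "U = S" by (intro iso_S_unique) simp_all
    then show "U \<in> {S}" by simp
  next
    fix U assume "U \<in> {S}"
    then show "U \<in> {U. is_simple n U \<and> U \<subseteq> M \<and> iso_modules n U S}"
      using S_simple S_M iso_refl by simp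
  qed
  then have "\<Union>{U. is_simple n U \<and> U \<subseteq> M \<and> iso_modules n U S} = S"
    by (simp only: cSup_singleton)
  then have "isotypic n M S = cspan S" by (simp only: isotypic_def)
  also have "\<dots> = S" by (simp only: specht_def cfun.span_span)
  finally show ?thesis .
qed

text \<open>A simple submodule not isomorphic to \<open>S\<close> cannot contain \<open>S\<close>, so it is orthogonal to \<open>S\<close>. Conversely,
  if such submodules did not span the complement of \<open>S\<close>, then the part of it orthogonal to all of them
  would contain a simple submodule, which is one of them.\<close>

lemma isotypic_rest_eq: "isotypic_rest n M S = ocomp n M S"
proof
  let ?G = "\<Union>{U. is_simple n U \<and> U \<subseteq> M \<and> \<not> iso_modules n U S}"
  have oc: "is_submodule n (ocomp n M S)" by (rule is_submodule_ocomp[OF M_submodule S_submodule])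
  have "U \<subseteq> ocomp n M S" if U: "is_simple n U" "U \<subseteq> M" "\<not> iso_modules n U S" for U
  proof -
    have subU: "is_submodule n U" using U(1) by (simp only: is_simple_def)
    have "\<not> S \<subseteq> U"
    proof
      assume "S \<subseteq> U"
      then have "S = U" using U(1) S_submodule S_nonzero unfolding is_simple_def by blast
      then show False using U(3) iso_refl by blast
    qed
    then show ?thesis using submodule_theorem[OF part subU U(2)] by blast
  qed
  then have "?G \<subseteq> ocomp n M S" by blast
  then show rest_sub: "isotypic_rest n M S \<subseteq> ocomp n M S"
    unfolding isotypic_rest_def using oc
    by (intro cfun.span_minimal) (simp_all only: is_submodule_def)
  have rest: "is_submodule n (isotypic_rest n M S)"
  proof -
    have sub: "csubspace (isotypic_rest n M S)" unfolding isotypic_rest_def by (rule cfun.subspace_span)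
    have "perm_act n \<sigma> v \<in> isotypic_rest n M S"
      if \<sigma>: "\<sigma> permutes {1..n}" and v: "v \<in> isotypic_rest n M S" for \<sigma> v
    proof -
      let ?V = "{v. perm_act n \<sigma> v \<in> isotypic_rest n M S}"
      have "csubspace ?V"
        by (rule cfun.subspaceI)
          (simp_all only: mem_Collect_eq perm_act_zero perm_act_add perm_act_scale
            cfun.subspace_0[OF sub] cfun.subspace_add[OF sub] cfun.subspace_scale[OF sub])
      moreover have "g \<in> ?V" if g: "g \<in> ?G" for g
      proof -
        obtain U where U: "is_simple n U" "U \<subseteq> M" "\<not> iso_modules n U S" "g \<in> U"
          using g by blast
        then have "perm_act n \<sigma> g \<in> U"
          using submodule_perm_act[OF _ \<sigma>] by (simp only: is_simple_def)
        then have "perm_act n \<sigma> g \<in> ?G" using U by blast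
        then show ?thesis unfolding isotypic_rest_def mem_Collect_eq by (rule cfun.span_base)
      qed
      ultimately have "isotypic_rest n M S \<subseteq> ?V"
        by (subst isotypic_rest_def) (intro cfun.span_minimal subsetI)
      then show ?thesis using v by blast
    qed
    moreover have "isotypic_rest n M S \<subseteq> word_space n"
      using rest_sub submodule_word_space[OF oc] by (rule order_trans)
    ultimately show ?thesis using sub unfolding is_submodule_def by blast
  qed
  \<comment> \<open>The part of the complement of \<open>S\<close> that the other simple submodules miss.\<close>
  let ?V = "ocomp n (ocomp n M S) (isotypic_rest n M S)"
  have V: "is_submodule n ?V" by (rule is_submodule_ocomp[OF oc rest])
  have "?V = {0}"
  proof (rule ccontr)
    assume "?V \<noteq> {0}"
    then obtain U where U: "is_simple n U" "U \<subseteq> ?V" by (rule contains_simple[OF V])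
    have UM: "U \<subseteq> M" and Uoc: "U \<subseteq> ocomp n M S" using U(2) unfolding ocomp_def by blast+
    have U0: "is_submodule n U" "U \<noteq> {0}" using U(1) unfolding is_simple_def by blast+
    have "\<not> iso_modules n U S"
    proof
      assume "iso_modules n U S"
      then have "U = S" by (rule iso_S_unique[OF U(1) UM])
      then have "s = 0" if "s \<in> S" for s using Uoc ocomp_disjoint[OF S_words that] that by blast
      then show False using S_nonzero submodule_zero[OF S_submodule] by blast
    qed
    then have "U \<subseteq> ?G" using U(1) UM by blast
    also have "?G \<subseteq> isotypic_rest n M S" unfolding isotypic_rest_def by (rule cfun.span_superset)
    finally have "u = 0" if "u \<in> U" for u
      using ocomp_disjoint[OF submodule_word_space[OF rest]] U(2) that by blast
    then show False using U0 submodule_zero[OF U0(1)] by blast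
  qed
  show "ocomp n M S \<subseteq> isotypic_rest n M S"
  proof
    fix v assume v: "v \<in> ocomp n M S"
    have "\<exists>p\<in>isotypic_rest n M S. \<forall>s\<in>isotypic_rest n M S. iprod n (v - p) s = 0"
      using rest by (intro orthogonal_decomposition) (simp_all only: is_submodule_def)
    then obtain p where p: "p \<in> isotypic_rest n M S"
      "\<forall>s\<in>isotypic_rest n M S. iprod n (v - p) s = 0" by (elim bexE)
    have "v - p \<in> ocomp n M S"
      by (rule submodule_diff[OF oc v]) (use p(1) rest_sub in blast)
    then have "v - p \<in> ?V" using p(2) by (subst ocomp_def) blast
    then have "v - p = 0" unfolding \<open>?V = {0}\<close> by blast
    then show "v \<in> isotypic_rest n M S" using p(1) by (simp only: right_minus_eq)
  qed
qed

lemma isotypic_proj_properties: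
  assumes "v \<in> M"
  shows "isotypic_proj n M S v \<in> S" "v - isotypic_proj n M S v \<in> ocomp n M S"
proof -
  \<comment> \<open>The projection is defined by a unique description, so its value has to be exhibited.\<close>
  have "\<exists>p\<in>S. \<forall>s\<in>S. iprod n (v - p) s = 0"
    using S_submodule by (intro orthogonal_decomposition) (simp_all only: is_submodule_def)
  then obtain p where p: "p \<in> S" "\<forall>s\<in>S. iprod n (v - p) s = 0" by (elim bexE)
  have "v - p \<in> M" by (rule submodule_diff[OF M_submodule assms]) (use p(1) S_M in blast)
  then have vp: "v - p \<in> ocomp n M S" using p(2) unfolding ocomp_def by blast
  have "isotypic_proj n M S v = p"
    unfolding isotypic_proj_def isotypic_eq isotypic_rest_eq
  proof (rule the_equality)
    fix u assume u: "u \<in> S \<and> v - u \<in> ocomp n M S"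
    have "(v - p) - (v - u) \<in> ocomp n M S"
      by (rule submodule_diff[OF is_submodule_ocomp[OF M_submodule S_submodule] vp]) (use u in blast)
    moreover have "(v - p) - (v - u) = u - p" by (simp add: algebra_simps)
    ultimately have "u - p \<in> ocomp n M S" by (simp only:)
    moreover have "u - p \<in> S" by (rule submodule_diff[OF S_submodule]) (use u p in blast)+
    ultimately have "u - p = 0" by (intro ocomp_disjoint[OF S_words])
    then show "u = p" by (simp only: right_minus_eq)
  qed (use p(1) vp in blast)
  then show "isotypic_proj n M S v \<in> S" "v - isotypic_proj n M S v \<in> ocomp n M S"
    using p(1) vp by (simp_all only:)
qed

end

section \<open>Jucys--Murphy elements and contents\<close>

definition jucys_murphy :: "nat \<Rightarrow> nat \<Rightarrow> vect \<Rightarrow> vect" where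
  "jucys_murphy n k u = (\<Sum>i\<in>{1..<k}. perm_act n (transpose i k) u)"

lemma transpose_permutes:
  fixes i k n :: nat
  assumes "k \<in> {1..n}" "i \<in> {1..<k}"
  shows "transpose i k permutes {1..n}"
proof (rule permutes_swap_id)
  have "1 \<le> i" "i < k" "k \<le> n" using assms by simp_all
  then show "i \<in> {1..n}" by simp
qed (fact assms(1))

lemma jucys_murphy_add: "jucys_murphy n k (u + v) = jucys_murphy n k u + jucys_murphy n k v"
  by (simp only: jucys_murphy_def perm_act_add sum.distrib)

lemma jucys_murphy_in_submodule:
  assumes "is_submodule n U" "k \<in> {1..n}" "u \<in> U"
  shows "jucys_murphy n k u \<in> U"
  unfolding jucys_murphy_def
  by (intro submodule_sum[OF assms(1)] submodule_perm_act[OF assms(1)] transpose_permutes assms(2,3))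

text \<open>Both summands of the decomposition \<open>M = S \<oplus> S\<^sup>\<bottom>\<close> are stable under \<open>X\<^sub>k\<close>, so each component of an
  eigenvector satisfies the eigenvalue equation.\<close>

lemma (in standard) isotypic_proj_jucys_murphy:
  assumes v: "v \<in> M" and k: "k \<in> {1..n}" and eigen: "jucys_murphy n k v = cscale c v"
  shows "jucys_murphy n k (isotypic_proj n M S v) = cscale c (isotypic_proj n M S v)"
proof -
  define p where "p = isotypic_proj n M S v"
  define q where "q = v - p"
  have p: "p \<in> S" and q: "q \<in> ocomp n M S"
    unfolding p_def q_def by (rule isotypic_proj_properties[OF v])+
  have oc: "is_submodule n (ocomp n M S)" by (rule is_submodule_ocomp[OF M_submodule S_submodule])
  have v_eq: "v = p + q" unfolding q_def by simp
  have "jucys_murphy n k p + jucys_murphy n k q = cscale c p + cscale c q"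
    using eigen unfolding v_eq by (simp only: jucys_murphy_add cfun.scale_right_distrib)
  then have eq: "jucys_murphy n k p - cscale c p = cscale c q - jucys_murphy n k q"
    by (metis add.commute add_diff_eq diff_eq_eq)
  have "jucys_murphy n k p - cscale c p \<in> S"
    by (intro submodule_diff[OF S_submodule] jucys_murphy_in_submodule[OF S_submodule k]
        submodule_scale[OF S_submodule] p)
  moreover have "jucys_murphy n k p - cscale c p \<in> ocomp n M S"
    unfolding eq
    by (intro submodule_diff[OF oc] jucys_murphy_in_submodule[OF oc k] submodule_scale[OF oc] q)
  ultimately have "jucys_murphy n k p - cscale c p = 0" by (rule ocomp_disjoint[OF S_words])
  then show ?thesis by (simp only: right_minus_eq p_def)
qed

definition pairs :: "nat \<Rightarrow> (nat \<times> nat) set" where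
  "pairs n = {(i, k). i \<in> {1..n} \<and> k \<in> {1..n} \<and> i \<noteq> k}"

lemma finite_pairs [simp]: "finite (pairs n)"
  by (rule finite_subset[of _ "{1..n} \<times> {1..n}"]) (auto simp: pairs_def)

text \<open>Every transposition occurs twice; ordered pairs keep the sum visibly invariant under conjugation.\<close>

definition transposition_sum :: "nat \<Rightarrow> vect \<Rightarrow> vect" where
  "transposition_sum n u = (\<Sum>(i, k)\<in>pairs n. perm_act n (transpose i k) u)"

lemma transposition_sum_eq_jucys_murphy:
  "transposition_sum n u = (\<Sum>k\<in>{1..n}. jucys_murphy n k u) + (\<Sum>k\<in>{1..n}. jucys_murphy n k u)"
proof -
  let ?f = "\<lambda>(i, k). perm_act n (transpose i k) u"
  let ?L = "{(i, k). i \<in> {1..<k} \<and> k \<in> {1..n}}" and ?G = "{(i, k). k \<in> {1..<i} \<and> i \<in> {1..n}}"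
  have fin: "finite ?L" "finite ?G"
    by (rule finite_subset[of _ "{1..n} \<times> {1..n}"]; auto)+
  have "pairs n = ?L \<union> ?G" by (auto simp: pairs_def)
  then have "transposition_sum n u = sum ?f (?L \<union> ?G)" by (simp only: transposition_sum_def)
  also have "\<dots> = sum ?f ?L + sum ?f ?G" by (rule sum.union_disjoint[OF fin]) auto
  also have "sum ?f ?G = sum ?f ?L"
    by (rule sum.reindex_bij_witness[of _ prod.swap prod.swap]) (auto simp: transpose_commute)
  also have "sum ?f ?L = (\<Sum>k\<in>{1..n}. jucys_murphy n k u)"
  proof -
    have "(\<Sum>k\<in>{1..n}. jucys_murphy n k u)
        = (\<Sum>(k, i)\<in>(SIGMA k:{1..n}. {1..<k}). perm_act n (transpose i k) u)"
      unfolding jucys_murphy_def by (rule sum.Sigma) auto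
    also have "\<dots> = sum ?f ?L"
      by (rule sum.reindex_bij_witness[of _ prod.swap prod.swap]) auto
    finally show ?thesis by (rule sym)
  qed
  finally show ?thesis .
qed

lemma transposition_sum_add: "transposition_sum n (u + v) = transposition_sum n u + transposition_sum n v"
  by (simp only: transposition_sum_def perm_act_add sum.distrib case_prod_unfold)

lemma transposition_sum_scale: "transposition_sum n (cscale c u) = cscale c (transposition_sum n u)"
  by (simp only: transposition_sum_def perm_act_scale cfun.scale_sum_right case_prod_unfold)

lemma comp_transpose: "inj \<sigma> \<Longrightarrow> \<sigma> \<circ> transpose i k = transpose (\<sigma> i) (\<sigma> k) \<circ> \<sigma>"
  by (auto simp: fun_eq_iff transpose_def inj_eq)

lemma transposition_sum_perm_act:
  assumes \<sigma>: "\<sigma> permutes {1..n}"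
  shows "transposition_sum n (perm_act n \<sigma> u) = perm_act n \<sigma> (transposition_sum n u)"
proof -
  have in_n: "\<sigma> k \<in> {1..n} \<longleftrightarrow> k \<in> {1..n}" for k by (rule permutes_in_image[OF \<sigma>])
  have in_n': "inv \<sigma> k \<in> {1..n} \<longleftrightarrow> k \<in> {1..n}" for k
    by (rule permutes_in_image[OF permutes_inv[OF \<sigma>]])
  note inv = permutes_inverses[OF \<sigma>]
  have "perm_act n \<sigma> (transposition_sum n u)
      = (\<Sum>(i, k)\<in>pairs n. perm_act n \<sigma> (perm_act n (transpose i k) u))"
    by (simp only: transposition_sum_def perm_act_sum case_prod_unfold)
  also have "\<dots> = (\<Sum>(i, k)\<in>pairs n. perm_act n (transpose (\<sigma> i) (\<sigma> k)) (perm_act n \<sigma> u))"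
  proof (rule sum.cong[OF refl])
    fix x assume x: "x \<in> pairs n"
    obtain i k where ik: "x = (i, k)" by (cases x)
    have t: "transpose i k permutes {1..n}" "transpose (\<sigma> i) (\<sigma> k) permutes {1..n}"
      using x in_n unfolding ik pairs_def by (intro permutes_swap_id; blast)+
    show "(case x of (i, k) \<Rightarrow> perm_act n \<sigma> (perm_act n (transpose i k) u))
        = (case x of (i, k) \<Rightarrow> perm_act n (transpose (\<sigma> i) (\<sigma> k)) (perm_act n \<sigma> u))"
      by (simp only: ik prod.case perm_act_comp[OF \<sigma> t(1)] perm_act_comp[OF t(2) \<sigma>]
          comp_transpose[OF permutes_inj[OF \<sigma>]])
  qed
  also have "\<dots> = transposition_sum n (perm_act n \<sigma> u)"
    unfolding transposition_sum_def
  proof (rule sum.reindex_bij_witness[of _ "\<lambda>(i, k). (inv \<sigma> i, inv \<sigma> k)" "\<lambda>(i, k). (\<sigma> i, \<sigma> k)"])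
    fix x assume x: "x \<in> pairs n"
    obtain i k where ik: "x = (i, k)" by (cases x)
    have "i \<in> {1..n}" "k \<in> {1..n}" "i \<noteq> k" using x by (simp_all add: ik pairs_def)
    then show "(case x of (i, k) \<Rightarrow> (\<sigma> i, \<sigma> k)) \<in> pairs n"
      "(case x of (i, k) \<Rightarrow> (inv \<sigma> i, inv \<sigma> k)) \<in> pairs n"
      unfolding ik pairs_def prod.case mem_Collect_eq using in_n in_n' inv by metis+
  qed (simp_all only: case_prod_unfold inv fst_conv snd_conv prod.collapse)
  finally show ?thesis by (rule sym)
qed

definition content :: "(nat \<Rightarrow> nat) \<Rightarrow> complex" where
  "content lam = (\<Sum>(i, j)\<in>diagram lam. of_nat j - of_nat i)"

context numbering
begin

lemma content_eq: "content lam = (\<Sum>k\<in>{1..n}. of_nat (col k) - of_nat (row k))"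
proof -
  have "(\<Sum>k\<in>{1..n}. of_nat (col k) - of_nat (row k) :: complex)
      = (\<Sum>b\<in>diagram lam. of_nat (col (T b)) - of_nat (row (T b)))"
    by (rule sum.reindex_bij_betw[OF bij, symmetric])
  also have "\<dots> = content lam" unfolding content_def by (rule sum.cong) auto
  finally show ?thesis by (rule sym)
qed

lemma transposition_sum_antisym:
  "transposition_sum n (antisym u) = antisym (transposition_sum n u)"
proof -
  have add: "transposition_sum n (\<Sum>i\<in>A. f i) = (\<Sum>i\<in>A. transposition_sum n (f i))"
    for A :: "(nat \<Rightarrow> nat) set" and f
    unfolding transposition_sum_def perm_act_sum case_prod_unfold by (rule sum.swap)
  show ?thesis
    unfolding antisym_def add
    by (rule sum.cong[OF refl]) (simp only: transposition_sum_scale transposition_sum_perm_act[OF C_permutes])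
qed

text \<open>Exchanging two entries of one row does not change the word, and exchanging two entries of one
  column changes the sign. In all other cases the smaller of the two letters ends up in a column that
  already contains it.\<close>

lemma antisym_transpose_word:
  assumes ik: "i \<in> {1..n}" "k \<in> {1..n}" "i \<noteq> k"
  shows "antisym (perm_act n (transpose i k) (wvec word))
    = cscale ((if row i = row k then 1 else 0) - (if col i = col k then 1 else 0)) (specht_vec lam n T)"
proof -
  have t: "transpose i k permutes {1..n}" using ik by (intro permutes_swap_id)
  define w where "w = place_perm (transpose i k) word"
  have act: "perm_act n (transpose i k) (wvec word) = wvec w"
    unfolding w_def by (rule perm_act_wvec[OF t word_in_words])
  have w_words: "w \<in> words n" unfolding w_def by (rule place_perm_in_words[OF t word_in_words])
  have nth: "w ! (l - 1) = row (transpose i k l)" if l: "l \<in> {1..n}" for l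
  proof -
    have "transpose i k l \<in> {1..n}" using permutes_in_image[OF t] l by blast
    moreover have "w ! (l - 1) = word ! (transpose i k l - 1)"
      unfolding w_def using l by (subst nth_place_perm) auto
    ultimately show ?thesis by (simp only: nth_word_pred)
  qed
  consider "row i = row k" | "col i = col k" "row i \<noteq> row k" | "row i < row k" "col i \<noteq> col k"
    | "row k < row i" "col i \<noteq> col k" by linarith
  then show ?thesis
  proof cases
    case 1
    then have "col i \<noteq> col k" using row_col_eqD ik by blast
    have "w = word"
    proof (rule nth_equalityI)
      show "length w = length word" unfolding w_def by (rule length_place_perm)
      fix l assume "l < length w"
      then have l: "Suc l \<in> {1..n}" by (simp add: w_def)
      have "w ! l = row (transpose i k (Suc l))" using nth[OF l] by simp
      also have "\<dots> = row (Suc l)" using 1 by (auto simp: transpose_def)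
      also have "\<dots> = word ! l" using nth_word_pred[OF l] by simp
      finally show "w ! l = word ! l" .
    qed
    then show ?thesis
      using 1 \<open>col i \<noteq> col k\<close> by (simp only: act if_True if_False diff_zero cfun.scale_one specht_vec_eq_antisym simp_thms)
  next
    case 2
    have "antisym (perm_act n (transpose i k) (wvec word))
        = cscale (of_int (sign (transpose i k))) (antisym (wvec word))"
      by (rule antisym_perm_act[OF C_transpose[OF ik(1,2) 2(1)]])
    moreover have "of_int (sign (transpose i k)) = (- 1 :: complex)" using ik(3) by (simp add: sign_swap_id)
    moreover have "(if row i = row k then 1 else 0) - (if col i = col k then 1 else 0) = (- 1 :: complex)"
      using 2 by simp
    ultimately show ?thesis by (simp only: specht_vec_eq_antisym)
  next
    case 3
    have D: "(row i, col k) \<in> diagram lam"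
      using diagram_upward[OF part box_in_diagram[OF ik(2)], of "row i" "col k"]
        3 row_bounds[OF ik(1)] col_bounds[OF ik(2)] by simp
    define p where "p = T (row i, col k)"
    have p: "p \<in> {1..n}" "row p = row i" "col p = col k"
      unfolding p_def by (rule T_in[OF D], rule row_T[OF D], rule col_T[OF D])
    have "p \<noteq> k" "p \<noteq> i" using p 3 by auto
    then have "w ! (p - 1) = w ! (k - 1)" using nth[OF p(1)] nth[OF ik(2)] p by (simp add: transpose_def)
    then have "antisym (wvec w) = 0"
      by (rule antisym_repeated_letter[OF w_words p(1) ik(2) \<open>p \<noteq> k\<close> p(3)])
    moreover have "(if row i = row k then 1 else 0) - (if col i = col k then 1 else 0) = (0 :: complex)"
      using 3 by simp
    ultimately show ?thesis by (simp only: act cfun.scale_zero_left)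
  next
    case 4
    have D: "(row k, col i) \<in> diagram lam"
      using diagram_upward[OF part box_in_diagram[OF ik(1)], of "row k" "col i"]
        4 row_bounds[OF ik(2)] col_bounds[OF ik(1)] by simp
    define p where "p = T (row k, col i)"
    have p: "p \<in> {1..n}" "row p = row k" "col p = col i"
      unfolding p_def by (rule T_in[OF D], rule row_T[OF D], rule col_T[OF D])
    have "p \<noteq> k" "p \<noteq> i" using p 4 by auto
    then have "w ! (p - 1) = w ! (i - 1)" using nth[OF p(1)] nth[OF ik(1)] p by (simp add: transpose_def)
    then have "antisym (wvec w) = 0"
      by (rule antisym_repeated_letter[OF w_words p(1) ik(1) \<open>p \<noteq> i\<close> p(3)])
    moreover have "(if row i = row k then 1 else 0) - (if col i = col k then 1 else 0) = (0 :: complex)"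
      using 4 by simp
    ultimately show ?thesis by (simp only: act cfun.scale_zero_left)
  qed
qed

lemma card_left_in_row:
  assumes k: "k \<in> {1..n}"
  shows "card {i\<in>{1..n}. row i = row k \<and> col i < col k} = col k - 1"
proof -
  have D: "(row k, j) \<in> diagram lam" if "j \<in> {1..<col k}" for j
    by (rule diagram_upward[OF part box_in_diagram[OF k]]) (use that row_bounds[OF k] in simp_all)
  have "bij_betw col {i\<in>{1..n}. row i = row k \<and> col i < col k} {1..<col k}"
  proof (rule bij_betw_byWitness[where f' = "\<lambda>j. T (row k, j)"])
    show "\<forall>i\<in>{i\<in>{1..n}. row i = row k \<and> col i < col k}. T (row k, col i) = i"
    proof
      fix i assume "i \<in> {i\<in>{1..n}. row i = row k \<and> col i < col k}"
      then show "T (row k, col i) = i" using T_box[of i] by simp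
    qed
    show "\<forall>j\<in>{1..<col k}. col (T (row k, j)) = j" by (rule ballI) (rule col_T[OF D])
    show "col ` {i\<in>{1..n}. row i = row k \<and> col i < col k} \<subseteq> {1..<col k}"
    proof clarify
      fix i assume "i \<in> {1..n}" "col i < col k"
      then show "col i \<in> {1..<col k}" using col_bounds[of i] by simp
    qed
    show "(\<lambda>j. T (row k, j)) ` {1..<col k} \<subseteq> {i\<in>{1..n}. row i = row k \<and> col i < col k}"
    proof clarify
      fix j assume j: "j \<in> {1..<col k}"
      show "T (row k, j) \<in> {1..n} \<and> row (T (row k, j)) = row k \<and> col (T (row k, j)) < col k"
        using T_in[OF D[OF j]] row_T[OF D[OF j]] col_T[OF D[OF j]] j by simp
    qed
  qed
  from bij_betw_same_card[OF this] show ?thesis by simp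
qed

lemma card_above_in_col:
  assumes k: "k \<in> {1..n}"
  shows "card {i\<in>{1..n}. col i = col k \<and> row i < row k} = row k - 1"
proof -
  have D: "(i, col k) \<in> diagram lam" if "i \<in> {1..<row k}" for i
    by (rule diagram_upward[OF part box_in_diagram[OF k]]) (use that col_bounds[OF k] in simp_all)
  have "bij_betw row {i\<in>{1..n}. col i = col k \<and> row i < row k} {1..<row k}"
  proof (rule bij_betw_byWitness[where f' = "\<lambda>i. T (i, col k)"])
    show "\<forall>i\<in>{i\<in>{1..n}. col i = col k \<and> row i < row k}. T (row i, col k) = i"
    proof
      fix i assume "i \<in> {i\<in>{1..n}. col i = col k \<and> row i < row k}"
      then show "T (row i, col k) = i" using T_box[of i] by simp
    qed
    show "\<forall>i\<in>{1..<row k}. row (T (i, col k)) = i" by (rule ballI) (rule row_T[OF D])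
    show "row ` {i\<in>{1..n}. col i = col k \<and> row i < row k} \<subseteq> {1..<row k}"
    proof clarify
      fix i assume "i \<in> {1..n}" "row i < row k"
      then show "row i \<in> {1..<row k}" using row_bounds[of i] by simp
    qed
    show "(\<lambda>i. T (i, col k)) ` {1..<row k} \<subseteq> {i\<in>{1..n}. col i = col k \<and> row i < row k}"
    proof clarify
      fix i assume i: "i \<in> {1..<row k}"
      show "T (i, col k) \<in> {1..n} \<and> col (T (i, col k)) = col k \<and> row (T (i, col k)) < row k"
        using T_in[OF D[OF i]] row_T[OF D[OF i]] col_T[OF D[OF i]] i by simp
    qed
  qed
  from bij_betw_same_card[OF this] show ?thesis by simp
qed

text \<open>Two different entries of a row lie in different columns, so each ordered pair of them has a left
  and a right member. The same holds with rows and columns exchanged.\<close>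

lemma sum_pairs_same:
  fixes f g :: "nat \<Rightarrow> nat"
  assumes inj: "\<And>i k. i \<in> {1..n} \<Longrightarrow> k \<in> {1..n} \<Longrightarrow> f i = f k \<Longrightarrow> g i = g k \<Longrightarrow> i = k"
  shows "(\<Sum>(i, k)\<in>pairs n. if f i = f k then 1 else 0 :: complex)
    = 2 * (\<Sum>k\<in>{1..n}. of_nat (card {i\<in>{1..n}. f i = f k \<and> g i < g k}))"
proof -
  let ?h = "\<lambda>(i :: nat, k :: nat). 1 :: complex"
  let ?L = "{(i, k). i \<in> {1..n} \<and> k \<in> {1..n} \<and> f i = f k \<and> g i < g k}"
  let ?G = "{(i, k). i \<in> {1..n} \<and> k \<in> {1..n} \<and> f i = f k \<and> g k < g i}"
  have fin: "finite ?L" "finite ?G"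
    by (rule finite_subset[of _ "{1..n} \<times> {1..n}"]; auto)+
  have iff: "i \<noteq> k \<longleftrightarrow> g i < g k \<or> g k < g i" if "i \<in> {1..n}" "k \<in> {1..n}" "f i = f k" for i k
  proof
    assume "i \<noteq> k"
    then have "g i \<noteq> g k" using inj[OF that] by blast
    then show "g i < g k \<or> g k < g i" by linarith
  qed auto
  have eq: "?L \<union> ?G = {x \<in> pairs n. f (fst x) = f (snd x)}"
  proof (rule set_eqI)
    fix x :: "nat \<times> nat"
    obtain i k where "x = (i, k)" by (cases x)
    then show "x \<in> ?L \<union> ?G \<longleftrightarrow> x \<in> {x \<in> pairs n. f (fst x) = f (snd x)}"
      unfolding pairs_def using iff[of i k] by simp blast
  qed
  have "(\<Sum>(i, k)\<in>pairs n. if f i = f k then 1 else 0 :: complex)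
      = (\<Sum>x\<in>pairs n. if f (fst x) = f (snd x) then 1 else 0)"
    by (simp only: case_prod_unfold)
  also have "\<dots> = (\<Sum>x | x \<in> pairs n \<and> f (fst x) = f (snd x). 1)"
    by (rule sum.inter_filter[OF finite_pairs, symmetric])
  also have "\<dots> = sum ?h (?L \<union> ?G)" unfolding eq by (rule sum.cong[OF refl]) simp
  also have "\<dots> = sum ?h ?L + sum ?h ?G" by (rule sum.union_disjoint[OF fin]) auto
  also have "sum ?h ?G = sum ?h ?L"
    by (rule sum.reindex_bij_witness[of _ prod.swap prod.swap]) auto
  also have "sum ?h ?L = (\<Sum>(k, i)\<in>(SIGMA k:{1..n}. {i\<in>{1..n}. f i = f k \<and> g i < g k}). 1)"
    by (rule sum.reindex_bij_witness[of _ prod.swap prod.swap]) auto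
  also have "\<dots> = (\<Sum>k\<in>{1..n}. of_nat (card {i\<in>{1..n}. f i = f k \<and> g i < g k}))"
  proof -
    have "(\<Sum>(k, i)\<in>(SIGMA k:{1..n}. {i\<in>{1..n}. f i = f k \<and> g i < g k}). 1 :: complex)
        = (\<Sum>k\<in>{1..n}. \<Sum>i\<in>{i\<in>{1..n}. f i = f k \<and> g i < g k}. 1)"
      by (rule sum.Sigma[symmetric]) simp_all
    then show ?thesis by (simp only: sum_constant mult_1_right)
  qed
  finally show ?thesis by (simp only: mult_2)
qed

text \<open>By \<open>antisym_transpose_word\<close> the eigenvalue is the number of ordered pairs in a common row minus
  the number in a common column. The box \<open>(i, j)\<close> has \<open>j - 1\<close> boxes to its left and \<open>i - 1\<close> above it, and
  the difference is its content.\<close>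

lemma transposition_sum_specht_vec:
  "transposition_sum n (specht_vec lam n T) = cscale (2 * content lam) (specht_vec lam n T)"
proof -
  let ?s = "specht_vec lam n T"
  let ?r = "\<lambda>(i, k). if row i = row k then 1 else 0 :: complex"
  let ?c = "\<lambda>(i, k). if col i = col k then 1 else 0 :: complex"
  have "transposition_sum n ?s = antisym (transposition_sum n (wvec word))"
    by (simp only: specht_vec_eq_antisym transposition_sum_antisym)
  also have "\<dots> = (\<Sum>x\<in>pairs n. antisym (perm_act n (transpose (fst x) (snd x)) (wvec word)))"
    by (simp only: transposition_sum_def antisym_sum case_prod_unfold)
  also have "\<dots> = (\<Sum>x\<in>pairs n. cscale (?r x - ?c x) ?s)"
  proof (rule sum.cong[OF refl])
    fix x assume "x \<in> pairs n"
    then have "fst x \<in> {1..n}" "snd x \<in> {1..n}" "fst x \<noteq> snd x" by (auto simp: pairs_def)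
    from antisym_transpose_word[OF this]
    show "antisym (perm_act n (transpose (fst x) (snd x)) (wvec word)) = cscale (?r x - ?c x) ?s"
      by (simp only: case_prod_unfold)
  qed
  also have "\<dots> = cscale (\<Sum>x\<in>pairs n. ?r x - ?c x) ?s" by (simp only: cfun.scale_sum_left)
  also have "(\<Sum>x\<in>pairs n. ?r x - ?c x) = sum ?r (pairs n) - sum ?c (pairs n)"
    by (rule sum_subtractf)
  also have "sum ?r (pairs n)
      = 2 * (\<Sum>k\<in>{1..n}. of_nat (card {i\<in>{1..n}. row i = row k \<and> col i < col k}))"
    by (rule sum_pairs_same) (rule row_col_eqD)
  also have "(\<Sum>k\<in>{1..n}. of_nat (card {i\<in>{1..n}. row i = row k \<and> col i < col k}) :: complex)
      = (\<Sum>k\<in>{1..n}. of_nat (col k) - 1)"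
  proof (rule sum.cong[OF refl])
    fix k assume k: "k \<in> {1..n}"
    then show "of_nat (card {i\<in>{1..n}. row i = row k \<and> col i < col k}) = of_nat (col k) - (1 :: complex)"
      unfolding card_left_in_row[OF k] using col_bounds[OF k] by (simp add: of_nat_diff)
  qed
  also have "sum ?c (pairs n)
      = 2 * (\<Sum>k\<in>{1..n}. of_nat (card {i\<in>{1..n}. col i = col k \<and> row i < row k}))"
    by (rule sum_pairs_same) (rule row_col_eqD)
  also have "(\<Sum>k\<in>{1..n}. of_nat (card {i\<in>{1..n}. col i = col k \<and> row i < row k}) :: complex)
      = (\<Sum>k\<in>{1..n}. of_nat (row k) - 1)"
  proof (rule sum.cong[OF refl])
    fix k assume k: "k \<in> {1..n}"
    then show "of_nat (card {i\<in>{1..n}. col i = col k \<and> row i < row k}) = of_nat (row k) - (1 :: complex)"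
      unfolding card_above_in_col[OF k] using row_bounds[OF k] by (simp add: of_nat_diff)
  qed
  also have "2 * (\<Sum>k\<in>{1..n}. of_nat (col k) - 1) - 2 * (\<Sum>k\<in>{1..n}. of_nat (row k) - 1)
      = 2 * content lam"
    by (simp add: content_eq sum_subtractf algebra_simps)
  finally show ?thesis .
qed

end

lemma transposition_sum_specht:
  assumes part: "is_partition lam n" and v: "v \<in> specht n lam"
  shows "transposition_sum n v = cscale (2 * content lam) v"
proof -
  let ?V = "{v. transposition_sum n v = cscale (2 * content lam) v}"
  have "csubspace ?V"
  proof (rule cfun.subspaceI)
    have "transposition_sum n (cscale 0 0) = cscale 0 (transposition_sum n 0)"
      by (rule transposition_sum_scale)
    then have "transposition_sum n 0 = 0" by (simp only: cfun.scale_zero_left)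
    then show "0 \<in> ?V" by (simp only: mem_Collect_eq cfun.scale_zero_right)
  next
    fix x y assume "x \<in> ?V" "y \<in> ?V"
    then show "x + y \<in> ?V"
      by (simp only: mem_Collect_eq transposition_sum_add cfun.scale_right_distrib)
  next
    fix c x assume "x \<in> ?V"
    then have "transposition_sum n x = cscale (2 * content lam) x" by simp
    then show "cscale c x \<in> ?V"
      by (simp only: mem_Collect_eq transposition_sum_scale cfun.scale_left_commute)
  qed
  moreover have "specht_vec lam n T \<in> ?V" if "is_syt lam n T" for T
  proof -
    interpret numbering lam n T
      by unfold_locales (fact part, use that in \<open>simp only: is_syt_def\<close>)
    show ?thesis using transposition_sum_specht_vec by simp
  qed
  ultimately have "specht n lam \<subseteq> ?V"
    unfolding specht_def by (intro cfun.span_minimal) blast+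
  then show ?thesis using v by blast
qed

section \<open>Adding a letter\<close>

lemma add_letter_snoc:
  assumes "v \<in> word_space n"
  shows "add_letter n a v (y @ [b]) = (if b = a then v y else 0)"
proof -
  have "add_letter n a v (y @ [b]) = (\<Sum>w\<in>words n. if w = y then if b = a then v w else 0 else 0)"
    unfolding add_letter_def lin_ext_def sum_fun_apply
    by (rule sum.cong) (auto simp: wvec_def)
  also have "\<dots> = (if b = a then v y else 0)"
    using assms by (simp add: in_word_space)
  finally show ?thesis .
qed

lemma add_letter_Nil: "add_letter n a v [] = 0"
  unfolding add_letter_def lin_ext_def sum_fun_apply by (simp add: wvec_def)

lemma add_letter_sum: "add_letter n a (\<Sum>i\<in>A. f i) = (\<Sum>i\<in>A. add_letter n a (f i))"
proof -
  have "cscale ((\<Sum>i\<in>A. f i) w) g = (\<Sum>i\<in>A. cscale (f i w) g)" for w g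
    by (simp only: sum_fun_apply[of f A w] cfun.scale_sum_left)
  then have "add_letter n a (\<Sum>i\<in>A. f i) = (\<Sum>w\<in>words n. \<Sum>i\<in>A. cscale (f i w) (wvec (w @ [a])))"
    unfolding add_letter_def lin_ext_def by (intro sum.cong[OF refl])
  also have "\<dots> = (\<Sum>i\<in>A. add_letter n a (f i))"
    unfolding add_letter_def lin_ext_def by (rule sum.swap)
  finally show ?thesis .
qed

lemma add_letter_scale: "add_letter n a (cscale c u) = cscale c (add_letter n a u)"
  unfolding add_letter_def lin_ext_def cfun.scale_sum_right
  by (rule sum.cong[OF refl]) (simp only: cscale_apply cfun.scale_scale)

lemma add_letter_in_weight_space:
  assumes mu: "is_partition mu (Suc n)" and r: "1 \<le> r" "mu (Suc r) < mu r"
    and v: "v \<in> weight_space n (mu(r := mu r - 1))"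
  shows "add_letter n r v \<in> weight_space (Suc n) mu"
  unfolding in_weight_space
proof (intro allI impI)
  fix x assume x: "x \<notin> weight_words (Suc n) mu"
  have vw: "v \<in> word_space n" using v weight_space_subset by blast
  have la: "is_partition (mu(r := mu r - 1)) n" by (rule partition_remove_box[OF mu r])
  show "add_letter n r v x = 0"
  proof (cases x rule: rev_cases)
    case Nil
    then show ?thesis by (simp only: add_letter_Nil)
  next
    case (snoc y b)
    show ?thesis
    proof (rule ccontr)
      assume "add_letter n r v x \<noteq> 0"
      then have "b = r" "v y \<noteq> 0"
        unfolding snoc add_letter_snoc[OF vw] by (metis, metis)
      then have y: "y \<in> weight_words n (mu(r := mu r - 1))" using v unfolding in_weight_space by blast
      have "y @ [r] \<in> weight_words (Suc n) mu"
      proof (rule weight_wordsI[OF mu])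
        show "length (y @ [r]) = Suc n" "0 \<notin> set (y @ [r])"
          using y r by (auto simp: weight_words_def words_def)
        fix i :: nat assume "1 \<le> i"
        then show "count_list (y @ [r]) i = mu i"
          using weight_words_count[OF la y, of i] r by auto
      qed
      then show False using x snoc \<open>b = r\<close> by blast
    qed
  qed
qed

lemma perm_act_add_letter:
  assumes \<sigma>: "\<sigma> permutes {1..n}" and v: "v \<in> word_space n" and a: "1 \<le> a" "a \<le> Suc n"
  shows "perm_act (Suc n) \<sigma> (add_letter n a v) = add_letter n a (perm_act n \<sigma> v)"
proof -
  have \<sigma>': "\<sigma> permutes {1..Suc n}" by (rule permutes_subset[OF \<sigma>]) auto
  have letter: "add_letter n a (wvec w) = wvec (w @ [a])" if "w \<in> words n" for w
  proof
    fix x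
    show "add_letter n a (wvec w) x = wvec (w @ [a]) x"
    proof (cases x rule: rev_cases)
      case Nil
      then show ?thesis by (simp only: add_letter_Nil) (simp add: wvec_def)
    next
      case (snoc y b)
      then show ?thesis
        by (simp only: add_letter_snoc[OF wvec_in_word_space[OF that]]) (simp add: wvec_def)
    qed
  qed
  have "perm_act (Suc n) \<sigma> (add_letter n a v)
      = (\<Sum>w\<in>words n. cscale (v w) (perm_act (Suc n) \<sigma> (wvec (w @ [a]))))"
    by (simp only: add_letter_def lin_ext_def perm_act_sum perm_act_scale)
  also have "\<dots> = (\<Sum>w\<in>words n. cscale (v w) (add_letter n a (wvec (place_perm \<sigma> w))))"
  proof (rule sum.cong[OF refl])
    fix w assume w: "w \<in> words n"
    then have "w @ [a] \<in> words (Suc n)" using a by (auto simp: words_def)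
    then have "perm_act (Suc n) \<sigma> (wvec (w @ [a])) = wvec (place_perm \<sigma> w @ [a])"
      by (simp only: perm_act_wvec[OF \<sigma>'] place_perm_snoc[OF \<sigma> length_words[OF w]])
    then show "cscale (v w) (perm_act (Suc n) \<sigma> (wvec (w @ [a])))
        = cscale (v w) (add_letter n a (wvec (place_perm \<sigma> w)))"
      by (simp only: letter[OF place_perm_in_words[OF \<sigma> w]])
  qed
  also have "\<dots> = add_letter n a (perm_act n \<sigma> v)"
    unfolding perm_act_def lin_ext_def[of n "\<lambda>w. wvec (place_perm \<sigma> w)"]
    by (simp only: add_letter_sum add_letter_scale)
  finally show ?thesis .
qed

lemma jucys_murphy_add_letter:
  assumes v: "v \<in> word_space n" and a: "1 \<le> a" "a \<le> Suc n" and k: "k \<in> {1..n}"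
  shows "jucys_murphy (Suc n) k (add_letter n a v) = add_letter n a (jucys_murphy n k v)"
  unfolding jucys_murphy_def add_letter_sum
  by (rule sum.cong[OF refl]) (rule perm_act_add_letter[OF transpose_permutes[OF k] v a])

lemma iprod_add_letter:
  assumes a: "1 \<le> a" "a \<le> Suc n"
  shows "iprod (Suc n) (add_letter n a v) u = iprod n v (last_part a u)"
proof -
  have "iprod (Suc n) (add_letter n a v) u
      = (\<Sum>w\<in>words n. v w * iprod (Suc n) (wvec (w @ [a])) u)"
    by (simp only: add_letter_def lin_ext_def iprod_sum_left iprod_scale_left)
  also have "\<dots> = iprod n v (last_part a u)"
    unfolding iprod_def[of n]
  proof (rule sum.cong[OF refl])
    fix w assume "w \<in> words n"
    then have "w @ [a] \<in> words (Suc n)" using a by (auto simp: words_def)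
    then have "iprod (Suc n) (wvec (w @ [a])) u = cnj (u (w @ [a]))"
      by (subst iprod_commute) (simp only: iprod_wvec)
    then show "v w * iprod (Suc n) (wvec (w @ [a])) u = v w * cnj (last_part a u w)"
      by (simp only: last_part_def)
  qed
  finally show ?thesis .
qed

section \<open>Subtableaux\<close>

lemma downward_closed_eq_interval:
  fixes A :: "nat set"
  assumes "finite A" "\<And>j. j \<in> A \<Longrightarrow> 1 \<le> j" "\<And>i j. j \<in> A \<Longrightarrow> 1 \<le> i \<Longrightarrow> i \<le> j \<Longrightarrow> i \<in> A"
  shows "A = {1..card A}"
proof (cases "A = {}")
  case False
  then have m: "Max A \<in> A" using assms(1) by (rule Max_in[rotated])
  have "A = {1..Max A}"
  proof
    show "A \<subseteq> {1..Max A}" using assms(1,2) Max_ge by auto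
    show "{1..Max A} \<subseteq> A" using assms(3)[OF m] by auto
  qed
  moreover from this have "card A = Max A" by (metis card_atLeastAtMost diff_Suc_1)
  ultimately show ?thesis by (simp only:)
qed simp

text \<open>The diagram shows every row length except the value at index 0.\<close>

lemma diagram_injective:
  assumes "diagram lam = diagram mu" "lam 0 = 0" "mu 0 = 0"
  shows "lam = mu"
proof
  fix i
  have row: "nu i = card {j. (i, j) \<in> diagram nu}" if "nu 0 = 0" for nu
  proof (cases "i = 0")
    case False
    then have "{j. (i, j) \<in> diagram nu} = {1..nu i}" by (auto simp: diagram_def)
    then show ?thesis by simp
  qed (simp add: that diagram_def)
  show "lam i = mu i" using row[of lam] row[of mu] assms by simp
qed

context standard
begin

abbreviation sub where "sub \<equiv> subshape lam T"

lemma row_increasing: "(i, j) \<in> diagram lam \<Longrightarrow> (i, j') \<in> diagram lam \<Longrightarrow> j < j' \<Longrightarrow> T (i, j) < T (i, j')"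
  and col_increasing: "(i, j) \<in> diagram lam \<Longrightarrow> (i', j) \<in> diagram lam \<Longrightarrow> i < i' \<Longrightarrow> T (i, j) < T (i', j)"
  using syt unfolding is_syt_def by blast+

text \<open>Entries increase along rows, so those at most \<open>m\<close> occupy an initial segment of each row.\<close>

lemma subshape_row: "{j. (i, j) \<in> diagram lam \<and> T (i, j) \<le> m} = {1..sub m i}"
  unfolding subshape_def
proof (rule downward_closed_eq_interval)
  show "finite {j. (i, j) \<in> diagram lam \<and> T (i, j) \<le> m}"
    by (rule finite_subset[of _ "{..lam i}"]) (auto simp: diagram_def)
  show "1 \<le> j" if "j \<in> {j. (i, j) \<in> diagram lam \<and> T (i, j) \<le> m}" for j
    using that by (auto simp: diagram_def)
  show "j' \<in> {j. (i, j) \<in> diagram lam \<and> T (i, j) \<le> m}"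
    if "j \<in> {j. (i, j) \<in> diagram lam \<and> T (i, j) \<le> m}" "1 \<le> j'" "j' \<le> j" for j' j
  proof -
    have j: "(i, j) \<in> diagram lam" "T (i, j) \<le> m" using that by auto
    then have "(i, j') \<in> diagram lam" using that by (auto simp: diagram_def)
    moreover from this have "T (i, j') \<le> m" using row_increasing[of i j' j] j that(3) by (cases "j' = j") auto
    ultimately show ?thesis by simp
  qed
qed

lemma diagram_subshape: "diagram (sub m) = {b \<in> diagram lam. T b \<le> m}"
proof -
  have "(i, j) \<in> diagram (sub m) \<longleftrightarrow> (i, j) \<in> diagram lam \<and> T (i, j) \<le> m" for i j
  proof -
    have "(i, j) \<in> diagram (sub m) \<longleftrightarrow> 1 \<le> i \<and> j \<in> {1..sub m i}" by (auto simp: diagram_def)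
    also have "\<dots> \<longleftrightarrow> 1 \<le> i \<and> (i, j) \<in> diagram lam \<and> T (i, j) \<le> m"
      unfolding subshape_row[symmetric] by simp
    also have "\<dots> \<longleftrightarrow> (i, j) \<in> diagram lam \<and> T (i, j) \<le> m" by (auto simp: diagram_def)
    finally show ?thesis .
  qed
  then show ?thesis by auto
qed

lemma bij_subshape:
  assumes "m \<le> n"
  shows "bij_betw T (diagram (sub m)) {1..m}"
proof -
  have "T ` {b \<in> diagram lam. T b \<le> m} = {1..m}"
  proof
    show "T ` {b \<in> diagram lam. T b \<le> m} \<subseteq> {1..m}" using T_in by auto
    show "{1..m} \<subseteq> T ` {b \<in> diagram lam. T b \<le> m}"
    proof
      fix k assume "k \<in> {1..m}"
      then have "k \<in> {1..n}" "k \<le> m" using assms by auto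
      then show "k \<in> T ` {b \<in> diagram lam. T b \<le> m}"
        using T_box[of k] box_in_diagram[of k] by (intro image_eqI[of _ _ "(row k, col k)"]) auto
    qed
  qed
  then show ?thesis
    unfolding diagram_subshape using bij by (auto simp: bij_betw_def inj_on_def)
qed

lemma partition_subshape:
  assumes "m \<le> n"
  shows "is_partition (sub m) m"
proof -
  have zero: "sub m 0 = 0" by (simp add: subshape_def diagram_def)
  have dec: "sub m (Suc i) \<le> sub m i" if "1 \<le> i" for i
  proof -
    have "{j. (Suc i, j) \<in> diagram lam \<and> T (Suc i, j) \<le> m} \<subseteq> {j. (i, j) \<in> diagram lam \<and> T (i, j) \<le> m}"
    proof clarify
      fix j assume j: "(Suc i, j) \<in> diagram lam" "T (Suc i, j) \<le> m"
      then have "1 \<le> j" by (simp add: diagram_def)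
      then have "(i, j) \<in> diagram lam" using diagram_upward[OF part j(1)] that by auto
      moreover from col_increasing[OF this j(1)] have "T (i, j) \<le> m" using j(2) by simp
      ultimately show "(i, j) \<in> diagram lam \<and> T (i, j) \<le> m" by blast
    qed
    then show ?thesis unfolding subshape_row by (cases "sub m (Suc i)") simp_all
  qed
  have le: "sub m i \<le> lam i" for i
  proof (cases "i = 0")
    case False
    have "{1..sub m i} \<subseteq> {1..lam i}" unfolding subshape_row[symmetric] by (auto simp: diagram_def)
    then show ?thesis by (cases "sub m i") auto
  qed (simp add: zero)
  have fin: "finite {i. sub m i \<noteq> 0}"
  proof (rule finite_subset)
    show "{i. sub m i \<noteq> 0} \<subseteq> {i. lam i \<noteq> 0}" using le by (auto simp: le_eq_less_or_eq) (metis gr0I le not_less)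
    show "finite {i. lam i \<noteq> 0}" using part by (simp add: is_partition_def)
  qed
  have "diagram (sub m) = (SIGMA i:{i. sub m i \<noteq> 0}. {1..sub m i})"
    using zero by (auto simp: diagram_def) (metis gr0I less_le_trans not_less_eq_eq not_less_zero)+
  then have "card (diagram (sub m)) = (\<Sum>i | sub m i \<noteq> 0. sub m i)" using fin by simp
  then have "(\<Sum>i | sub m i \<noteq> 0. sub m i) = m"
    using bij_betw_same_card[OF bij_subshape[OF assms]] by simp
  then show ?thesis using zero dec fin by (simp add: is_partition_def)
qed

lemma syt_subshape:
  assumes "m \<le> n"
  shows "is_syt (sub m) m T"
  using bij_subshape[OF assms] row_increasing col_increasing
  unfolding is_syt_def is_tableau_def diagram_subshape by simp

lemma standard_subshape:
  assumes "m \<le> n"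
  shows "standard (sub m) m T"
proof unfold_locales
  show "is_partition (sub m) m" by (rule partition_subshape[OF assms])
  show "is_syt (sub m) m T" by (rule syt_subshape[OF assms])
  then show "is_tableau (sub m) m T" by (simp only: is_syt_def)
qed

lemma row_col_subshape:
  assumes "m \<le> n" "k \<in> {1..m}"
  shows "row_of (sub m) T k = row k" "col_of (sub m) T k = col k"
proof -
  interpret small: standard "sub m" m T by (rule standard_subshape[OF assms(1)])
  have "(row_of (sub m) T k, col_of (sub m) T k) \<in> diagram lam"
    using small.box_in_diagram[OF assms(2)] unfolding diagram_subshape by blast
  from row_T[OF this] col_T[OF this]
  show "row_of (sub m) T k = row k" "col_of (sub m) T k = col k"
    unfolding small.T_box[OF assms(2)] by simp_all
qed

text \<open>The entries to the right of and below \<open>m + 1\<close> are larger, hence its box is a corner of the shape of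
  the entries \<open>1, \<dots>, m + 1\<close>.\<close>

lemma subshape_corner:
  assumes m: "Suc m \<le> n"
  defines "a \<equiv> row (Suc m)"
  shows "1 \<le> a" "sub (Suc m) (Suc a) < sub (Suc m) a"
    "sub m = (sub (Suc m))(a := sub (Suc m) a - 1)"
proof -
  have k: "Suc m \<in> {1..n}" using m by simp
  define c where "c = col (Suc m)"
  have box: "(a, c) \<in> diagram lam" "T (a, c) = Suc m"
    unfolding a_def c_def by (rule box_in_diagram[OF k], rule T_box[OF k])
  then have D: "(a, c) \<in> diagram (sub (Suc m))" unfolding diagram_subshape by simp
  show a: "1 \<le> a" using box by (simp add: diagram_def)
  have c: "1 \<le> c" "c \<le> sub (Suc m) a" using D by (simp_all add: diagram_def)
  have c_eq: "c = sub (Suc m) a"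
  proof (rule ccontr)
    assume "c \<noteq> sub (Suc m) a"
    then have lt: "c < sub (Suc m) a" using c by simp
    have "(a, sub (Suc m) a) \<in> diagram (sub (Suc m))" using a c by (simp add: diagram_def)
    then have "(a, sub (Suc m) a) \<in> diagram lam" "T (a, sub (Suc m) a) \<le> Suc m"
      unfolding diagram_subshape by simp_all
    then show False using row_increasing[OF box(1) _ lt] box(2) by simp
  qed
  show corner: "sub (Suc m) (Suc a) < sub (Suc m) a"
  proof (rule ccontr)
    assume "\<not> sub (Suc m) (Suc a) < sub (Suc m) a"
    then have "(Suc a, c) \<in> diagram (sub (Suc m))" using c c_eq by (simp add: diagram_def)
    then have "(Suc a, c) \<in> diagram lam" "T (Suc a, c) \<le> Suc m"
      unfolding diagram_subshape by simp_all
    then show False using col_increasing[OF box(1), of "Suc a"] box(2) by simp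
  qed
  show "sub m = (sub (Suc m))(a := sub (Suc m) a - 1)"
  proof (rule diagram_injective)
    have "b = (a, c)" if "b \<in> diagram lam" "T b = Suc m" for b
      using that box bij unfolding bij_betw_def by (metis inj_onD)
    then have "{b \<in> diagram lam. T b \<le> m} = {b \<in> diagram lam. T b \<le> Suc m} - {(a, c)}"
      using box(2) by (auto simp: le_Suc_eq)
    then show "diagram (sub m) = diagram ((sub (Suc m))(a := sub (Suc m) a - 1))"
      unfolding diagram_remove_box[where mu = "sub (Suc m)", OF corner]
      by (simp only: diagram_subshape c_eq)
    show "sub m 0 = 0" by (simp add: subshape_def diagram_def)
    show "((sub (Suc m))(a := sub (Suc m) a - 1)) 0 = 0" using a by (simp add: subshape_def diagram_def)
  qed
qed

lemma subshape_full: "sub n = lam"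
proof (rule diagram_injective)
  show "diagram (sub n) = diagram lam" unfolding diagram_subshape using T_in by auto
  show "sub n 0 = 0" by (simp add: subshape_def diagram_def)
  show "lam 0 = 0" using part by (simp add: is_partition_def)
qed

end

section \<open>The eigenvalues\<close>

lemma galg_act_scale: "galg_act n (cscale c a) v = cscale c (galg_act n a v)"
  unfolding galg_act_def cfun.scale_sum_right
  by (rule sum.cong[OF refl]) (simp only: cscale_apply cfun.scale_scale)

lemma galg_act_sum: "galg_act n (\<Sum>i\<in>A. a i) v = (\<Sum>i\<in>A. galg_act n (a i) v)"
proof -
  have "cscale ((\<Sum>i\<in>A. a i) \<sigma>) w = (\<Sum>i\<in>A. cscale (a i \<sigma>) w)" for \<sigma> and w :: vect
    by (simp only: sum_fun_apply[of a A \<sigma>] cfun.scale_sum_left)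
  then have "galg_act n (\<Sum>i\<in>A. a i) v
      = (\<Sum>\<sigma> | \<sigma> permutes {1..n}. \<Sum>i\<in>A. cscale (a i \<sigma>) (perm_act n \<sigma> v))"
    unfolding galg_act_def by (intro sum.cong[OF refl])
  also have "\<dots> = (\<Sum>i\<in>A. galg_act n (a i) v)"
    unfolding galg_act_def by (rule sum.swap)
  finally show ?thesis .
qed

lemma galg_act_gvec:
  assumes "\<tau> permutes {1..n}"
  shows "galg_act n (gvec \<tau>) v = perm_act n \<tau> v"
proof -
  have "galg_act n (gvec \<tau>) v = (\<Sum>\<sigma> | \<sigma> permutes {1..n}. if \<sigma> = \<tau> then perm_act n \<sigma> v else 0)"
    unfolding galg_act_def gvec_def
    by (rule sum.cong[OF refl]) (simp only: cfun.scale_one cfun.scale_zero_left split: if_split, simp)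
  also have "\<dots> = perm_act n \<tau> v"
    using assms finite_permutations[of "{1..n}"] by (simp only: sum.delta finite_atLeastAtMost mem_Collect_eq if_True)
  finally show ?thesis .
qed

lemma galg_act_walk_sum:
  assumes v: "v \<in> word_space n"
  shows "galg_act n (walk_sum n) v = (\<Sum>k\<in>{1..n}. cscale (1 / of_nat k) (v + jucys_murphy n k v))"
proof -
  have "galg_act n (walk_sum n) v
      = (\<Sum>k\<in>{1..n}. cscale (1 / of_nat k) (\<Sum>i\<in>{1..k}. galg_act n (gvec (transpose i k)) v))"
    by (simp only: walk_sum_def galg_act_sum galg_act_scale cfun.scale_sum_right)
  also have "\<dots> = (\<Sum>k\<in>{1..n}. cscale (1 / of_nat k) (v + jucys_murphy n k v))"
  proof (rule sum.cong[OF refl])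
    fix k assume k: "k \<in> {1..n}"
    have "(\<Sum>i\<in>{1..k}. galg_act n (gvec (transpose i k)) v) = (\<Sum>i\<in>{1..k}. perm_act n (transpose i k) v)"
    proof (rule sum.cong[OF refl])
      fix i assume "i \<in> {1..k}"
      then have "i \<in> {1..n}" using k by auto
      then show "galg_act n (gvec (transpose i k)) v = perm_act n (transpose i k) v"
        using k by (intro galg_act_gvec permutes_swap_id)
    qed
    also have "\<dots> = (\<Sum>i\<in>insert k {1..<k}. perm_act n (transpose i k) v)"
      by (rule sum.cong) (use k in auto)
    also have "\<dots> = perm_act n (transpose k k) v + (\<Sum>i\<in>{1..<k}. perm_act n (transpose i k) v)"
      by (rule sum.insert) auto
    also have "transpose k k = id" by (simp add: fun_eq_iff transpose_def)
    also have "perm_act n id v = v" by (rule perm_act_id[OF v])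
    finally show "cscale (1 / of_nat k) (\<Sum>i\<in>{1..k}. galg_act n (gvec (transpose i k)) v)
        = cscale (1 / of_nat k) (v + jucys_murphy n k v)"
      by (simp only: jucys_murphy_def)
  qed
  finally show ?thesis .
qed

lemma sum_jucys_murphy_specht:
  assumes part: "is_partition lam n" and v: "v \<in> specht n lam"
  shows "(\<Sum>k\<in>{1..n}. jucys_murphy n k v) = cscale (content lam) v"
proof -
  let ?J = "\<Sum>k\<in>{1..n}. jucys_murphy n k v"
  have eq: "?J + ?J = cscale (2 * content lam) v"
    using transposition_sum_specht[OF part v] by (simp only: transposition_sum_eq_jucys_murphy)
  show ?thesis
  proof
    fix x
    have "?J x + ?J x = 2 * content lam * v x" using fun_cong[OF eq, of x] by (simp only: plus_fun_apply cscale_apply)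
    then show "?J x = cscale (content lam) v x" by (simp only: cscale_apply) (simp add: mult_2[symmetric])
  qed
qed

text \<open>Choose \<open>u \<in> S\<close> from which removing the last letter \<open>r\<close> leaves \<open>v\<close>. If the projection vanished,
  then \<open>0 = \<langle>v \<cdot> r, u\<rangle> = \<langle>v, v\<rangle>\<close>.\<close>

lemma (in standard) isotypic_proj_add_letter_nonzero:
  assumes r: "1 \<le> r" "r \<le> n" "lam (Suc r) < lam r" and n: "n = Suc m"
    and v: "v \<in> specht m (lam(r := lam r - 1))" "v \<noteq> 0" and word: "v \<in> word_space m"
    and M: "add_letter m r v \<in> M"
  shows "isotypic_proj n M S (add_letter m r v) \<noteq> 0"
proof
  assume zero: "isotypic_proj n M S (add_letter m r v) = 0"
  have "\<exists>u\<in>specht (Suc m) lam. last_part r u = v \<and> (\<forall>b>r. last_part b u = 0)"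
    by (rule specht_restriction[OF part[unfolded n] r(1,3) v(1)])
  then obtain u where u: "u \<in> specht (Suc m) lam" "last_part r u = v" by (elim bexE conjE)
  have "add_letter m r v - isotypic_proj n M S (add_letter m r v) \<in> ocomp n M S"
    by (rule isotypic_proj_properties[OF M])
  then have "add_letter m r v \<in> ocomp n M S" unfolding zero by simp
  then have "iprod (Suc m) (add_letter m r v) u = 0" using u(1) unfolding ocomp_def n by blast
  then have "iprod m v v = 0"
    using iprod_add_letter[OF r(1), of m v u] r(2) u(2) n by simp
  then show False using iprod_self_eq_0[OF word] v(2) by blast
qed

context standard
begin

text \<open>For a single box the Specht module has to be reached through highest weight vectors: no letter of
  the word \<open>1\<close> can be replaced by a smaller one.\<close>

lemma jucys_murphy_tab_vec_1:
  assumes "1 \<le> n"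
  shows "tab_vec lam T 1 \<in> specht 1 (sub 1)" "tab_vec lam T 1 \<noteq> 0"
    "jucys_murphy 1 1 (tab_vec lam T 1) = cscale (of_nat (col 1) - of_nat (row 1)) (tab_vec lam T 1)"
proof -
  interpret small: standard "sub 1" 1 T by (rule standard_subshape[OF assms])
  have one: "(1::nat) \<in> {1..1}" by simp
  have row1: "row_of (sub 1) T 1 = 1" using small.row_bounds[OF one] by simp
  have "small.word = [1]" by (simp add: tab_word_def row1[simplified])
  then have word: "[1] \<in> weight_words 1 (sub 1)" using small.word_in_weight_words by simp
  have "raise a b (wvec [1]) = 0" if "1 \<le> a" "a < b" for a b
  proof -
    have none: "{k. k < length [1::nat] \<and> [1::nat] ! k = b} = {}" using that by auto
    have "a \<noteq> b" using that by simp
    from raise_wvec[OF this, of "[1]"] show ?thesis unfolding none by (simp only: sum.empty)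
  qed
  then have "wvec [1] \<in> hw_space 1 (sub 1)"
    using wvec_in_weight_space[OF word] unfolding hw_space_def by blast
  then have "wvec [1] \<in> specht 1 (sub 1)" by (simp only: specht_eq_hw_space[OF small.part])
  moreover have vec: "tab_vec lam T 1 = wvec [1]" by simp
  ultimately show "tab_vec lam T 1 \<in> specht 1 (sub 1)" by (simp only:)
  have "wvec [1] [1] = 1" by (simp add: wvec_def)
  then show "tab_vec lam T 1 \<noteq> 0" unfolding vec by (metis zero_fun_apply zero_neq_one)
  have box: "(row_of (sub 1) T 1, col_of (sub 1) T 1) \<in> diagram (sub 1)"
    by (rule small.box_in_diagram[OF one])
  have D: "(1, 1) \<in> diagram (sub 1)"
    by (rule diagram_upward[OF small.part box]) (use small.row_bounds[OF one] small.col_bounds[OF one] in simp_all)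
  have "T (1, 1) = 1" using small.T_in[OF D] by simp
  then have "col_of (sub 1) T 1 = 1" using small.col_T[OF D] by simp
  then have "row 1 = 1" "col 1 = 1" using row1 row_col_subshape[OF assms one] by simp_all
  then show "jucys_murphy 1 1 (tab_vec lam T 1) = cscale (of_nat (col 1) - of_nat (row 1)) (tab_vec lam T 1)"
    by (simp only: jucys_murphy_def atLeastLessThan_empty order_refl sum.empty diff_self cfun.scale_zero_left)
qed

text \<open>Membership in the Specht module and nonvanishing are part of the induction, as both are needed for
  the next projection to be nonzero.\<close>

lemma jucys_murphy_tab_vec:
  assumes "1 \<le> m" "m \<le> n"
  shows "tab_vec lam T m \<in> specht m (sub m) \<and> tab_vec lam T m \<noteq> 0 \<and>
    (\<forall>k\<in>{1..m}. jucys_murphy m k (tab_vec lam T m)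
      = cscale (of_nat (col k) - of_nat (row k)) (tab_vec lam T m))"
  using assms
proof (induction m rule: dec_induct)
  case base
  have "{1..1} = {1::nat}" by simp
  then show ?case using jucys_murphy_tab_vec_1[OF base] by (simp only: ball_simps simp_thms)
next
  case (step m)
  let ?c = "\<lambda>k. of_nat (col k) - of_nat (row k) :: complex"
  let ?v = "tab_vec lam T m"
  let ?la = "sub m" and ?mu = "sub (Suc m)" and ?r = "row (Suc m)"
  have m: "Suc m \<le> n" "m \<le> n" using step.prems by simp_all
  have v: "?v \<in> specht m ?la" "?v \<noteq> 0"
    and jm: "\<And>k. k \<in> {1..m} \<Longrightarrow> jucys_murphy m k ?v = cscale (?c k) ?v"
    using step.IH[OF m(2)] by blast+
  interpret big: standard ?mu "Suc m" T by (rule standard_subshape[OF m(1)])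
  interpret small: standard ?la m T by (rule standard_subshape[OF m(2)])
  note corner = subshape_corner[OF m(1)]
  have k: "Suc m \<in> {1..Suc m}" by simp
  have rle: "?r \<le> Suc m"
    using big.row_bounds[OF k] row_col_subshape[OF m(1) k] by simp
  have vM: "?v \<in> small.M" using v(1) small.S_M by blast
  have vW: "?v \<in> word_space m" using vM weight_space_subset by blast
  define x where "x = add_letter m ?r ?v"
  have xM: "x \<in> big.M"
    unfolding x_def by (rule add_letter_in_weight_space[OF big.part corner(1,2)]) (use vM corner(3) in simp)
  define p where "p = isotypic_proj (Suc m) big.M big.S x"
  have next_eq: "tab_vec lam T (Suc m) = p"
  proof -
    obtain m' where "m = Suc m'" using step.hyps by (cases m) auto
    then show ?thesis by (simp only: tab_vec.simps lifting_def p_def x_def)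
  qed
  have pS: "p \<in> big.S" unfolding p_def by (rule big.isotypic_proj_properties[OF xM])
  have vS: "?v \<in> specht m (?mu(?r := ?mu ?r - 1))" using v(1) corner(3) by (simp only:)
  have "p \<noteq> 0"
    unfolding p_def x_def
    by (rule big.isotypic_proj_add_letter_nonzero[OF corner(1) rle corner(2) refl vS v(2) vW
          xM[unfolded x_def]])
  have jm_p: "jucys_murphy (Suc m) k p = cscale (?c k) p" if k: "k \<in> {1..m}" for k
    unfolding p_def
  proof (rule big.isotypic_proj_jucys_murphy[OF xM])
    show "k \<in> {1..Suc m}" using k by simp
    show "jucys_murphy (Suc m) k x = cscale (?c k) x"
      unfolding x_def
      by (simp only: jucys_murphy_add_letter[OF vW corner(1) rle k] jm[OF k] add_letter_scale)
  qed
  \<comment> \<open>The new eigenvalue is what the total content leaves after the old ones.\<close>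
  have jm_last: "jucys_murphy (Suc m) (Suc m) p = cscale (?c (Suc m)) p"
  proof -
    have ins: "{1..Suc m} = insert (Suc m) {1..m}" by auto
    have "content ?mu = (\<Sum>k\<in>{1..Suc m}. ?c k)"
      unfolding big.content_eq
      by (rule sum.cong[OF refl]) (simp only: row_col_subshape[OF m(1)])
    also have "\<dots> = ?c (Suc m) + (\<Sum>k\<in>{1..m}. ?c k)"
      unfolding ins by (rule sum.insert) auto
    finally have content: "content ?mu = ?c (Suc m) + (\<Sum>k\<in>{1..m}. ?c k)" .
    have "jucys_murphy (Suc m) (Suc m) p + (\<Sum>k\<in>{1..m}. jucys_murphy (Suc m) k p)
        = (\<Sum>k\<in>{1..Suc m}. jucys_murphy (Suc m) k p)"
      unfolding ins by (rule sum.insert[symmetric]) auto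
    also have "\<dots> = cscale (content ?mu) p" by (rule sum_jucys_murphy_specht[OF big.part pS])
    also have "\<dots> = cscale (?c (Suc m)) p + (\<Sum>k\<in>{1..m}. cscale (?c k) p)"
      by (simp only: content cfun.scale_left_distrib cfun.scale_sum_left)
    also have "(\<Sum>k\<in>{1..m}. cscale (?c k) p) = (\<Sum>k\<in>{1..m}. jucys_murphy (Suc m) k p)"
      by (rule sum.cong[OF refl]) (rule jm_p[symmetric])
    finally show ?thesis by (simp only: add_right_cancel)
  qed
  have "jucys_murphy (Suc m) k p = cscale (?c k) p" if "k \<in> {1..Suc m}" for k
  proof (cases "k = Suc m")
    case True
    then show ?thesis by (simp only: jm_last)
  next
    case False
    then have "k \<in> {1..m}" using that by auto
    then show ?thesis by (rule jm_p)
  qed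
  then show ?case using pS \<open>p \<noteq> 0\<close> unfolding next_eq by blast
qed

lemma walk_sum_tab_vec:
  assumes n: "1 \<le> n"
  shows "tab_vec lam T n \<noteq> 0"
    "galg_act n (walk_sum n) (tab_vec lam T n)
      = cscale (\<Sum>(i, j)\<in>diagram lam. (of_nat j - of_nat i + 1) / of_nat (T (i, j))) (tab_vec lam T n)"
proof -
  let ?v = "tab_vec lam T n"
  have v: "?v \<in> specht n lam" "?v \<noteq> 0"
    and jm: "\<And>k. k \<in> {1..n} \<Longrightarrow> jucys_murphy n k ?v = cscale (of_nat (col k) - of_nat (row k)) ?v"
    using jucys_murphy_tab_vec[OF n order_refl] unfolding subshape_full by blast+
  show "?v \<noteq> 0" by (rule v(2))
  have "galg_act n (walk_sum n) ?v = (\<Sum>k\<in>{1..n}. cscale (1 / of_nat k) (?v + jucys_murphy n k ?v))"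
    by (rule galg_act_walk_sum[OF subsetD[OF S_words v(1)]])
  also have "\<dots> = (\<Sum>k\<in>{1..n}. cscale ((of_nat (col k) - of_nat (row k) + 1) / of_nat k) ?v)"
  proof (rule sum.cong[OF refl])
    fix k assume k: "k \<in> {1..n}"
    show "cscale (1 / of_nat k) (?v + jucys_murphy n k ?v)
        = cscale ((of_nat (col k) - of_nat (row k) + 1) / of_nat k) ?v"
      unfolding jm[OF k] by (rule ext) (use k in \<open>simp add: field_simps\<close>)
  qed
  also have "\<dots> = cscale (\<Sum>k\<in>{1..n}. (of_nat (col k) - of_nat (row k) + 1) / of_nat k) ?v"
    by (rule cfun.scale_sum_left[symmetric])
  also have "(\<Sum>k\<in>{1..n}. (of_nat (col k) - of_nat (row k) + 1) / of_nat k)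
      = (\<Sum>b\<in>diagram lam. (of_nat (col (T b)) - of_nat (row (T b)) + 1) / (of_nat (T b) :: complex))"
    by (rule sum.reindex_bij_betw[OF bij, symmetric])
  also have "\<dots> = (\<Sum>(i, j)\<in>diagram lam. (of_nat j - of_nat i + 1) / of_nat (T (i, j)))"
    by (rule sum.cong) auto
  finally show "galg_act n (walk_sum n) ?v
      = cscale (\<Sum>(i, j)\<in>diagram lam. (of_nat j - of_nat i + 1) / of_nat (T (i, j))) ?v" .
qed

end

lemma eigenvalue_unique:
  assumes "is_eigenvector n a c v" "is_eigenvector n a d v"
  shows "c = d"
proof -
  have eq: "cscale c v = cscale d v" and "v \<noteq> 0" using assms by (auto simp only: is_eigenvector_def)
  then show ?thesis using cfun.scale_right_imp_eq by blast
qed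

theorem lemma6:
  fixes lam :: "nat \<Rightarrow> nat" and n :: nat and T :: tableau
  assumes "n \<ge> 1" and "is_partition lam n" and "is_syt lam n T"
  shows "is_eigenvector n (cscale (1 / of_nat n) (walk_sum n)) (eig lam n T) (tab_vec lam T n) \<and>
    eig lam n T =
      1 / of_nat n * (\<Sum>(i, j)\<in>diagram lam. (of_nat j - of_nat i + 1) / of_nat (T (i, j)))"
proof -
  let ?a = "cscale (1 / of_nat n) (walk_sum n)" and ?v = "tab_vec lam T n"
  let ?e = "1 / of_nat n * (\<Sum>(i, j)\<in>diagram lam. (of_nat j - of_nat i + 1) / of_nat (T (i, j))) :: complex"
  interpret standard lam n T
    by unfold_locales (fact assms(2), use assms(3) in \<open>simp only: is_syt_def\<close>, fact assms(3))
  have ev: "is_eigenvector n ?a ?e ?v"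
    unfolding is_eigenvector_def
    by (simp only: galg_act_scale walk_sum_tab_vec[OF assms(1)] cfun.scale_scale simp_thms)
  have "eig lam n T = ?e"
    unfolding eig_def using ev eigenvalue_unique[OF _ ev] by (rule the_equality)
  then show ?thesis using ev by (simp only: simp_thms)
qed

end
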